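(* Let $\mathcal{N}$ be a super nebula and let $\mathcal{G}$ be a $\Delta$galaxy. Then the pair $\{\mathcal{N},\mathcal{G}\}$ satisfies the Erdős–Hajnal conjecture: there exists $\epsilon(\mathcal{N},\mathcal{G})>0$ such that every tournament $T$ that contains neither $\mathcal{N}$ nor $\mathcal{G}$ contains a transitive subtournament of size at least $|T|^{\epsilon(\mathcal{N},\mathcal{G})}$.
   Context: All tournaments are finite. A tournament $T$ contains a tournament $H$ if $H$ is isomorphic to the subtournament $T|X$ induced by some $X\subseteq V(T)$. A tournament is transitive if it has no directed cycle. We write $u\to v$ if $(u,v)$ is an arc. Orderings. Let $\theta=(v_1,\dots,v_n)$ be an ordering of $V(T)$. An arc $(v_i,v_j)$ is backward under $\theta$ if $i>j$ (otherwise forward). A vertex $v_j$ is between $v_i$ and $v_k$ if $i<j<k$ or $k<j<i$; a vertex is between leaves of some structure if it is between two of its leaves. For $Y\subseteq V(T)$, the restriction of $\theta$ to $Y$ is the induced order on $Y$. Stars. A tournament $S$ with vertices $u_1,\dots,u_p$ is a right star (resp. left star) under the ordering $(u_1,\dots,u_p)$ if its backward arcs under this ordering are exactly $(u_p,u_i)$ for $i=1,\dots,p-1$ (resp. exactly $(u_i,u_1)$ for $i=2,\dots,p$); it is a middle star if for some $2\le r\le p-1$ its backward arcs are exactly $(u_i,u_r)$ for $i=r+1,\dots,p$ and $(u_r,u_i)$ for $i=1,\dots,r-1$. The center is $u_p$ (resp. $u_1$, resp. $u_r$) and the other vertices are the leaves; for $p=2$ either vertex may be chosen as center. A star is a left,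 right or middle star; a frontier star is a left or right star. Super $2$-nebulas. Let $T$ be a tournament with ordering $\theta=(v_1,\dots,v_n)$ such that $V(T)=V(Q_1)\cup V(Q_2)$ (disjoint), where for $i=1,2$ the tournament $T|V(Q_i)$ is a frontier star with star ordering the restriction of $\theta$, every backward arc of $T$ under $\theta$ has both ends in the same $V(Q_i)$, and either all leaves of $Q_1,Q_2$ precede both centers in $\theta$, or all leaves lie between the two centers, or all leaves come after both centers. A tournament $H$ with ordering $\theta$ is a super $2$-nebula under $\theta$ if it is obtained from such a $T$ by reversing the arc joining the two centers of $Q_1$ and $Q_2$; the centers and leaves of $Q_1,Q_2$ are the centers and leaves of $H$. Super nebula. A tournament $T$ is a super nebula if there is an ordering $\theta$ of $V(T)$ and a partition $V(T)=V(Q_1)\cup\dots\cup V(Q_m)\cup V(\Sigma_1)\cup\dots\cup V(\Sigma_l)\cup X$ such that: each $T|V(Q_i)$ is a star whose star ordering is the restriction of $\theta$; each $T|V(\Sigma_j)$ is a super $2$-nebula under the restriction of $\theta$; every backward arc of $T$ under $\theta$ has both ends in the same part $V(Q_i)$ or $V(\Sigma_j)$ (so vertices of $X$ are incident to no backward arc); no center of a star $Q_i$ is between leaves of some $\Sigma_j$; and no center of a $\Sigma_j$ is between leaves of another $\Sigma_{j'}$. Galaxy. A tournament $T$ is a galaxy under an ordering $\theta$ if $V(T)=V(Q_1)\cup\dots\cup V(Q_l)\cup X$ (disjoint) where each $T|V(Q_i)$ is a frontier star with star ordering the restriction of $\theta$, every backward arc has both ends in the same $V(Q_i)$, and no center of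 a star $Q_i$ is between leaves of another star $Q_{i'}$. Triangles and $\Delta$galaxies. Under an ordering $\theta=(v_1,\dots,v_n)$, a triangle is a set $\{v_{i_1},v_{i_2},v_{i_3}\}$ with $i_1<i_2<i_3$ and $v_{i_2}\to v_{i_1}$, $v_{i_3}\to v_{i_1}$, $v_{i_3}\to v_{i_2}$; $v_{i_2}$ is its center and $v_{i_1},v_{i_3}$ its left and right exteriors. A tournament $T$ is a triangular galaxy under $\theta$ if $V(T)=V(\Delta_1)\cup\dots\cup V(\Delta_l)\cup X$ (disjoint) where each $\Delta_i$ is a triangle under $\theta$, every backward arc of $T$ under $\theta$ has both ends in the same $V(\Delta_i)$ or both ends in $X$, $T|X$ is a galaxy under the restriction of $\theta$ to $X$, and no vertex of any triangle is between leaves of a star of $T|X$. A $\Delta$galaxy is a triangular galaxy (under some ordering) with exactly one triangle ($l=1$). *)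

theory Defs
  imports Complex_Main "HOL-Library.Disjoint_Sets" "Graph_Theory.Graph_Theory"
begin

section \<open>Tournaments\<close>

locale tournament = pair_digraph T for T :: "'a pair_pre_digraph" +
  assumes exactly_one_arc:
    "\<lbrakk>u \<in> pverts T; v \<in> pverts T; u \<noteq> v\<rbrakk> \<Longrightarrow> (u, v) \<in> parcs T \<longleftrightarrow> (v, u) \<notin> parcs T"

definition subtournament :: "'a pair_pre_digraph \<Rightarrow> 'a set \<Rightarrow> 'a pair_pre_digraph" where
  "subtournament T X = \<lparr> pverts = X, parcs = parcs T \<inter> X \<times> X \<rparr>"

lemma with_proj_subtournament: "with_proj (subtournament T X) = with_proj T \<restriction> X"
  by (auto simp: subtournament_def with_proj_def induce_subgraph_def)

definition contains :: "'a pair_pre_digraph \<Rightarrow> 'b pair_pre_digraph \<Rightarrow> bool" where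
  "contains T H \<longleftrightarrow>
    (\<exists>X. X \<subseteq> pverts T \<and> digraph_iso (with_proj H) (with_proj (subtournament T X)))"

definition transitive_tournament :: "'a pair_pre_digraph \<Rightarrow> bool" where
  "transitive_tournament T \<longleftrightarrow> tournament T \<and> (\<nexists>p. pre_digraph.cycle (with_proj T) p)"


section \<open>Orderings\<close>

text \<open>An ordering of the vertices is a duplicate-free list, with positions counted from 0.\<close>

definition tournament_ordering :: "'a pair_pre_digraph \<Rightarrow> 'a list \<Rightarrow> bool" where
  "tournament_ordering T \<theta> \<longleftrightarrow> tournament T \<and> distinct \<theta> \<and> set \<theta> = pverts T"

definition before :: "'a list \<Rightarrow> 'a \<Rightarrow> 'a \<Rightarrow> bool" where
  "before \<theta> u v \<longleftrightarrow> (\<exists>i j. i < j \<and> j < length \<theta> \<and> \<theta> ! i = u \<and> \<theta> ! j = v)"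

definition between :: "'a list \<Rightarrow> 'a \<Rightarrow> 'a \<Rightarrow> 'a \<Rightarrow> bool" where
  "between \<theta> v x y \<longleftrightarrow> before \<theta> x v \<and> before \<theta> v y \<or> before \<theta> y v \<and> before \<theta> v x"

definition between_leaves :: "'a list \<Rightarrow> 'a \<Rightarrow> 'a set \<Rightarrow> bool" where
  "between_leaves \<theta> v L \<longleftrightarrow> (\<exists>x\<in>L. \<exists>y\<in>L. between \<theta> v x y)"

definition restrict_ordering :: "'a list \<Rightarrow> 'a set \<Rightarrow> 'a list" where
  "restrict_ordering \<theta> Y = filter (\<lambda>v. v \<in> Y) \<theta>"

definition backward_arcs :: "'a pair_pre_digraph \<Rightarrow> 'a list \<Rightarrow> ('a \<times> 'a) set" where
  "backward_arcs T \<theta> = {(u, v). (u, v) \<in> parcs T \<and> before \<theta> v u}"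


section \<open>Stars\<close>

text \<open>
  The last argument is the center; the leaves are all other vertices. For two vertices the
  left and the right star have the same backward arc, so either vertex can serve as center.
\<close>

definition right_star :: "'a pair_pre_digraph \<Rightarrow> 'a list \<Rightarrow> 'a \<Rightarrow> bool" where
  "right_star S us c \<longleftrightarrow> tournament_ordering S us \<and> us \<noteq> [] \<and> c = last us \<and>
    backward_arcs S us = {(c, us ! i) | i. i < length us - 1}"

definition left_star :: "'a pair_pre_digraph \<Rightarrow> 'a list \<Rightarrow> 'a \<Rightarrow> bool" where
  "left_star S us c \<longleftrightarrow> tournament_ordering S us \<and> us \<noteq> [] \<and> c = hd us \<and>
    backward_arcs S us = {(us ! i, c) | i. 0 < i \<and> i < length us}"

definition middle_star :: "'a pair_pre_digraph \<Rightarrow> 'a list \<Rightarrow> 'a \<Rightarrow> bool" where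
  "middle_star S us c \<longleftrightarrow> tournament_ordering S us \<and>
    (\<exists>r. 0 < r \<and> r < length us - 1 \<and> c = us ! r \<and>
      backward_arcs S us =
        {(us ! i, us ! r) | i. r < i \<and> i < length us} \<union> {(us ! r, us ! i) | i. i < r})"

definition frontier_star :: "'a pair_pre_digraph \<Rightarrow> 'a list \<Rightarrow> 'a \<Rightarrow> bool" where
  "frontier_star S us c \<longleftrightarrow> left_star S us c \<or> right_star S us c"

definition star :: "'a pair_pre_digraph \<Rightarrow> 'a list \<Rightarrow> 'a \<Rightarrow> bool" where
  "star S us c \<longleftrightarrow> left_star S us c \<or> right_star S us c \<or> middle_star S us c"


section \<open>Super nebulas\<close>

definition reverse_arc :: "'a pair_pre_digraph \<Rightarrow> 'a \<Rightarrow> 'a \<Rightarrow> 'a pair_pre_digraph" where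
  "reverse_arc T a b = \<lparr> pverts = pverts T,
    parcs = {(u, v). if {u, v} = {a, b} then (v, u) \<in> parcs T else (u, v) \<in> parcs T} \<rparr>"

text \<open>The last two arguments are the centers; the leaves are all other vertices.\<close>

definition super_2_nebula :: "'a pair_pre_digraph \<Rightarrow> 'a list \<Rightarrow> 'a \<Rightarrow> 'a \<Rightarrow> bool" where
  "super_2_nebula H \<theta> c\<^sub>1 c\<^sub>2 \<longleftrightarrow>
    (\<exists>T Q\<^sub>1 Q\<^sub>2. tournament_ordering T \<theta> \<and> pverts T = Q\<^sub>1 \<union> Q\<^sub>2 \<and> Q\<^sub>1 \<inter> Q\<^sub>2 = {} \<and>
      frontier_star (subtournament T Q\<^sub>1) (restrict_ordering \<theta> Q\<^sub>1) c\<^sub>1 \<and>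
      frontier_star (subtournament T Q\<^sub>2) (restrict_ordering \<theta> Q\<^sub>2) c\<^sub>2 \<and>
      (\<forall>(u, v) \<in> backward_arcs T \<theta>. {u, v} \<subseteq> Q\<^sub>1 \<or> {u, v} \<subseteq> Q\<^sub>2) \<and>
      ((\<forall>v \<in> pverts T - {c\<^sub>1, c\<^sub>2}. before \<theta> v c\<^sub>1 \<and> before \<theta> v c\<^sub>2) \<or>
       (\<forall>v \<in> pverts T - {c\<^sub>1, c\<^sub>2}. between \<theta> v c\<^sub>1 c\<^sub>2) \<or>
       (\<forall>v \<in> pverts T - {c\<^sub>1, c\<^sub>2}. before \<theta> c\<^sub>1 v \<and> before \<theta> c\<^sub>2 v)) \<and>
      H = reverse_arc T c\<^sub>1 c\<^sub>2)"

text \<open>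
  The parts are the stars \<open>Q i\<close> with center \<open>a i\<close> (\<open>i < m\<close>), the super 2-nebulas \<open>S j\<close> with
  centers \<open>c j\<close> and \<open>d j\<close> (\<open>j < l\<close>), and \<open>X\<close>.
\<close>

definition super_nebula :: "'a pair_pre_digraph \<Rightarrow> bool" where
  "super_nebula T \<longleftrightarrow>
    (\<exists>\<theta> (m::nat) (l::nat) Q a S c d X.
      tournament_ordering T \<theta> \<and>
      pverts T = (\<Union>i<m. Q i) \<union> (\<Union>j<l. S j) \<union> X \<and>
      disjoint_family_on Q {..<m} \<and> disjoint_family_on S {..<l} \<and>
      (\<Union>i<m. Q i) \<inter> (\<Union>j<l. S j) = {} \<and> ((\<Union>i<m. Q i) \<union> (\<Union>j<l. S j)) \<inter> X = {} \<and>
      (\<forall>i<m. star (subtournament T (Q i)) (restrict_ordering \<theta> (Q i)) (a i)) \<and>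
      (\<forall>j<l. super_2_nebula (subtournament T (S j)) (restrict_ordering \<theta> (S j)) (c j) (d j)) \<and>
      (\<forall>(u, v) \<in> backward_arcs T \<theta>. (\<exists>i<m. {u, v} \<subseteq> Q i) \<or> (\<exists>j<l. {u, v} \<subseteq> S j)) \<and>
      (\<forall>i<m. \<forall>j<l. \<not> between_leaves \<theta> (a i) (S j - {c j, d j})) \<and>
      (\<forall>j<l. \<forall>j'<l. j \<noteq> j' \<longrightarrow>
        \<not> between_leaves \<theta> (c j) (S j' - {c j', d j'}) \<and>
        \<not> between_leaves \<theta> (d j) (S j' - {c j', d j'})))"


section \<open>Galaxies and triangular galaxies\<close>

definition galaxy_decomposition ::
  "'a pair_pre_digraph \<Rightarrow> 'a list \<Rightarrow> nat \<Rightarrow> (nat \<Rightarrow> 'a set) \<Rightarrow> (nat \<Rightarrow> 'a) \<Rightarrow> bool" where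
  "galaxy_decomposition T \<theta> m Q a \<longleftrightarrow>
    tournament_ordering T \<theta> \<and>
    (\<exists>X. pverts T = (\<Union>i<m. Q i) \<union> X \<and> (\<Union>i<m. Q i) \<inter> X = {}) \<and>
    disjoint_family_on Q {..<m} \<and>
    (\<forall>i<m. frontier_star (subtournament T (Q i)) (restrict_ordering \<theta> (Q i)) (a i)) \<and>
    (\<forall>(u, v) \<in> backward_arcs T \<theta>. \<exists>i<m. {u, v} \<subseteq> Q i) \<and>
    (\<forall>i<m. \<forall>i'<m. i \<noteq> i' \<longrightarrow> \<not> between_leaves \<theta> (a i) (Q i' - {a i'}))"

definition triangle :: "'a pair_pre_digraph \<Rightarrow> 'a list \<Rightarrow> 'a set \<Rightarrow> bool" where
  "triangle T \<theta> D \<longleftrightarrow>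
    (\<exists>x y z. D = {x, y, z} \<and> before \<theta> x y \<and> before \<theta> y z \<and>
      (y, x) \<in> parcs T \<and> (z, x) \<in> parcs T \<and> (z, y) \<in> parcs T)"

text \<open>
  The last argument is the number of triangles. The stars that no triangle vertex may split are
  those of the decomposition \<open>Q\<close> witnessing that \<open>X\<close> induces a galaxy.
\<close>

definition triangular_galaxy :: "'a pair_pre_digraph \<Rightarrow> 'a list \<Rightarrow> nat \<Rightarrow> bool" where
  "triangular_galaxy T \<theta> l \<longleftrightarrow>
    (\<exists>D X m Q a.
      tournament_ordering T \<theta> \<and>
      pverts T = (\<Union>i<l. D i) \<union> X \<and> (\<Union>i<l. D i) \<inter> X = {} \<and> disjoint_family_on D {..<l} \<and>
      (\<forall>i<l. triangle T \<theta> (D i)) \<and>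
      (\<forall>(u, v) \<in> backward_arcs T \<theta>. (\<exists>i<l. {u, v} \<subseteq> D i) \<or> {u, v} \<subseteq> X) \<and>
      galaxy_decomposition (subtournament T X) (restrict_ordering \<theta> X) m Q a \<and>
      (\<forall>i<l. \<forall>v \<in> D i. \<forall>k<m. \<not> between_leaves \<theta> v (Q k - {a k})))"

definition Delta_galaxy :: "'a pair_pre_digraph \<Rightarrow> bool" where
  "Delta_galaxy T \<longleftrightarrow> (\<exists>\<theta>. triangular_galaxy T \<theta> 1)"

end

theory Submission
  imports Defs
begin

text \<open>
  Suppose that every proper subset of \<open>T\<close> satisfies the claim but \<open>T\<close> itself does not. Embedding \<open>G\<close>
  vertex by vertex, in the manner of Erd\H{o}s and Hajnal, can only fail if there is a pair of
  linear-size sets with almost all arcs in one direction; iterating, \<open>T\<close> contains a long sequence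
  of linear-size sets whose arcs are almost all forward. Replace every second set by a transitive
  subset of nearly maximal size. Since \<open>T\<close> is a minimal counterexample, large subsets of two of these
  sets, at least one of them of linear size, always span a backward arc: otherwise their transitive
  subsets would combine into one that is too large.

  Centers are placed into linear sets and leaves into pieces of the transitive sets, so that any
  center finds backward arcs to all its leaves. For a galaxy this already gives an embedding, since
  the leaves of a star lie in one transitive set. For a super nebula the only obstruction is a
  backward triple on three different sets. Such a triple serves as the triangle of \<open>G\<close>, and the
  galaxy around it is embedded into sets kept in reserve between those used for \<open>N\<close>.
\<close>

section \<open>Finite sets\<close>

text \<open>Why a linear set must take part in every such pair is a matter of exponents. Put \<tau>
  = |V|^\<epsilon>, so that no transitive set of the minimal counterexample V reaches \<tau>. A
  fixed fraction 1/C of V contains a transitive set of size at least C^(-\<epsilon>) \<tau>, and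
  C^(-\<epsilon>) tends to 1 with \<epsilon>; a fixed fraction of a nearly maximal transitive set
  only retains \<eta> \<tau> for a constant \<eta>. Choosing \<epsilon> after all other constants
  raises the former bound to (1 - \<eta>) \<tau>. So a linear set and a piece together reach \<tau>,
  whereas two pieces need not. Centers thus cut the ordering into groups, each of which fits into
  one transitive set. The betweenness conditions in the definitions keep the leaves of a galaxy
  star, or of a super 2-nebula, in one group. Leaves of the other stars of a super nebula may be
  separated by centers; two of them joined by a backward arc would form a backward triple with their
  center, as would a leaf of a super 2-nebula that is backward to both centers.\<close>

lemma card_UN_small:
  fixes Z :: "'i \<Rightarrow> 'c set"
  assumes "finite L" "card L \<le> h" "0 < h" "\<And>l. l \<in> L \<Longrightarrow> c * h * card (Z l) \<le> n"
  shows "c * card (\<Union>l\<in>L. Z l) \<le> n"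
proof -
  have "h * (c * card (\<Union>l\<in>L. Z l)) \<le> h * (c * (\<Sum>l\<in>L. card (Z l)))"
    using card_UN_le[OF assms(1), of Z] by (simp add: mult_le_mono)
  also have "\<dots> = (\<Sum>l\<in>L. c * h * card (Z l))"
    by (simp add: sum_distrib_left mult_ac)
  also have "\<dots> \<le> card L * n"
    using sum_bounded_above[of L "\<lambda>l. c * h * card (Z l)" n] assms(4) by simp
  also have "\<dots> \<le> h * n"
    using assms(2) by simp
  finally show ?thesis
    using assms(3) by simp
qed

lemma card_cover_pigeonhole:
  assumes "finite L" "A \<subseteq> (\<Union>l\<in>L. Z l)" "\<And>l. l \<in> L \<Longrightarrow> finite (Z l)" "A \<noteq> {}"
  obtains l where "l \<in> L" "card A \<le> card L * card (Z l)"
proof -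
  have "\<exists>l\<in>L. card A \<le> card L * card (Z l)"
  proof (rule ccontr)
    assume "\<not> ?thesis"
    then have *: "\<And>l. l \<in> L \<Longrightarrow> card L * card (Z l) < card A" by force
    have ne: "L \<noteq> {}" using assms by auto
    have "card A \<le> card (\<Union>l\<in>L. Z l)"
      using assms by (intro card_mono) auto
    also have "\<dots> \<le> (\<Sum>l\<in>L. card (Z l))"
      using card_UN_le assms(1) by blast
    finally have "card L * card A \<le> (\<Sum>l\<in>L. card L * card (Z l))"
      by (simp add: sum_distrib_left[symmetric])
    also have "\<dots> < (\<Sum>l\<in>L. card A)"
      using * ne assms(1) by (intro sum_strict_mono) auto
    finally show False by simp
  qed
  then show ?thesis using that by blast
qed

lemma disjoint_parts:
  assumes "finite S" "finite W" "card S * m \<le> card W"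
  shows "\<exists>U. (\<forall>v\<in>S. U v \<subseteq> W \<and> card (U v) = m) \<and> disjoint_family_on U S"
  using assms
proof (induction S arbitrary: W rule: finite_induct)
  case empty
  then show ?case by (simp add: disjoint_family_on_def)
next
  case (insert v S)
  then have "m + card S * m \<le> card W" by simp
  then obtain A where A: "A \<subseteq> W" "card A = m" "finite A"
    using obtain_subset_with_card_n[of m W] by (metis add_leD1)
  have "card S * m \<le> card (W - A)"
    using A insert by (simp add: card_Diff_subset)
  then obtain U where U: "\<forall>v\<in>S. U v \<subseteq> W - A \<and> card (U v) = m" "disjoint_family_on U S"
    using insert.IH[of "W - A"] insert.prems by auto
  have "disjoint_family_on (U(v := A)) (insert v S)"
    using U insert.hyps unfolding disjoint_family_on_def by auto
  moreover have "\<forall>u\<in>insert v S. (U(v := A)) u \<subseteq> W \<and> card ((U(v := A)) u) = m"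
    using U A insert.hyps by auto
  ultimately show ?case by blast
qed

text \<open>Markov's inequality by double counting: the rows bound the number of pairs by
  \<open>card A * card B / (2 * D)\<close>, while every bad column contributes more than
  \<open>card A / D\<close>.\<close>

lemma half_of_columns_sparse:
  fixes Q :: "'b \<Rightarrow> 'd \<Rightarrow> bool"
  assumes "finite A" "finite B"
    and "\<And>a. a \<in> A \<Longrightarrow> 2 * D * card {b \<in> B. Q a b} \<le> card B"
  shows "card B \<le> 2 * card {b \<in> B. D * card {a \<in> A. Q a b} \<le> card A}"
proof -
  define Bad where "Bad = {b \<in> B. \<not> D * card {a \<in> A. Q a b} \<le> card A}"
  have fin: "finite Bad" using assms Bad_def by simp
  have "2 * (card Bad * card A) = 2 * (\<Sum>b\<in>Bad. card A)" by simp
  also have "\<dots> \<le> 2 * (\<Sum>b\<in>Bad. D * card {a \<in> A. Q a b})"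
    unfolding Bad_def by (intro mult_le_mono sum_mono) auto
  also have "\<dots> \<le> 2 * (\<Sum>b\<in>B. D * card {a \<in> A. Q a b})"
    using assms(2) Bad_def by (intro mult_le_mono sum_mono2) auto
  also have "(\<Sum>b\<in>B. D * card {a \<in> A. Q a b}) = D * (\<Sum>b\<in>B. \<Sum>a\<in>A. if Q a b then 1 else 0)"
    using assms(1) by (simp add: sum_distrib_left sum.If_cases Int_def)
  also have "(\<Sum>b\<in>B. \<Sum>a\<in>A. if Q a b then 1 else 0 :: nat) = (\<Sum>a\<in>A. \<Sum>b\<in>B. if Q a b then 1 else 0)"
    by (rule sum.swap)
  also have "\<dots> = (\<Sum>a\<in>A. card {b \<in> B. Q a b})"
    using assms(2) by (simp add: sum.If_cases Int_def)
  also have "2 * (D * \<dots>) = (\<Sum>a\<in>A. 2 * D * card {b \<in> B. Q a b})"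
    by (simp add: sum_distrib_left mult_ac)
  also have "\<dots> \<le> card A * card B"
    using sum_bounded_above[of A "\<lambda>a. 2 * D * card {b \<in> B. Q a b}" "card B"] assms(3) by simp
  finally have *: "card A * (2 * card Bad) \<le> card A * card B" by (simp add: mult_ac)
  have "2 * card Bad \<le> card B"
  \<comment> \<open>The factor \<open>card A\<close> can be cancelled only if it is nonzero; for
    empty \<open>A\<close> no column is bad.\<close>
  proof (cases "card A = 0")
    case True
    then have "Bad = {}" using assms(1) unfolding Bad_def by simp
    then show ?thesis by simp
  next
    case False
    then show ?thesis using * by simp
  qed
  moreover have "card B = card Bad + card {b \<in> B. D * card {a \<in> A. Q a b} \<le> card A}"
  proof -
    have "B = Bad \<union> {b \<in> B. D * card {a \<in> A. Q a b} \<le> card A}" unfolding Bad_def by auto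
    then show ?thesis
      using card_Un_disjoint[of Bad "{b \<in> B. D * card {a \<in> A. Q a b} \<le> card A}"] assms(2) fin
      unfolding Bad_def by auto
  qed
  ultimately show ?thesis by linarith
qed

section \<open>Tournaments as relations\<close>

locale tournament_arcs =
  fixes V :: "'c set" and E :: "'c \<Rightarrow> 'c \<Rightarrow> bool"
  assumes finite_V: "finite V"
    and irrefl: "u \<in> V \<Longrightarrow> \<not> E u u"
    and total: "u \<in> V \<Longrightarrow> v \<in> V \<Longrightarrow> u \<noteq> v \<Longrightarrow> E u v \<longleftrightarrow> \<not> E v u"
begin

lemma finite_sub: "W \<subseteq> V \<Longrightarrow> finite W"
  using finite_V finite_subset by blast

text \<open>Exceptions are bounded at each single vertex and from both sides, because an embedded
  vertex, whichever it is, must leave most of every other set usable. This is the smoothness on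
  which the greedy embedding rests. The fraction \<open>1 / D\<close> is written as a product to
  stay within the naturals.\<close>

definition mostly_forward :: "nat \<Rightarrow> 'c set \<Rightarrow> 'c set \<Rightarrow> bool" where
  "mostly_forward D A B \<longleftrightarrow> A \<inter> B = {} \<and>
    (\<forall>a\<in>A. D * card {b \<in> B. \<not> E a b} \<le> card B) \<and>
    (\<forall>b\<in>B. D * card {a \<in> A. \<not> E a b} \<le> card A)"

text \<open>Exceptions can only disappear while the sets shrink by at most the factor
  \<open>c\<close>, so the density loses no more than this factor.\<close>

lemma mostly_forward_subsets:
  assumes "mostly_forward (c * D) A B" "A' \<subseteq> A" "B' \<subseteq> B" "A \<subseteq> V" "B \<subseteq> V"
    and "card A \<le> c * card A'" "card B \<le> c * card B'" "0 < c"
  shows "mostly_forward D A' B'"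
  unfolding mostly_forward_def
proof (intro conjI ballI)
  show "A' \<inter> B' = {}" using assms unfolding mostly_forward_def by auto
next
  fix a assume a: "a \<in> A'"
  have "card {b \<in> B'. \<not> E a b} \<le> card {b \<in> B. \<not> E a b}"
    using assms finite_sub by (intro card_mono) auto
  then have "c * (D * card {b \<in> B'. \<not> E a b}) \<le> c * D * card {b \<in> B. \<not> E a b}"
    by (simp add: mult.assoc)
  also have "\<dots> \<le> card B" using assms(1,2) a unfolding mostly_forward_def by auto
  also have "\<dots> \<le> c * card B'" by fact
  finally show "D * card {b \<in> B'. \<not> E a b} \<le> card B'" using \<open>0 < c\<close> by simp
next
  fix b assume b: "b \<in> B'"
  have "card {a \<in> A'. \<not> E a b} \<le> card {a \<in> A. \<not> E a b}"
    using assms finite_sub by (intro card_mono) auto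
  then have "c * (D * card {a \<in> A'. \<not> E a b}) \<le> c * D * card {a \<in> A. \<not> E a b}"
    by (simp add: mult.assoc)
  also have "\<dots> \<le> card A" using assms(1,3) b unfolding mostly_forward_def by auto
  also have "\<dots> \<le> c * card A'" by fact
  finally show "D * card {a \<in> A'. \<not> E a b} \<le> card A'" using \<open>0 < c\<close> by simp
qed

lemma mostly_forward_complete:
  assumes "A \<subseteq> V" "B \<subseteq> V" "\<And>a b. a \<in> A \<Longrightarrow> b \<in> B \<Longrightarrow> E a b"
  shows "mostly_forward D A B"
proof -
  have "card {b \<in> B. \<not> E a b} = 0" if "a \<in> A" for a
    using assms(3) that by (subst card_eq_0_iff) auto
  moreover have "card {a \<in> A. \<not> E a b} = 0" if "b \<in> B" for b
    using assms(3) that by (subst card_eq_0_iff) auto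
  moreover have "A \<inter> B = {}" using assms irrefl by blast
  ultimately show ?thesis unfolding mostly_forward_def by (simp del: card_eq_0_iff)
qed

text \<open>Turns a one-sided bound into the two-sided one. Dropping the vertices of
  \<open>B\<close> with too many exceptions leaves half of \<open>B\<close> by averaging; the factor
  2 in the hypothesis pays both for the averaging and for the smaller \<open>B\<close>. The loss
  does not depend on the sizes of the sets, so one of them may be tiny.\<close>

lemma mostly_forward_restrict_right:
  assumes "A \<subseteq> V" "B \<subseteq> V" "A \<inter> B = {}"
    and "\<And>a. a \<in> A \<Longrightarrow> 2 * D * card {b \<in> B. \<not> E a b} \<le> card B"
  obtains B' where "B' \<subseteq> B" "card B \<le> 2 * card B'" "mostly_forward D A B'"
proof
  let ?B = "{b \<in> B. D * card {a \<in> A. \<not> E a b} \<le> card A}"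
  show "?B \<subseteq> B" by auto
  show half: "card B \<le> 2 * card ?B"
    using half_of_columns_sparse[of A B D "\<lambda>a b. \<not> E a b"] assms finite_sub by auto
  have "D * card {b \<in> ?B. \<not> E a b} \<le> card ?B" if "a \<in> A" for a
  proof -
    have "card {b \<in> ?B. \<not> E a b} \<le> card {b \<in> B. \<not> E a b}"
      using assms finite_sub by (intro card_mono) auto
    then have "2 * (D * card {b \<in> ?B. \<not> E a b}) \<le> 2 * D * card {b \<in> B. \<not> E a b}" by simp
    also have "\<dots> \<le> card B" using assms(4) that .
    finally show ?thesis using half by linarith
  qed
  then show "mostly_forward D A ?B"
    unfolding mostly_forward_def using assms(3) by auto
qed

text \<open>Reversing all arcs swaps the two sides of a mostly forward pair, so the left version
  below is inherited from the right one.\<close>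

lemma reversed: "tournament_arcs V (\<lambda>u v. E v u)"
  using finite_V irrefl total by unfold_locales blast+

lemma mostly_forward_restrict_left:
  assumes "A \<subseteq> V" "B \<subseteq> V" "A \<inter> B = {}"
    and "\<And>b. b \<in> B \<Longrightarrow> 2 * D * card {a \<in> A. \<not> E a b} \<le> card A"
  obtains A' where "A' \<subseteq> A" "card A \<le> 2 * card A'" "mostly_forward D A' B"
proof -
  interpret r: tournament_arcs V "\<lambda>u v. E v u" by (rule reversed)
  obtain A' where "A' \<subseteq> A" "card A \<le> 2 * card A'" "r.mostly_forward D B A'"
    using r.mostly_forward_restrict_right[of B A D] assms by blast
  then show ?thesis
    using that unfolding r.mostly_forward_def mostly_forward_def by (simp add: Int_commute)
qed

section \<open>Transitive subsets\<close>

lemma transp_on_union: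
  assumes "A \<subseteq> V" "B \<subseteq> V" "transp_on A E" "transp_on B E"
    and "\<And>a b. a \<in> A \<Longrightarrow> b \<in> B \<Longrightarrow> E a b"
  shows "transp_on (A \<union> B) E"
proof (rule transp_onI)
  fix x y z assume xyz: "x \<in> A \<union> B" "y \<in> A \<union> B" "z \<in> A \<union> B" "E x y" "E y z"
  have no: "\<not> E b a" if "a \<in> A" "b \<in> B" for a b
    using assms total irrefl that by (metis subsetD)
  show "E x z"
    using xyz no assms(5) transp_onD[OF assms(3)] transp_onD[OF assms(4)] by (metis Un_iff)
qed

text \<open>A vertex together with a transitive subset of the larger of its two neighbourhoods. The
  lemma serves to push any strict upper bound on transitive sets above a prescribed constant once
  \<open>V\<close> is large.\<close>

lemma transitive_set_of_log_size:
  assumes "W \<subseteq> V" "2 ^ m \<le> card W"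
  shows "\<exists>X\<subseteq>W. transp_on X E \<and> card X = m"
  using assms
proof (induction m arbitrary: W)
  case 0
  then show ?case by (intro exI[of _ "{}"]) (simp add: transp_on_def)
next
  case (Suc m)
  have fin: "finite W" using Suc.prems finite_sub by blast
  have "card W > 0" using Suc.prems by (metis less_le_trans zero_less_numeral zero_less_power)
  then obtain v where v: "v \<in> W" by fastforce
  define Out where "Out = {w \<in> W. E v w}"
  define In where "In = {w \<in> W. E w v}"
  have sv: "transp_on {v} E" by (simp add: transp_on_def)
  have sub: "Out \<subseteq> W" "In \<subseteq> W" "v \<notin> Out" "v \<notin> In"
    using Out_def In_def Suc.prems v irrefl by auto
  have "E v w \<or> E w v" if "w \<in> W - {v}" for w
    using Suc.prems(1) v that total[of v w] by auto
  then have "W - {v} = Out \<union> In"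
    using Suc.prems v irrefl unfolding Out_def In_def by auto
  then have "card W - 1 \<le> card Out + card In"
    using card_Un_le[of Out In] v fin by (metis card_Diff_singleton)
  \<comment> \<open>Together the neighbourhoods have at least \<open>2 ^ Suc m - 1\<close> vertices,
    one more than two sets below \<open>2 ^ m\<close> could have.\<close>
  then have "2 ^ m \<le> card Out \<or> 2 ^ m \<le> card In" using Suc.prems(2) \<open>card W > 0\<close> by auto
  then show ?case
  proof
    assume "2 ^ m \<le> card Out"
    then obtain X where X: "X \<subseteq> Out" "transp_on X E" "card X = m"
      using Suc.IH[of Out] sub Suc.prems by blast
    have "transp_on ({v} \<union> X) E"
      using X(1,2) v Suc.prems(1) sub(1) sv unfolding Out_def by (intro transp_on_union) auto
    moreover have "card ({v} \<union> X) = Suc m"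
    proof -
      have "v \<notin> X" "finite X" using X(1) sub finite_subset[OF _ fin, of X] by auto
      then show ?thesis using X(3) by simp
    qed
    ultimately show ?thesis using X sub v by blast
  next
    assume "2 ^ m \<le> card In"
    then obtain X where X: "X \<subseteq> In" "transp_on X E" "card X = m"
      using Suc.IH[of In] sub Suc.prems by blast
    have "transp_on (X \<union> {v}) E"
      using X(1,2) v Suc.prems(1) sub(2) sv unfolding In_def by (intro transp_on_union) auto
    moreover have "card (X \<union> {v}) = Suc m"
    proof -
      have "v \<notin> X" "finite X" using X(1) sub finite_subset[OF _ fin, of X] by auto
      then show ?thesis using X(3) by simp
    qed
    ultimately show ?thesis using X sub v by blast
  qed
qed

lemma transitive_source:
  assumes "finite B" "B \<noteq> {}" "B \<subseteq> V" "transp_on B E"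
  shows "\<exists>s\<in>B. \<forall>b\<in>B - {s}. E s b"
  using assms
proof (induction B rule: finite_ne_induct)
  case (singleton x)
  then show ?case by auto
next
  case (insert x B)
  then obtain s where s: "s \<in> B" "\<forall>b\<in>B - {s}. E s b"
    using transp_on_subset[of "insert x B" E B] by auto
  show ?case
  proof (cases "E x s")
    case True
    have "E x b" if "b \<in> B" for b
      using s that True transp_onD[OF insert.prems(2), of x s b] by blast
    then show ?thesis by auto
  next
    case False
    then have "E s x" using total s insert.prems(1) insert.hyps by (metis insert_subset subsetD)
    then show ?thesis using s by auto
  qed
qed

lemma transitive_initial_segment:
  assumes "B \<subseteq> V" "transp_on B E" "s \<le> card B"
  shows "\<exists>C\<subseteq>B. card C = s \<and> (\<forall>c\<in>C. \<forall>b\<in>B - C. E c b)"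
  using assms(3)
proof (induction s)
  case 0
  then show ?case by (intro exI[of _ "{}"]) simp
next
  case (Suc s)
  then obtain C where C: "C \<subseteq> B" "card C = s" "\<forall>c\<in>C. \<forall>b\<in>B - C. E c b" by auto
  have fin: "finite B" using assms finite_sub by blast
  have "B - C \<noteq> {}" using C Suc.prems by (metis Diff_eq_empty_iff card_mono finite_subset[OF _ fin] not_less_eq_eq)
  then obtain x where x: "x \<in> B - C" "\<forall>b\<in>(B - C) - {x}. E x b"
    using transitive_source[of "B - C"] fin assms transp_on_subset[of B E "B - C"] by auto
  have "card (insert x C) = Suc s" using C x fin finite_subset by fastforce
  moreover have "\<forall>c\<in>insert x C. \<forall>b\<in>B - insert x C. E c b" using C x by auto
  ultimately show ?case using C x by (intro exI[of _ "insert x C"]) auto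
qed

text \<open>The linear order of a transitive set is cut into consecutive intervals, so that pattern
  vertices sent to increasing intervals get forward arcs whatever vertices are chosen there.\<close>

lemma transitive_pieces:
  assumes "B \<subseteq> V" "transp_on B E" "P * s \<le> card B"
  shows "\<exists>G. (\<forall>r<P. G r \<subseteq> B \<and> card (G r) = s) \<and>
    (\<forall>r r'. r < r' \<longrightarrow> r' < P \<longrightarrow> (\<forall>a\<in>G r. \<forall>b\<in>G r'. E a b))"
  using assms
proof (induction P arbitrary: B)
  case 0
  then show ?case by simp
next
  case (Suc P)
  have fin: "finite B" using Suc.prems finite_sub by blast
  obtain C where C: "C \<subseteq> B" "card C = s" "\<forall>c\<in>C. \<forall>b\<in>B - C. E c b"
    using transitive_initial_segment[of B s] Suc.prems by auto
  have "P * s \<le> card (B - C)"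
    using C Suc.prems fin by (simp add: card_Diff_subset finite_subset)
  moreover have "B - C \<subseteq> V" "transp_on (B - C) E"
    using Suc.prems transp_on_subset[of B E "B - C"] by auto
  ultimately obtain G where G: "\<forall>r<P. G r \<subseteq> B - C \<and> card (G r) = s"
    "\<forall>r r'. r < r' \<longrightarrow> r' < P \<longrightarrow> (\<forall>a\<in>G r. \<forall>b\<in>G r'. E a b)"
    using Suc.IH[of "B - C"] by metis
  let ?G = "\<lambda>r. case r of 0 \<Rightarrow> C | Suc r \<Rightarrow> G r"
  have "\<forall>r<Suc P. ?G r \<subseteq> B \<and> card (?G r) = s"
    using C G by (auto split: nat.split)
  moreover have "\<forall>r r'. r < r' \<longrightarrow> r' < Suc P \<longrightarrow> (\<forall>a\<in>?G r. \<forall>b\<in>?G r'. E a b)"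
  proof (intro allI impI ballI)
    fix r r' a b assume r: "r < r'" "r' < Suc P" and ab: "a \<in> ?G r" "b \<in> ?G r'"
    then obtain t' where t': "r' = Suc t'" "t' < P" by (cases r') auto
    show "E a b"
    proof (cases r)
      case 0
      then have "a \<in> C" "b \<in> B - C" using ab t' G(1) by auto
      then show ?thesis using C(3) by blast
    next
      case (Suc t)
      then show ?thesis using G(2) r ab t' by auto
    qed
  qed
  ultimately show ?case by (intro exI[of _ ?G]) blast
qed

end

section \<open>Long sequences of mostly forward sets\<close>

text \<open>Injectivity is left out because between tournaments preserving arcs already forces it,
  and the image is then an induced copy.\<close>

definition hom_into :: "'p set \<Rightarrow> ('p \<Rightarrow> 'p \<Rightarrow> bool) \<Rightarrow> ('c \<Rightarrow> 'c \<Rightarrow> bool) \<Rightarrow> ('p \<Rightarrow> 'c) \<Rightarrow> bool" where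
  "hom_into S R E \<phi> \<longleftrightarrow> (\<forall>u\<in>S. \<forall>v\<in>S. u \<noteq> v \<longrightarrow> R u v \<longrightarrow> E (\<phi> u) (\<phi> v))"

context tournament_arcs
begin

text \<open>
  Vertices are embedded one by one. When every vertex of a candidate set would shrink some other
  candidate set by more than the factor \<open>D\<close>, two candidate sets contain a sparse pair.
\<close>

lemma hom_or_sparse_pair:
  assumes "finite S" "card S \<le> h" "0 < q" "0 < D"
    and "\<And>u v. u \<in> S \<Longrightarrow> v \<in> S \<Longrightarrow> R u v \<Longrightarrow> \<not> R v u"
    and "\<And>v. v \<in> S \<Longrightarrow> U v \<subseteq> V \<and> D ^ card S * q \<le> card (U v)"
    and "disjoint_family_on U S"
  shows "(\<exists>\<phi>. (\<forall>v\<in>S. \<phi> v \<in> U v) \<and> hom_into S R E \<phi>) \<or>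
    (\<exists>A B. A \<subseteq> V \<and> B \<subseteq> V \<and> A \<inter> B = {} \<and> q \<le> h * card A \<and> q \<le> h * card B \<and>
      ((\<forall>a\<in>A. D * card {b \<in> B. E a b} \<le> card B) \<or> (\<forall>a\<in>A. D * card {b \<in> B. E b a} \<le> card B)))"
    (is "_ \<or> ?pair")
  using assms
proof (induction S arbitrary: U rule: finite_induct)
  case empty
  then show ?case by (simp add: hom_into_def)
next
  case (insert v S)
  let ?N = "\<lambda>a w. {b \<in> U w. if R v w then E a b else E b a}"
  have Uv: "U v \<subseteq> V" "finite (U v)" using insert.prems(5)[of v] finite_sub by auto
  have big: "q \<le> card (U w)" if "w \<in> insert v S" for w
  proof -
    have "1 * q \<le> D ^ card (insert v S) * q"
      using insert.prems(3) by (intro mult_le_mono) auto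
    also have "\<dots> \<le> card (U w)" using insert.prems(5)[of w] that by blast
    finally show ?thesis by simp
  qed
  show ?case
  proof (cases "\<exists>a\<in>U v. \<forall>w\<in>S. card (U w) \<le> D * card (?N a w)")
    case True
    then obtain a where a: "a \<in> U v" "\<And>w. w \<in> S \<Longrightarrow> card (U w) \<le> D * card (?N a w)" by blast
    \<comment> \<open>Each embedded vertex may cost the remaining candidate sets a factor
      \<open>D\<close>; the exponent is the budget for the vertices still to come.\<close>
    have "D ^ card S * q \<le> card (?N a w)" if "w \<in> S" for w
    proof -
      have "D * (D ^ card S * q) \<le> card (U w)"
        using insert.prems(5)[of w] insert.hyps that by (simp add: mult_ac)
      also have "\<dots> \<le> D * card (?N a w)" using a that by blast
      finally show ?thesis using \<open>0 < D\<close> by simp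
    qed
    moreover have "disjoint_family_on (?N a) S"
      using insert.prems(6) unfolding disjoint_family_on_def by blast
    moreover have "?N a w \<subseteq> V" if "w \<in> S" for w
      using insert.prems(5)[of w] that by blast
    ultimately have "(\<exists>\<phi>. (\<forall>w\<in>S. \<phi> w \<in> ?N a w) \<and> hom_into S R E \<phi>) \<or> ?pair"
      using insert.prems(1,4) insert.hyps \<open>0 < q\<close> \<open>0 < D\<close> by (intro insert.IH) auto
    then show ?thesis
    proof
      assume "\<exists>\<phi>. (\<forall>w\<in>S. \<phi> w \<in> ?N a w) \<and> hom_into S R E \<phi>"
      then obtain \<phi> where \<phi>: "\<And>w. w \<in> S \<Longrightarrow> \<phi> w \<in> ?N a w" "hom_into S R E \<phi>" by blast
      have "hom_into (insert v S) R E (\<phi>(v := a))"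
        unfolding hom_into_def
      proof (intro ballI impI)
        fix u w assume uw: "u \<in> insert v S" "w \<in> insert v S" "u \<noteq> w" "R u w"
        consider "u = v" "w \<in> S" | "w = v" "u \<in> S" | "u \<in> S" "w \<in> S" using uw by blast
        then show "E ((\<phi>(v := a)) u) ((\<phi>(v := a)) w)"
        proof cases
          case 1
          then show ?thesis using \<phi>(1)[of w] uw by auto
        next
          case 2
          then have "\<not> R v u" using insert.prems(4)[of u v] uw by auto
          then show ?thesis using \<phi>(1)[of u] uw 2 by auto
        next
          case 3
          then show ?thesis using \<phi>(2) uw insert.hyps unfolding hom_into_def by auto
        qed
      qed
      moreover have "\<forall>w\<in>insert v S. (\<phi>(v := a)) w \<in> U w"
        using \<phi> a insert.hyps by auto
      ultimately show ?thesis by blast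
    qed blast
  next
    case False
    \<comment> \<open>\<open>Z w\<close> collects the vertices that would shrink the candidates of
      \<open>w\<close> too far. These sets cover \<open>U v\<close>, so some \<open>w\<close> is to
      blame for a large share; and as \<open>R\<close> fixes the direction between \<open>v\<close>
      and \<open>w\<close>, all of \<open>Z w\<close> is sparse towards \<open>U w\<close> in the
      same direction.\<close>
    define Z where "Z w = {a \<in> U v. D * card (?N a w) < card (U w)}" for w
    have "U v \<subseteq> (\<Union>w\<in>S. Z w)"
    proof
      fix a assume "a \<in> U v"
      then obtain w where "w \<in> S" "\<not> card (U w) \<le> D * card (?N a w)" using False by blast
      then have "a \<in> Z w" using \<open>a \<in> U v\<close> unfolding Z_def by auto
      then show "a \<in> (\<Union>w\<in>S. Z w)" using \<open>w \<in> S\<close> by blast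
    qed
    moreover have "U v \<noteq> {}" using big[of v] \<open>0 < q\<close> by auto
    moreover have "finite (Z w)" for w using Uv unfolding Z_def by simp
    ultimately obtain w where w: "w \<in> S" "card (U v) \<le> card S * card (Z w)"
      using card_cover_pigeonhole[of S "U v" Z] insert.hyps by metis
    have "card S \<le> h" using insert.prems(1) insert.hyps by auto
    then have "card S * card (Z w) \<le> h * card (Z w)" by simp
    moreover have "q \<le> card (U v)" using big by blast
    ultimately have A: "q \<le> h * card (Z w)" using w by linarith
    then have "0 < h" using \<open>0 < q\<close> by (cases h) auto
    then have B: "q \<le> h * card (U w)" using big[of w] w
      by (metis insertI2 le_trans mult_le_mono1 nat_mult_1 Suc_leI One_nat_def)
    have dis: "Z w \<inter> U w = {}"
      using insert.prems(6) w insert.hyps unfolding disjoint_family_on_def Z_def by fastforce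
    have "(\<forall>a\<in>Z w. D * card {b \<in> U w. E a b} \<le> card (U w)) \<or>
        (\<forall>a\<in>Z w. D * card {b \<in> U w. E b a} \<le> card (U w))"
      by (cases "R v w") (auto simp: Z_def)
    moreover have "Z w \<subseteq> V" "U w \<subseteq> V" using Uv insert.prems(5)[of w] w unfolding Z_def by auto
    ultimately show ?thesis using A B dis by blast
  qed
qed

lemma restricted: "W \<subseteq> V \<Longrightarrow> tournament_arcs W E"
  unfolding tournament_arcs_def using finite_sub irrefl total by (meson subsetD)

text \<open>\<open>W\<close> is split into equal candidate sets and the greedy dichotomy is used
  with \<open>2 * D\<close>, whose factor 2 is spent on making the sparse pair two-sided. In the
  size constant, one factor 2 comes from rounding \<open>card W div n\<close>, another from halving
  one set of the pair, and the outer \<open>card S\<close> from the pigeonhole choice of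
  \<open>w\<close>.\<close>

lemma hom_or_mostly_forward_pair:
  fixes S :: "'p set"
  assumes "finite S" "0 < D"
    and "\<And>u v. u \<in> S \<Longrightarrow> v \<in> S \<Longrightarrow> R u v \<Longrightarrow> \<not> R v u"
    and "\<nexists>\<phi>. \<phi> ` S \<subseteq> V \<and> hom_into S R E \<phi>"
    and "W \<subseteq> V" "4 * card S * (card S * (2 * D) ^ card S) \<le> card W"
  shows "\<exists>A B. A \<subseteq> W \<and> B \<subseteq> W \<and> mostly_forward D A B \<and>
    card W \<le> 4 * card S * (card S * (2 * D) ^ card S) * card A \<and>
    card W \<le> 4 * card S * (card S * (2 * D) ^ card S) * card B"
proof -
  define h where "h = card S"
  define n where "n = h * (2 * D) ^ h"
  define q where "q = card W div n"
  have "S \<noteq> {}" using assms(4) by (auto simp: hom_into_def)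
  then have "0 < h" using assms(1) h_def by auto
  then have "0 < n" using \<open>0 < D\<close> n_def by simp
  have n4: "4 * h * n \<le> card W" using assms(6) unfolding h_def n_def .
  have "n \<le> 4 * h * n" using \<open>0 < h\<close> by simp
  then have "n \<le> card W" using n4 by linarith
  then have "0 < q" using \<open>0 < n\<close> unfolding q_def by (simp add: div_greater_zero_iff)
  have "card W < n * Suc q"
    using \<open>0 < n\<close> unfolding q_def by (metis dividend_less_times_div mult_Suc_right add.commute)
  also have "\<dots> \<le> n * (2 * q)" using \<open>0 < q\<close> by (intro mult_le_mono) auto
  finally have Wq: "card W \<le> 2 * n * q" by simp
  have "card S * ((2 * D) ^ h * q) \<le> card W"
    using div_times_less_eq_dividend[of "card W" n] unfolding q_def n_def h_def by (simp add: mult_ac)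
  then obtain U where U: "\<forall>v\<in>S. U v \<subseteq> W \<and> card (U v) = (2 * D) ^ h * q" "disjoint_family_on U S"
    using disjoint_parts[OF assms(1) finite_sub[OF assms(5)], of "(2 * D) ^ h * q"] by metis
  interpret w: tournament_arcs W E
    using assms(5) by (rule restricted)
  have "(\<exists>\<phi>. (\<forall>v\<in>S. \<phi> v \<in> U v) \<and> hom_into S R E \<phi>) \<or>
    (\<exists>A B. A \<subseteq> W \<and> B \<subseteq> W \<and> A \<inter> B = {} \<and> q \<le> h * card A \<and> q \<le> h * card B \<and>
      ((\<forall>a\<in>A. 2 * D * card {b \<in> B. E a b} \<le> card B) \<or>
       (\<forall>a\<in>A. 2 * D * card {b \<in> B. E b a} \<le> card B)))"
  proof (rule w.hom_or_sparse_pair[where S = S and U = U])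
    show "U v \<subseteq> W \<and> (2 * D) ^ card S * q \<le> card (U v)" if "v \<in> S" for v
      using U(1) that h_def by simp
  qed (use U(2) assms(1-3) \<open>0 < q\<close> h_def in simp_all)
  moreover have "\<not> (\<exists>\<phi>. (\<forall>v\<in>S. \<phi> v \<in> U v) \<and> hom_into S R E \<phi>)"
    using assms(4,5) U by blast
  ultimately obtain A B where AB: "A \<subseteq> W" "B \<subseteq> W" "A \<inter> B = {}" "q \<le> h * card A" "q \<le> h * card B"
    "(\<forall>a\<in>A. 2 * D * card {b \<in> B. E a b} \<le> card B) \<or> (\<forall>a\<in>A. 2 * D * card {b \<in> B. E b a} \<le> card B)"
    by blast
  have AV: "A \<subseteq> V" "B \<subseteq> V" using AB assms(5) by auto
  have size: "card W \<le> 4 * h * n * card C" if "q \<le> h * (2 * card C)" for C :: "'c set"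
  proof -
    have "card W \<le> 2 * n * (h * (2 * card C))" using Wq mult_le_mono2[OF that, of "2 * n"] by linarith
    then show ?thesis by (simp add: mult_ac)
  qed
  have half: "q \<le> h * (2 * card C')" if "q \<le> h * card C" "card C \<le> 2 * card C'" for C C' :: "'c set"
    using that mult_le_mono2[of "card C" "2 * card C'" h] by linarith
  have dir: "E a b \<longleftrightarrow> \<not> E b a" if "a \<in> A" "b \<in> B" for a b
    using that AB(3) AV total by (metis disjoint_iff subsetD)
  \<comment> \<open>Few arcs in one direction means mostly forward in the other; the cases differ in
    which set of the pair comes first.\<close>
  from AB(6) show ?thesis
  proof
    assume *: "\<forall>a\<in>A. 2 * D * card {b \<in> B. E a b} \<le> card B"
    have "2 * D * card {b \<in> B. \<not> E b a} \<le> card B" if "a \<in> A" for a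
    proof -
      have "{b \<in> B. \<not> E b a} = {b \<in> B. E a b}" using dir that by blast
      then show ?thesis using * that by simp
    qed
    then obtain B' where B': "B' \<subseteq> B" "card B \<le> 2 * card B'" "mostly_forward D B' A"
      using mostly_forward_restrict_left[of B A D] AV AB(3) by (metis Int_commute)
    show ?thesis
      using B' AB size[of B'] size[of A] half[OF AB(5) B'(2)] half[OF AB(4), of A]
      unfolding n_def h_def by (intro exI[of _ B'] exI[of _ A]) auto
  next
    assume *: "\<forall>a\<in>A. 2 * D * card {b \<in> B. E b a} \<le> card B"
    have "2 * D * card {b \<in> B. \<not> E a b} \<le> card B" if "a \<in> A" for a
    proof -
      have "{b \<in> B. \<not> E a b} = {b \<in> B. E b a}" using dir that by blast
      then show ?thesis using * that by simp
    qed
    then obtain B' where B': "B' \<subseteq> B" "card B \<le> 2 * card B'" "mostly_forward D A B'"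
      using mostly_forward_restrict_right[of A B D] AV AB(3) by metis
    show ?thesis
      using B' AB size[of B'] size[of A] half[OF AB(5) B'(2)] half[OF AB(4), of A]
      unfolding n_def h_def by (intro exI[of _ A] exI[of _ B']) auto
  qed
qed

end

text \<open>The induction continues inside the second set of a pair: \<open>A\<close> stays as the
  initial set and \<open>k\<close> more are found in \<open>B\<close>. These may be as small as a
  fraction \<open>1 / M\<close> of \<open>B\<close>, so the pair is requested with density
  \<open>M * D\<close>. \<open>M\<close> is fixed before \<open>V\<close> and \<open>E\<close>,
  since the exponent will be computed from it.\<close>

lemma mostly_forward_sequence:
  fixes S :: "'p set" and k :: nat
  assumes "finite S" "asymp_on S R" "0 < D"
  shows "\<exists>M>0. \<forall>(V :: 'c set) E W. tournament_arcs V E \<longrightarrow>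
    (\<nexists>\<phi>. \<phi> ` S \<subseteq> V \<and> hom_into S R E \<phi>) \<longrightarrow> W \<subseteq> V \<longrightarrow> M \<le> card W \<longrightarrow>
    (\<exists>F. (\<forall>i<k. F i \<subseteq> W \<and> card W \<le> M * card (F i)) \<and>
      (\<forall>i j. i < j \<longrightarrow> j < k \<longrightarrow> tournament_arcs.mostly_forward E D (F i) (F j)))"
  using assms(3)
proof (induction k arbitrary: D)
  case 0
  then show ?case by (intro exI[of _ 1]) auto
next
  case (Suc k)
  from Suc.IH[OF Suc.prems] obtain M where "M > 0"
    and M_all: "\<forall>(V :: 'c set) E W. tournament_arcs V E \<longrightarrow>
    (\<nexists>\<phi>. \<phi> ` S \<subseteq> V \<and> hom_into S R E \<phi>) \<longrightarrow> W \<subseteq> V \<longrightarrow> M \<le> card W \<longrightarrow>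
    (\<exists>F. (\<forall>i<k. F i \<subseteq> W \<and> card W \<le> M * card (F i)) \<and>
      (\<forall>i j. i < j \<longrightarrow> j < k \<longrightarrow> tournament_arcs.mostly_forward E D (F i) (F j)))"
    by (elim exE conjE) (rule that)
  note M = \<open>M > 0\<close>
  define M' where "M' = 4 * card S * (card S * (2 * (M * D)) ^ card S) + 1"
  show ?case
  proof (intro exI[of _ "M' * M"] conjI allI impI)
    show "0 < M' * M" using M M'_def by simp
    fix V :: "'c set" and E W
    assume t: "tournament_arcs V E" and no: "\<nexists>\<phi>. \<phi> ` S \<subseteq> V \<and> hom_into S R E \<phi>"
      and W: "W \<subseteq> V" "M' * M \<le> card W"
    interpret tournament_arcs V E by fact
    have MD: "0 < M * D" using M Suc.prems by simp
    have "M' * 1 \<le> M' * M" using M by (intro mult_le_mono) auto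
    then have "M' \<le> card W" using W by linarith
    then have large: "4 * card S * (card S * (2 * (M * D)) ^ card S) \<le> card W"
      unfolding M'_def by linarith
    obtain A B where AB: "A \<subseteq> W" "B \<subseteq> W" "mostly_forward (M * D) A B"
      "card W \<le> 4 * card S * (card S * (2 * (M * D)) ^ card S) * card A"
      "card W \<le> 4 * card S * (card S * (2 * (M * D)) ^ card S) * card B"
      using hom_or_mostly_forward_pair[OF assms(1) MD _ no W(1) large] asymp_onD[OF assms(2)] by metis
    have le: "card W \<le> M' * card A" "card W \<le> M' * card B"
      using AB(4,5) unfolding M'_def by (auto simp: add_mult_distrib)
    have "M' * M \<le> M' * card B" using W le by linarith
    moreover have "0 < M'" unfolding M'_def by simp
    ultimately have "M \<le> card B" by simp
    moreover have "B \<subseteq> V" using AB W by blast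
    ultimately obtain F where F: "\<And>i. i < k \<Longrightarrow> F i \<subseteq> B \<and> card B \<le> M * card (F i)"
      "\<And>i j. i < j \<Longrightarrow> j < k \<Longrightarrow> mostly_forward D (F i) (F j)"
      using M_all[rule_format, OF t no, of B] by metis
    let ?F = "\<lambda>i. case i of 0 \<Rightarrow> A | Suc i \<Rightarrow> F i"
    have MA: "card A \<le> M * card A" using M by simp
    have "?F i \<subseteq> W \<and> card W \<le> M' * M * card (?F i)" if "i < Suc k" for i
    proof (cases i)
      case 0
      have "card W \<le> M' * (M * card A)" using le(1) MA mult_le_mono2 le_trans by blast
      then show ?thesis using 0 AB(1) by (simp add: mult.assoc)
    next
      case (Suc j)
      then have "F j \<subseteq> B" "card B \<le> M * card (F j)" using F that by auto
      then have "F j \<subseteq> W" "card W \<le> M' * (M * card (F j))"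
        using AB(2) le(2) mult_le_mono2 le_trans by blast+
      then show ?thesis using Suc by (simp add: mult.assoc)
    qed
    moreover have "mostly_forward D (?F i) (?F j)" if ij: "i < j" "j < Suc k" for i j
    proof -
      obtain j' where j': "j = Suc j'" "j' < k" using ij by (cases j) auto
      show ?thesis
      proof (cases i)
        case 0
        have "mostly_forward D A (F j')"
          using mostly_forward_subsets[OF AB(3), of A "F j'"] F(1)[OF j'(2)] AB W MA M by blast
        then show ?thesis using 0 j' by simp
      next
        case (Suc i')
        then show ?thesis using F(2) j' ij by simp
      qed
    qed
    ultimately show "\<exists>F. (\<forall>i<Suc k. F i \<subseteq> W \<and> card W \<le> M' * M * card (F i)) \<and>
      (\<forall>i j. i < j \<longrightarrow> j < Suc k \<longrightarrow> mostly_forward D (F i) (F j))"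
      by (intro exI[of _ ?F]) blast
  qed
qed

section \<open>Grids\<close>

context tournament_arcs
begin

text \<open>The chosen \<open>B\<close> may be far below linear size, so densities cannot be
  inherited by comparing sizes. But each vertex of \<open>B\<close> still has few exceptions in
  every other set; averaging over \<open>B\<close> and discarding up to half of the other set
  restores the bound on both sides.\<close>

lemma refine_one_set:
  fixes F :: "nat \<Rightarrow> 'c set"
  assumes sub: "\<And>j. j < k \<Longrightarrow> F j \<subseteq> V"
    and mf: "\<And>j j'. j < j' \<Longrightarrow> j' < k \<Longrightarrow> mostly_forward (2 * D) (F j) (F j')"
    and i: "i < k" "B \<subseteq> F i"
  shows "\<exists>G. G i = B \<and> (\<forall>j<k. G j \<subseteq> F j \<and> (j \<noteq> i \<longrightarrow> card (F j) \<le> 2 * card (G j))) \<and>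
    (\<forall>j j'. j < j' \<longrightarrow> j' < k \<longrightarrow> mostly_forward D (G j) (G j'))"
proof -
  have BV: "B \<subseteq> V" using sub i by blast
  have "\<exists>C\<subseteq>F j. card (F j) \<le> 2 * card C \<and>
      (j < i \<longrightarrow> mostly_forward D C B) \<and> (i < j \<longrightarrow> mostly_forward D B C)" if j: "j < k" "j \<noteq> i" for j
  proof (cases "j < i")
    case True
    have sparse: "F j \<inter> B = {}" "\<And>b. b \<in> B \<Longrightarrow> 2 * D * card {a \<in> F j. \<not> E a b} \<le> card (F j)"
      using mf[OF True i(1)] i(2) unfolding mostly_forward_def by auto
    obtain C where "C \<subseteq> F j" "card (F j) \<le> 2 * card C" "mostly_forward D C B"
      using mostly_forward_restrict_left[OF sub[OF j(1)] BV sparse(1)] sparse(2) by metis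
    then show ?thesis using True by auto
  next
    case False
    then have ij: "i < j" using j by simp
    have sparse: "B \<inter> F j = {}" "\<And>b. b \<in> B \<Longrightarrow> 2 * D * card {a \<in> F j. \<not> E b a} \<le> card (F j)"
      using mf[OF ij j(1)] i(2) unfolding mostly_forward_def by auto
    obtain C where "C \<subseteq> F j" "card (F j) \<le> 2 * card C" "mostly_forward D B C"
      using mostly_forward_restrict_right[OF BV sub[OF j(1)] sparse(1)] sparse(2) by metis
    then show ?thesis using False by auto
  qed
  then obtain G where G: "\<And>j. j < k \<Longrightarrow> j \<noteq> i \<Longrightarrow> G j \<subseteq> F j \<and> card (F j) \<le> 2 * card (G j) \<and>
      (j < i \<longrightarrow> mostly_forward D (G j) B) \<and> (i < j \<longrightarrow> mostly_forward D B (G j))"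
    by metis
  have "mostly_forward D ((G(i := B)) j) ((G(i := B)) j')" if "j < j'" "j' < k" for j j'
  proof -
    consider "j = i" | "j' = i" | "j \<noteq> i" "j' \<noteq> i" by blast
    then show ?thesis
    proof cases
      case 3
      then show ?thesis
        using mostly_forward_subsets[OF mf[OF that], of "G j" "G j'"] G[of j] G[of j'] sub that by auto
    qed (use G that in auto)
  qed
  then show ?thesis
    using G i by (intro exI[of _ "G(i := B)"]) auto
qed

text \<open>The indices are treated one at a time. Each step halves the density parameter, hence
  \<open>2 ^ (k - t)\<close>, and may halve every set but the current one, transitive sets chosen
  earlier included, hence \<open>2 ^ t\<close>. The factor \<open>2 ^ k\<close> in \<open>ex\<close>
  allows for the cuts a set has suffered before its turn.\<close>

lemma refine_to_transitive:
  fixes F :: "nat \<Rightarrow> 'c set" and q :: real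
  assumes sub: "\<And>j. j < k \<Longrightarrow> F j \<subseteq> V"
    and mf: "\<And>j j'. j < j' \<Longrightarrow> j' < k \<Longrightarrow> mostly_forward (2 ^ k * D) (F j) (F j')"
    and ex: "\<And>i X. i < k \<Longrightarrow> X \<subseteq> F i \<Longrightarrow> card (F i) \<le> 2 ^ k * card X \<Longrightarrow>
      \<exists>B\<subseteq>X. transp_on B E \<and> q \<le> card B"
    and "t \<le> k" "0 \<le> q"
  shows "\<exists>G. (\<forall>i<k. G i \<subseteq> F i) \<and>
    (\<forall>i j. i < j \<longrightarrow> j < k \<longrightarrow> mostly_forward (2 ^ (k - t) * D) (G i) (G j)) \<and>
    (\<forall>i<k. if i < t \<and> even i then transp_on (G i) E \<and> q \<le> 2 ^ t * real (card (G i))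
      else card (F i) \<le> 2 ^ t * card (G i))"
  using assms(4)
proof (induction t)
  case 0
  then show ?case using mf by (intro exI[of _ F]) auto
next
  case (Suc t)
  then obtain G where sG: "\<And>i. i < k \<Longrightarrow> G i \<subseteq> F i"
    and mG: "\<And>i j. i < j \<Longrightarrow> j < k \<Longrightarrow> mostly_forward (2 ^ (k - t) * D) (G i) (G j)"
    and cG: "\<And>i. i < k \<Longrightarrow> if i < t \<and> even i then transp_on (G i) E \<and> q \<le> 2 ^ t * real (card (G i))
      else card (F i) \<le> 2 ^ t * card (G i)" by (auto dest: Suc_leD)
  have D2: "2 ^ (k - t) * D = 2 * (2 ^ (k - Suc t) * D)"
    using Suc.prems by (simp add: Suc_diff_Suc[symmetric])
  have tk: "t < k" using Suc.prems by simp
  \<comment> \<open>For odd \<open>t\<close> the set itself serves as \<open>B\<close>, so that both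
    parities pass through the same refinement.\<close>
  have "\<exists>B\<subseteq>G t. if even t then transp_on B E \<and> q \<le> card B else B = G t"
  proof (cases "even t")
    case True
    have "card (F t) \<le> 2 ^ t * card (G t)" using cG[OF tk] by simp
    also have "\<dots> \<le> 2 ^ k * card (G t)" using tk by (intro mult_le_mono power_increasing) auto
    finally show ?thesis using ex[OF tk sG[OF tk]] True by simp
  qed auto
  then obtain B where B: "B \<subseteq> G t" "if even t then transp_on B E \<and> q \<le> card B else B = G t"
    by blast
  have "\<exists>H. H t = B \<and> (\<forall>j<k. H j \<subseteq> G j \<and> (j \<noteq> t \<longrightarrow> card (G j) \<le> 2 * card (H j))) \<and>
    (\<forall>j j'. j < j' \<longrightarrow> j' < k \<longrightarrow> mostly_forward (2 ^ (k - Suc t) * D) (H j) (H j'))"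
    using sG sub mG tk B(1) by (intro refine_one_set) (auto simp: D2)
  then obtain H where H: "H t = B" "\<And>j. j < k \<Longrightarrow> H j \<subseteq> G j"
    "\<And>j. j < k \<Longrightarrow> j \<noteq> t \<Longrightarrow> card (G j) \<le> 2 * card (H j)"
    "\<And>j j'. j < j' \<Longrightarrow> j' < k \<Longrightarrow> mostly_forward (2 ^ (k - Suc t) * D) (H j) (H j')" by metis
  have "if i < Suc t \<and> even i then transp_on (H i) E \<and> q \<le> 2 ^ Suc t * real (card (H i))
      else card (F i) \<le> 2 ^ Suc t * card (H i)" if ik: "i < k" for i
  proof (cases "i = t")
    case True
    show ?thesis
    proof (cases "even t")
      case even: True
      have "1 * real (card B) \<le> 2 ^ Suc t * real (card B)"
        by (intro mult_right_mono one_le_power) auto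
      then show ?thesis using True even B H(1) by auto
    next
      case False
      then show ?thesis using True B H(1) cG[OF ik] by auto
    qed
  next
    case False
    then have GH: "card (G i) \<le> 2 * card (H i)" using H(3) ik by blast
    show ?thesis
    proof (cases "i < t \<and> even i")
      case True
      then have "transp_on (G i) E" "q \<le> 2 ^ t * real (card (G i))" using cG[OF ik] by auto
      moreover have "2 ^ t * real (card (G i)) \<le> 2 ^ t * real (2 * card (H i))"
        using GH by (intro mult_left_mono) (auto simp del: of_nat_mult)
      ultimately have "q \<le> 2 ^ t * real (2 * card (H i))" "transp_on (H i) E"
        using transp_on_subset[OF _ H(2)[OF ik]] order.trans by blast+
      then show ?thesis using True by (simp add: mult_ac)
    next
      case False2: False
      then have "card (F i) \<le> 2 ^ t * card (G i)" using cG[OF ik] by (simp split: if_splits)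
      also have "\<dots> \<le> 2 ^ t * (2 * card (H i))" using GH by simp
      finally show ?thesis using False2 False by auto
    qed
  qed
  moreover have "H i \<subseteq> F i" if "i < k" for i using H(2) sG that by blast
  ultimately show ?case using H(4) by (intro exI[of _ H]) blast
qed

lemma transitive_pair:
  assumes "2 \<le> card V"
  shows "\<exists>X\<subseteq>V. transp_on X E \<and> card X = 2"
proof -
  obtain X where X: "X \<subseteq> V" "card X = 2" using assms obtain_subset_with_card_n by metis
  then obtain x y where xy: "X = {x, y}" "x \<noteq> y" by (meson card_2_iff)
  have "transp_on X E"
    unfolding transp_on_def xy(1) using X(1) xy irrefl[of x] irrefl[of y] total[of x y] by auto
  then show ?thesis using X by blast
qed

end

text \<open>
  The sets \<open>F g r\<close> with even \<open>g\<close> are consecutive pieces of one transitive set; they only have to be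
  large compared with the largest transitive set. Those with odd \<open>g\<close> are of linear size and do not
  depend on \<open>r\<close>.
\<close>

locale grid = tournament_arcs V E for V :: "'c set" and E +
  fixes F :: "nat \<Rightarrow> nat \<Rightarrow> 'c set" and k P D K :: nat
  assumes cell_sub: "g < k \<Longrightarrow> r < P \<Longrightarrow> F g r \<subseteq> V"
    and cell_nonempty: "g < k \<Longrightarrow> r < P \<Longrightarrow> F g r \<noteq> {}"
    and cell_forward: "g < g' \<Longrightarrow> g' < k \<Longrightarrow> r < P \<Longrightarrow> r' < P \<Longrightarrow> mostly_forward D (F g r) (F g' r')"
    and cell_chain: "g < k \<Longrightarrow> even g \<Longrightarrow> r < r' \<Longrightarrow> r' < P \<Longrightarrow> a \<in> F g r \<Longrightarrow> b \<in> F g r' \<Longrightarrow> E a b"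
    and cell_backward: "g < g' \<Longrightarrow> g' < k \<Longrightarrow> r < P \<Longrightarrow> r' < P \<Longrightarrow> odd g \<or> odd g' \<Longrightarrow>
      A \<subseteq> F g r \<Longrightarrow> B \<subseteq> F g' r' \<Longrightarrow> card (F g r) \<le> K * card A \<Longrightarrow> card (F g' r') \<le> K * card B \<Longrightarrow>
      \<exists>a\<in>A. \<exists>b\<in>B. E b a"

text \<open>Every small enough \<epsilon> will do, the last bound because \<open>exp\<close> lies
  above its tangent at 0. The bound for \<open>2 ^ Z\<close> will exclude small tournaments; the one
  for \<open>x\<close> limits the loss from passing to a set of linear size.\<close>

lemma small_exponent:
  fixes Z :: nat and x \<eta> :: real
  assumes "0 < Z" "1 \<le> x" "0 < \<eta>"
  obtains \<epsilon> :: real where "0 < \<epsilon>" "(2 ^ Z) powr \<epsilon> \<le> 2" "1 - \<eta> \<le> x powr (- \<epsilon>)"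
proof
  \<comment> \<open>Without \<open>+ 1\<close> the quotient would be a division by zero for
    \<open>x = 1\<close>, hence 0, and \<epsilon> would not be positive.\<close>
  define \<epsilon> where "\<epsilon> = min (1 / real Z) (\<eta> / (ln x + 1))"
  have lx: "0 \<le> ln x" using assms by simp
  have "0 < \<eta> / (ln x + 1)" using assms(3) lx by (intro divide_pos_pos) linarith+
  then show "0 < \<epsilon>" using assms unfolding \<epsilon>_def by simp
  have "(2 ^ Z :: real) powr \<epsilon> \<le> (2 ^ Z) powr (1 / real Z)"
    unfolding \<epsilon>_def by (intro powr_mono) auto
  also have "\<dots> = 2" using assms by (simp add: powr_realpow[symmetric] powr_powr)
  finally show "(2 ^ Z :: real) powr \<epsilon> \<le> 2" .
  have "\<epsilon> * ln x \<le> \<eta> / (ln x + 1) * (ln x + 1)"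
    using lx assms \<open>0 < \<epsilon>\<close> unfolding \<epsilon>_def by (intro mult_mono) auto
  then have "\<epsilon> * ln x \<le> \<eta>" using lx by simp
  then have "1 - \<eta> \<le> 1 + (- \<epsilon> * ln x)" by simp
  also have "\<dots> \<le> exp (- \<epsilon> * ln x)" by (rule exp_ge_add_one_self)
  finally show "1 - \<eta> \<le> x powr (- \<epsilon>)" using assms by (simp add: powr_def)
qed

text \<open>The two conditions on transitive sets say that \<open>V\<close> is a minimal
  counterexample for \<epsilon>. That \<epsilon> depends only on the pattern and the grid parameters
  is what makes it uniform over all tournaments.\<close>

lemma grid_exists:
  fixes S :: "'p set" and k P D K :: nat
  assumes "finite S" "asymp_on S R"
    and "0 < D" "0 < P" "0 < K" "2 \<le> k"
  shows "\<exists>\<epsilon>>0. \<forall>(V :: 'c set) E. tournament_arcs V E \<longrightarrow>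
    (\<nexists>\<phi>. \<phi> ` S \<subseteq> V \<and> hom_into S R E \<phi>) \<longrightarrow>
    (\<forall>W. W \<subset> V \<longrightarrow> (\<exists>X\<subseteq>W. transp_on X E \<and> real (card W) powr \<epsilon> \<le> real (card X))) \<longrightarrow>
    (\<forall>X\<subseteq>V. transp_on X E \<longrightarrow> real (card X) < real (card V) powr \<epsilon>) \<longrightarrow>
    (\<exists>F. grid V E F k P D K)"
proof -
  \<comment> \<open>The density that must be requested at the start: \<open>2 ^ k\<close> is
    consumed by the \<open>k\<close> refinements, \<open>2 * P\<close> by cutting into
    pieces.\<close>
  have "0 < 2 ^ k * (2 * P * D)" using assms by simp
  from mostly_forward_sequence[OF assms(1) assms(2) this, where k = k and ?'c = 'c]
  obtain M where "M > 0" and seq: "\<forall>(V :: 'c set) E W. tournament_arcs V E \<longrightarrow>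
    (\<nexists>\<phi>. \<phi> ` S \<subseteq> V \<and> hom_into S R E \<phi>) \<longrightarrow> W \<subseteq> V \<longrightarrow> M \<le> card W \<longrightarrow>
    (\<exists>F. (\<forall>i<k. F i \<subseteq> W \<and> card W \<le> M * card (F i)) \<and>
      (\<forall>i j. i < j \<longrightarrow> j < k \<longrightarrow>
        tournament_arcs.mostly_forward E (2 ^ k * (2 * P * D)) (F i) (F j)))"
    by (elim exE conjE) (rule that)
  \<comment> \<open>The losses are collected. A subset of a piece keeps \<eta> of \<tau>:
    \<open>2 ^ (k + 1)\<close> for \<tau>\<open>/ 2\<close> and the refinements,
    \<open>2 * P\<close> for the pieces, \<open>K\<close> for the subset. A subset of a linear set
    keeps \<open>1 / C\<close> of \<open>V\<close>. \<open>Z\<close> is a lower bound to be forced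
    on \<tau>, large enough for the sequence to exist and for every transitive set to have
    \<open>P\<close> vertices.\<close>
  define \<eta> :: real where "\<eta> = 1 / (2 ^ (k + 2) * P * K)"
  define C where "C = M * 2 ^ k * K"
  define Z where "Z = M + 2 ^ (k + 1) * P"
  have \<eta>0: "0 < \<eta>" using assms unfolding \<eta>_def by simp
  have "1 * 1 * 1 \<le> 2 ^ k * real P * real K"
    using assms by (intro mult_mono) auto
  then have \<eta>4: "\<eta> \<le> 1 / 4" unfolding \<eta>_def by (simp add: field_simps)
  have C1: "1 \<le> C" using assms \<open>M > 0\<close> unfolding C_def by (simp add: Suc_le_eq)
  have Z0: "0 < Z" using \<open>M > 0\<close> unfolding Z_def by simp
  have C1r: "1 \<le> real C" using C1 by simp
  obtain \<epsilon> :: real where \<epsilon>: "0 < \<epsilon>" "(2 ^ Z) powr \<epsilon> \<le> 2" "1 - \<eta> \<le> real C powr (- \<epsilon>)"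
    using small_exponent[OF Z0 C1r \<eta>0] by blast
  have main: "\<exists>F. grid V E F k P D K"
    if t: "tournament_arcs V E"
      and no: "\<nexists>\<phi>. \<phi> ` S \<subseteq> V \<and> hom_into S R E \<phi>"
      and ih: "\<And>W. W \<subset> V \<Longrightarrow> \<exists>X\<subseteq>W. transp_on X E \<and> real (card W) powr \<epsilon> \<le> real (card X)"
      and small: "\<And>X. X \<subseteq> V \<Longrightarrow> transp_on X E \<Longrightarrow> real (card X) < real (card V) powr \<epsilon>"
    for V :: "'c set" and E
  proof -
    interpret tournament_arcs V E by fact
    define \<tau> where "\<tau> = real (card V) powr \<epsilon>"
    have "card V > 0" using small[of "{}"] by (auto simp: transp_on_def)
    \<comment> \<open>A single vertex is a transitive set of size 1, which equals
      \<open>1 powr\<close> \<epsilon>.\<close>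
    have "2 \<le> card V"
    proof (rule ccontr)
      assume "\<not> 2 \<le> card V"
      then have "card V = 1" using \<open>card V > 0\<close> by linarith
      moreover from this obtain v where "V = {v}" using card_1_singletonE by blast
      ultimately show False using small[of V] irrefl by (auto simp: transp_on_def)
    qed
    \<comment> \<open>Otherwise \<tau> would be at most 2, and any two vertices would already form a
      transitive set of that size.\<close>
    have big: "2 ^ Z \<le> card V"
    proof (rule ccontr)
      assume "\<not> 2 ^ Z \<le> card V"
      then have "real (card V) \<le> real (2 ^ Z)" by (simp only: of_nat_le_iff)
      then have "\<tau> \<le> (2 ^ Z) powr \<epsilon>" unfolding \<tau>_def using \<epsilon> by (intro powr_mono2) auto
      moreover obtain X where "X \<subseteq> V" "transp_on X E" "card X = 2"
        using transitive_pair \<open>2 \<le> card V\<close> by blast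
      ultimately show False using small[of X] \<epsilon> \<tau>_def by auto
    qed
    have "\<exists>X\<subseteq>V. transp_on X E \<and> card X = Z" by (rule transitive_set_of_log_size[OF subset_refl big])
    then have Z\<tau>: "real Z < \<tau>" using small unfolding \<tau>_def by metis
    have "M \<le> Z" unfolding Z_def by simp
    then have "M \<le> card V" using big less_exp[of Z] by linarith
    from seq[rule_format, OF t no subset_refl this]
    obtain A where A: "\<And>i. i < k \<Longrightarrow> A i \<subseteq> V" "\<And>i. i < k \<Longrightarrow> card V \<le> M * card (A i)"
      "\<And>i j. i < j \<Longrightarrow> j < k \<Longrightarrow> mostly_forward (2 ^ k * (2 * P * D)) (A i) (A j)"
      by metis
    have Ane: "A i \<noteq> {}" if "i < k" for i using A(2)[OF that] \<open>card V > 0\<close> by auto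
    \<comment> \<open>The induction hypothesis speaks of proper subsets only; a second set of the
      sequence, nonempty and disjoint from \<open>A i\<close>, provides a vertex outside.\<close>
    have proper: "X \<subset> V" if "i < k" "X \<subseteq> A i" for i X
    proof -
      obtain j where j: "j < k" "j \<noteq> i" using \<open>2 \<le> k\<close>
        by (metis One_nat_def Suc_1 Suc_le_lessD less_trans zero_less_one zero_neq_one)
      have "A i \<inter> A j = {}"
        using A(3)[of i j] A(3)[of j i] j that unfolding mostly_forward_def by (cases "i < j") auto
      then show ?thesis using Ane[OF j(1)] A(1)[OF j(1)] A(1)[OF that(1)] that by blast
    qed
    have linear: "\<exists>B\<subseteq>X. transp_on B E \<and> (1 - \<eta>) * \<tau> \<le> card B"
      if X: "i < k" "X \<subseteq> A i" "card V \<le> C * card X" for i X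
    proof -
      obtain B where B: "B \<subseteq> X" "transp_on B E" "real (card X) powr \<epsilon> \<le> card B"
        using ih[OF proper[OF X(1,2)]] by blast
      have "real (card V) \<le> real C * real (card X)"
        using X(3) by (metis of_nat_le_iff of_nat_mult)
      then have "real (card V) / real C \<le> real (card X)"
        using C1r by (simp add: divide_le_eq mult.commute)
      then have "(real (card V) / real C) powr \<epsilon> \<le> real (card X) powr \<epsilon>"
        using \<epsilon> by (intro powr_mono2) auto
      moreover have "(real (card V) / real C) powr \<epsilon> = real C powr (- \<epsilon>) * \<tau>"
        unfolding \<tau>_def by (simp add: powr_divide powr_minus field_simps)
      moreover have "(1 - \<eta>) * \<tau> \<le> real C powr (- \<epsilon>) * \<tau>"
        using \<epsilon> unfolding \<tau>_def by (intro mult_right_mono) auto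
      ultimately have "(1 - \<eta>) * \<tau> \<le> card B" using B(3) by linarith
      then show ?thesis using B by blast
    qed
    have "\<exists>G. (\<forall>i<k. G i \<subseteq> A i) \<and>
      (\<forall>i j. i < j \<longrightarrow> j < k \<longrightarrow> mostly_forward (2 ^ (k - k) * (2 * P * D)) (G i) (G j)) \<and>
      (\<forall>i<k. if i < k \<and> even i then transp_on (G i) E \<and> \<tau> / 2 \<le> 2 ^ k * real (card (G i))
        else card (A i) \<le> 2 ^ k * card (G i))"
    proof (rule refine_to_transitive)
      fix i X assume iX: "i < k" "X \<subseteq> A i" "card (A i) \<le> 2 ^ k * card X"
      have "card V \<le> M * (2 ^ k * card X)" using A(2)[OF iX(1)] iX(3) by (meson le_trans mult_le_mono2)
      also have "\<dots> \<le> C * card X" using assms unfolding C_def by simp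
      finally obtain B where "B \<subseteq> X" "transp_on B E" "(1 - \<eta>) * \<tau> \<le> card B" using linear iX by blast
      moreover have "\<tau> / 2 \<le> (1 - \<eta>) * \<tau>"
        using \<eta>4 mult_right_mono[of "1 / 2" "1 - \<eta>" \<tau>] unfolding \<tau>_def by simp
      ultimately show "\<exists>B\<subseteq>X. transp_on B E \<and> \<tau> / 2 \<le> card B" by (meson order.trans)
    qed (use A in \<open>auto simp: \<tau>_def\<close>)
    then obtain G where G0: "\<forall>i<k. G i \<subseteq> A i"
        "\<forall>i j. i < j \<longrightarrow> j < k \<longrightarrow> mostly_forward (2 ^ (k - k) * (2 * P * D)) (G i) (G j)"
        "\<forall>i<k. if i < k \<and> even i then transp_on (G i) E \<and> \<tau> / 2 \<le> 2 ^ k * real (card (G i))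
          else card (A i) \<le> 2 ^ k * card (G i)"
      by (elim exE conjE) (rule that)
    have G: "G i \<subseteq> A i" if "i < k" for i using G0(1) that by blast
    have Gmf: "mostly_forward (2 * P * D) (G i) (G j)" if "i < j" "j < k" for i j
      using G0(2) that by simp
    have Geven: "transp_on (G i) E \<and> \<tau> / 2 \<le> 2 ^ k * real (card (G i))" if "i < k" "even i" for i
      using G0(3)[rule_format, OF that(1)] that by simp
    have Godd: "card (A i) \<le> 2 ^ k * card (G i)" if "i < k" "odd i" for i
      using G0(3)[rule_format, OF that(1)] that by simp
    have GV: "G i \<subseteq> V" if "i < k" for i using G A(1) that by blast
    have "\<forall>g\<in>{..<k}. \<exists>H. (\<forall>r<P. H r \<subseteq> G g \<and> card (G g) \<le> 2 * P * card (H r)) \<and> (odd g \<longrightarrow> (\<forall>r. H r = G g)) \<and>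
      (even g \<longrightarrow> (\<forall>r r'. r < r' \<longrightarrow> r' < P \<longrightarrow> (\<forall>a\<in>H r. \<forall>b\<in>H r'. E a b)))"
    proof
      fix g assume "g \<in> {..<k}"
      then have g: "g < k" by simp
      show "\<exists>H. (\<forall>r<P. H r \<subseteq> G g \<and> card (G g) \<le> 2 * P * card (H r)) \<and> (odd g \<longrightarrow> (\<forall>r. H r = G g)) \<and>
      (even g \<longrightarrow> (\<forall>r r'. r < r' \<longrightarrow> r' < P \<longrightarrow> (\<forall>a\<in>H r. \<forall>b\<in>H r'. E a b)))"
    proof (cases "even g")
      case True
      have "2 ^ (k + 1) * real P \<le> real Z" unfolding Z_def by simp
      then have "2 ^ k * real P < \<tau> / 2" using Z\<tau> by simp
      also have "\<dots> \<le> 2 ^ k * real (card (G g))" using Geven g True by blast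
      finally have "P \<le> card (G g)" by simp
      \<comment> \<open>With at least \<open>P\<close> vertices available the pieces are nonempty,
        and rounding down costs at most a factor 2.\<close>
      define s where "s = card (G g) div P"
      have "0 < s" using \<open>P \<le> card (G g)\<close> \<open>0 < P\<close> s_def by (simp add: div_greater_zero_iff)
      have "card (G g) < P * Suc s"
        unfolding s_def using \<open>0 < P\<close> by (metis dividend_less_times_div mult_Suc_right add.commute)
      also have "\<dots> \<le> P * (2 * s)" using \<open>0 < s\<close> by (intro mult_le_mono) auto
      finally have sz: "card (G g) \<le> 2 * P * s" by simp
      have Ps: "P * s \<le> card (G g)" unfolding s_def by simp
      have tr: "transp_on (G g) E" using Geven g True by blast
      obtain H where "\<forall>r<P. H r \<subseteq> G g \<and> card (H r) = s"
        "\<forall>r r'. r < r' \<longrightarrow> r' < P \<longrightarrow> (\<forall>a\<in>H r. \<forall>b\<in>H r'. E a b)"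
        using transitive_pieces[OF GV[OF g] tr Ps] by (elim exE conjE) (rule that)
      then show ?thesis using sz True by (intro exI[of _ H]) auto
    next
      case False
      have "card (G g) \<le> 2 * P * card (G g)" using \<open>0 < P\<close> by simp
      then show ?thesis using False by (intro exI[of _ "\<lambda>_. G g"]) auto
    qed
    qed
    from bchoice[OF this] obtain F where F0: "\<forall>g\<in>{..<k}. (\<forall>r<P. F g r \<subseteq> G g \<and> card (G g) \<le> 2 * P * card (F g r)) \<and> (odd g \<longrightarrow> (\<forall>r. F g r = G g)) \<and>
      (even g \<longrightarrow> (\<forall>r r'. r < r' \<longrightarrow> r' < P \<longrightarrow> (\<forall>a\<in>F g r. \<forall>b\<in>F g r'. E a b)))"
      by (elim exE) (rule that)
    have F: "F g r \<subseteq> G g \<and> card (G g) \<le> 2 * P * card (F g r)" if "g < k" "r < P" for g r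
      using F0 that by simp
    have Fodd: "F g r = G g" if "g < k" "odd g" for g r
      using F0 that by simp
    have Fc: "\<forall>a\<in>F g r. \<forall>b\<in>F g r'. E a b" if "g < k" "even g" "r < r'" "r' < P" for g r r'
      using F0 that by simp
    \<comment> \<open>In an even group \<open>X\<close> is transitive itself and only its size
      counts; in an odd group the transitive subset comes from minimality.\<close>
    have large: "\<exists>B\<subseteq>X. transp_on B E \<and> \<eta> * \<tau> \<le> card B \<and> (odd g \<longrightarrow> (1 - \<eta>) * \<tau> \<le> card B)"
      if g: "g < k" "r < P" "X \<subseteq> F g r" "card (F g r) \<le> K * card X" for g r X
    proof (cases "even g")
      case True
      have "card (G g) \<le> 2 * P * (K * card X)" using F[OF g(1,2)] g(4) by (meson le_trans mult_le_mono2)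
      then have "real (card (G g)) \<le> real (2 * P * (K * card X))" by (simp only: of_nat_le_iff)
      then have "2 ^ k * real (card (G g)) \<le> 2 ^ k * (2 * real P * (real K * real (card X)))" by simp
      then have "\<tau> / 2 \<le> 2 ^ k * (2 * real P * (real K * real (card X)))"
        using Geven[OF g(1) True] by linarith
      then have "\<eta> * \<tau> \<le> card X" unfolding \<eta>_def using assms by (simp add: field_simps)
      moreover have "transp_on X E"
        using Geven[OF g(1) True] F[OF g(1,2)] g(3) transp_on_subset by (metis subset_trans)
      ultimately show ?thesis using True by auto
    next
      case False
      have "card (A g) \<le> 2 ^ k * card (G g)" using Godd g False by blast
      also have "\<dots> \<le> 2 ^ k * (K * card X)"
        using Fodd[OF g(1) False] g(4) by simp
      finally have "card V \<le> M * (2 ^ k * (K * card X))"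
        using A(2)[OF g(1)] by (meson le_trans mult_le_mono2)
      then have "card V \<le> C * card X" unfolding C_def by (simp add: mult.assoc)
      moreover have "X \<subseteq> A g" using F[OF g(1,2)] G[OF g(1)] g(3) by blast
      ultimately obtain B where B: "B \<subseteq> X" "transp_on B E" "(1 - \<eta>) * \<tau> \<le> card B"
        using linear g(1) by blast
      have "\<eta> * \<tau> \<le> (1 - \<eta>) * \<tau>" using \<eta>4 unfolding \<tau>_def by (intro mult_right_mono) auto
      then have "\<eta> * \<tau> \<le> card B" using B(3) by linarith
      then show ?thesis using B by blast
    qed
    have "grid V E F k P D K"
    proof unfold_locales
      fix g r assume "g < k" "r < P"
      then show "F g r \<subseteq> V" using F GV by blast
      have "card (A g) \<noteq> 0" using Ane A(1) finite_sub \<open>g < k\<close> by auto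
      show "F g r \<noteq> {}"
      proof
        assume "F g r = {}"
        then have "card (G g) = 0" using F[OF \<open>g < k\<close> \<open>r < P\<close>] by simp
        then show False
          using Geven[OF \<open>g < k\<close>] Godd[OF \<open>g < k\<close>] \<open>card (A g) \<noteq> 0\<close> Z\<tau> Z0 by (cases "even g") auto
      qed
    next
      fix g g' r r' assume g: "g < g'" "g' < k" "r < P" "r' < P"
      show "mostly_forward D (F g r) (F g' r')"
        using mostly_forward_subsets[OF Gmf[OF g(1,2)], of "F g r" "F g' r'"]
          F[of g r] F[of g' r'] GV[of g] GV[of g'] g \<open>0 < P\<close> by auto
    next
      fix g r r' a b assume "g < k" "even g" "r < r'" "r' < P" "a \<in> F g r" "b \<in> F g r'"
      then show "E a b" using Fc by blast
    next
      fix g g' r r' X Y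
      assume g: "g < g'" "g' < k" "r < P" "r' < P" "odd g \<or> odd g'" "X \<subseteq> F g r" "Y \<subseteq> F g' r'"
        "card (F g r) \<le> K * card X" "card (F g' r') \<le> K * card Y"
      have gk: "g < k" using g by simp
      obtain X' where X': "X' \<subseteq> X" "transp_on X' E" "\<eta> * \<tau> \<le> card X'" "odd g \<longrightarrow> (1 - \<eta>) * \<tau> \<le> card X'"
        using large[OF gk g(3,6,8)] by blast
      obtain Y' where Y': "Y' \<subseteq> Y" "transp_on Y' E" "\<eta> * \<tau> \<le> card Y'" "odd g' \<longrightarrow> (1 - \<eta>) * \<tau> \<le> card Y'"
        using large[OF g(2,4,7,9)] by blast
      have dis: "G g \<inter> G g' = {}" using Gmf[OF g(1,2)] unfolding mostly_forward_def by blast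
      have sub: "X \<subseteq> G g" "Y \<subseteq> G g'" using F[OF gk g(3)] F[OF g(2,4)] g by auto
      show "\<exists>a\<in>X. \<exists>b\<in>Y. E b a"
      proof (rule ccontr)
        assume no_back: "\<not> (\<exists>a\<in>X. \<exists>b\<in>Y. E b a)"
        have XY: "X' \<subseteq> V" "Y' \<subseteq> V" "X' \<inter> Y' = {}"
          using X'(1) Y'(1) sub GV[OF gk] GV[OF g(2)] dis by blast+
        have "E a b" if "a \<in> X'" "b \<in> Y'" for a b
          using no_back X'(1) Y'(1) XY that total[of a b] by blast
        then have "transp_on (X' \<union> Y') E" using X' Y' XY by (intro transp_on_union) auto
        then have "real (card (X' \<union> Y')) < \<tau>" using small[of "X' \<union> Y'"] XY unfolding \<tau>_def by simp
        moreover have "card (X' \<union> Y') = card X' + card Y'"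
          using XY finite_sub by (intro card_Un_disjoint) auto
        moreover have "(1 - \<eta>) * \<tau> + \<eta> * \<tau> = \<tau>" by (simp add: algebra_simps)
        ultimately show False using g(5) X'(3,4) Y'(3,4) by auto
      qed
    qed
    then show ?thesis by blast
  qed
  show ?thesis
    using \<epsilon>(1) main by (intro exI[of _ \<epsilon>] conjI allI impI) blast+
qed

section \<open>Greedy embedding into a grid\<close>

text \<open>An assignment of pattern vertices to cells. A group may be shared only if it is even,
  and then by increasing pieces, so pairs inside a group are always forward. \<open>D_large\<close>
  limits what all earlier choices rule out to half of a slot. \<open>K_large\<close> makes backward
  arcs available to a fraction \<open>1 / (4 * card W)\<close> of a slot, needed against centers
  that miss a leaf, and to quarters of slots.\<close>

locale grid_pattern = grid V E F k P D K for V :: "'c set" and E F k P D K +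
  fixes W :: "'p set" and R :: "'p \<Rightarrow> 'p \<Rightarrow> bool" and pos :: "'p \<Rightarrow> nat"
    and gg rr :: "'p \<Rightarrow> nat"
  assumes finite_W: "finite W"
    and pos_inj: "inj_on pos W"
    and R_total: "u \<in> W \<Longrightarrow> v \<in> W \<Longrightarrow> u \<noteq> v \<Longrightarrow> R u v \<longleftrightarrow> \<not> R v u"
    and gg_less: "u \<in> W \<Longrightarrow> gg u < k"
    and rr_less: "u \<in> W \<Longrightarrow> rr u < P"
    and gg_order: "u \<in> W \<Longrightarrow> v \<in> W \<Longrightarrow> pos u < pos v \<Longrightarrow>
      gg u < gg v \<or> gg u = gg v \<and> even (gg u) \<and> rr u < rr v"
    and D_large: "2 * card W \<le> D"
    and K_large: "4 * card W + 4 \<le> K"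
begin

definition slot :: "'p \<Rightarrow> 'c set" where
  "slot v = F (gg v) (rr v)"

text \<open>Measured against the order of the pattern and not against its arcs; this makes it
  symmetric in the two vertices.\<close>

definition backward :: "'p \<Rightarrow> 'p \<Rightarrow> 'c \<Rightarrow> 'c \<Rightarrow> bool" where
  "backward u v a b \<longleftrightarrow> (if pos u < pos v then E b a else E a b)"

text \<open>Three distinct groups suffice, as two vertices in slots of one group are never joined by
  a backward arc. A failure of this condition hands over the triangle for the other pattern.\<close>

definition triangle_free :: bool where
  "triangle_free \<longleftrightarrow> (\<forall>u\<in>W. \<forall>v\<in>W. \<forall>w\<in>W. gg u < gg v \<longrightarrow> gg v < gg w \<longrightarrow>
    (\<forall>a\<in>slot u. \<forall>b\<in>slot v. \<forall>c\<in>slot w. \<not> (E b a \<and> E c a \<and> E c b)))"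

definition half_slots :: "'p set \<Rightarrow> ('p \<Rightarrow> 'c set) \<Rightarrow> bool" where
  "half_slots X F' \<longleftrightarrow> (\<forall>v\<in>X. F' v \<subseteq> slot v \<and> card (slot v) \<le> 2 * card (F' v))"

text \<open>Robust on purpose: earlier parts may have ruled out up to half of every slot when the
  turn of \<open>X\<close> comes.\<close>

definition embeddable :: "'p set \<Rightarrow> bool" where
  "embeddable X \<longleftrightarrow> (\<forall>F'. half_slots X F' \<longrightarrow> (\<exists>\<phi>. (\<forall>v\<in>X. \<phi> v \<in> F' v) \<and> hom_into X R E \<phi>))"

section \<open>Elementary properties of slots and backward pairs\<close>

lemma pos_neq: "u \<in> W \<Longrightarrow> v \<in> W \<Longrightarrow> u \<noteq> v \<Longrightarrow> pos u < pos v \<or> pos v < pos u"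
  using pos_inj by (metis inj_onD linorder_neqE_nat)

lemma slot_sub: "v \<in> W \<Longrightarrow> slot v \<subseteq> V"
  unfolding slot_def using cell_sub gg_less rr_less by blast

lemma slot_card:
  assumes "v \<in> W"
  shows "0 < card (slot v)"
proof -
  have "slot v \<noteq> {}" unfolding slot_def using cell_nonempty gg_less rr_less assms by simp
  then show ?thesis using finite_sub[OF slot_sub[OF assms]] by (simp add: card_gt_0_iff)
qed

lemma slot_chain:
  assumes "u \<in> W" "v \<in> W" "pos u < pos v" "gg u = gg v" "a \<in> slot u" "b \<in> slot v"
  shows "E a b"
proof -
  have "even (gg u)" "rr u < rr v" using gg_order[OF assms(1-3)] assms(4) by auto
  then show ?thesis
    using cell_chain[OF gg_less[OF assms(1)], of "rr u" "rr v"] rr_less[OF assms(2)] assms(4-6)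
    unfolding slot_def by auto
qed

lemma slot_forward:
  assumes "u \<in> W" "v \<in> W" "pos u < pos v"
  shows "mostly_forward D (slot u) (slot v)"
proof (cases "gg u = gg v")
  case True
  then show ?thesis
    using assms slot_sub slot_chain by (intro mostly_forward_complete) auto
next
  case False
  then have "gg u < gg v" using gg_order[OF assms] by simp
  then show ?thesis
    unfolding slot_def using cell_forward gg_less rr_less assms by blast
qed

lemma slot_disjoint:
  assumes "u \<in> W" "v \<in> W" "u \<noteq> v"
  shows "slot u \<inter> slot v = {}"
  using pos_neq[OF assms] slot_forward[OF assms(1,2)] slot_forward[OF assms(2,1)]
  unfolding mostly_forward_def by blast

lemma slot_dir:
  assumes "u \<in> W" "v \<in> W" "u \<noteq> v" "a \<in> slot u" "b \<in> slot v"
  shows "E a b \<longleftrightarrow> \<not> E b a"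
proof (rule total)
  show "a \<in> V" "b \<in> V" using assms slot_sub by blast+
  show "a \<noteq> b" using slot_disjoint[OF assms(1-3)] assms(4,5) by blast
qed

lemma backward_sym:
  assumes "u \<in> W" "v \<in> W" "u \<noteq> v"
  shows "backward u v a b \<longleftrightarrow> backward v u b a"
  using pos_neq[OF assms] unfolding backward_def by auto

lemma gg_less_if:
  assumes "u \<in> W" "v \<in> W" "pos u < pos v" "gg u \<noteq> gg v"
  shows "gg u < gg v"
  using gg_order[OF assms(1-3)] assms(4) by simp

lemma odd_gg_neq:
  assumes "u \<in> W" "v \<in> W" "u \<noteq> v" "odd (gg u)"
  shows "gg u \<noteq> gg v"
  using pos_neq[OF assms(1-3)] gg_order[OF assms(1,2)] gg_order[OF assms(2,1)] assms(4) by auto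

lemma slot_backward:
  assumes uv: "u \<in> W" "v \<in> W" "u \<noteq> v" "odd (gg u)"
    and AB: "A \<subseteq> slot u" "B \<subseteq> slot v" "card (slot u) \<le> K * card A" "card (slot v) \<le> K * card B"
  shows "\<exists>a\<in>A. \<exists>b\<in>B. backward u v a b"
proof (cases "pos u < pos v")
  case True
  then have "gg u < gg v" using gg_less_if[OF uv(1,2)] odd_gg_neq[OF uv] by blast
  then show ?thesis
    using cell_backward[of "gg u" "gg v" "rr u" "rr v" A B] gg_less rr_less uv AB True
    unfolding slot_def backward_def by auto
next
  case False
  then have vu: "pos v < pos u" using pos_neq uv by blast
  then have "gg v < gg u" using gg_less_if[OF uv(2,1)] odd_gg_neq[OF uv] by metis
  then have "\<exists>b\<in>B. \<exists>a\<in>A. E a b"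
    using cell_backward[of "gg v" "gg u" "rr v" "rr u" B A] gg_less rr_less uv AB
    unfolding slot_def by auto
  then show ?thesis using False unfolding backward_def by auto
qed

text \<open>As \<open>backward\<close> is symmetric, \<open>triangle_free\<close> applies to the
  triple after sorting it by position; the six cases are the possible orders.\<close>

lemma no_backward_triple:
  assumes tf: "triangle_free" and W: "u \<in> W" "v \<in> W" "w \<in> W"
    and ne: "gg u \<noteq> gg v" "gg u \<noteq> gg w" "gg v \<noteq> gg w"
    and ab: "a \<in> slot u" "b \<in> slot v" "e \<in> slot w"
    and bk: "backward u v a b" "backward u w a e" "backward v w b e"
  shows False
proof -
  have t: "\<not> (E q p \<and> E s p \<and> E s q)"
    if "x \<in> W" "y \<in> W" "z \<in> W" "pos x < pos y" "pos y < pos z" "gg x \<noteq> gg y" "gg y \<noteq> gg z"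
      "p \<in> slot x" "q \<in> slot y" "s \<in> slot z" for x y z p q s
    using tf gg_less_if that unfolding triangle_free_def by blast
  have d: "u \<noteq> v" "u \<noteq> w" "v \<noteq> w" using ne by auto
  have bk': "backward v u b a" "backward w u e a" "backward w v e b"
    using bk backward_sym W d by blast+
  consider "pos u < pos v" "pos v < pos w" | "pos u < pos w" "pos w < pos v"
    | "pos v < pos u" "pos u < pos w" | "pos v < pos w" "pos w < pos u"
    | "pos w < pos u" "pos u < pos v" | "pos w < pos v" "pos v < pos u"
    using pos_neq[OF W(1,2) d(1)] pos_neq[OF W(1,3) d(2)] pos_neq[OF W(2,3) d(3)] by linarith
  then show False
  proof cases
    case 1
    then show ?thesis using t[OF W(1,2,3) 1 ne(1,3) ab(1,2,3)] bk unfolding backward_def by simp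
  next
    case 2
    then show ?thesis
      using t[OF W(1,3,2) 2 ne(2) ne(3)[symmetric] ab(1,3,2)] bk bk' unfolding backward_def by simp
  next
    case 3
    then show ?thesis
      using t[OF W(2,1,3) 3 ne(1)[symmetric] ne(2) ab(2,1,3)] bk bk' unfolding backward_def by simp
  next
    case 4
    then show ?thesis
      using t[OF W(2,3,1) 4 ne(3) ne(2)[symmetric] ab(2,3,1)] bk bk' unfolding backward_def by simp
  next
    case 5
    then show ?thesis
      using t[OF W(3,1,2) 5 ne(2)[symmetric] ne(1) ab(3,1,2)] bk bk' unfolding backward_def by simp
  next
    case 6
    then show ?thesis
      using t[OF W(3,2,1) 6 ne(3)[symmetric] ne(1)[symmetric] ab(3,2,1)] bk bk'
      unfolding backward_def by simp
  qed
qed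

lemma hom_intoI:
  assumes "X \<subseteq> W"
    and "\<And>u v. u \<in> X \<Longrightarrow> v \<in> X \<Longrightarrow> pos u < pos v \<Longrightarrow> if R v u then E (\<phi> v) (\<phi> u) else E (\<phi> u) (\<phi> v)"
  shows "hom_into X R E \<phi>"
  unfolding hom_into_def
proof (intro ballI impI)
  fix u v assume uv: "u \<in> X" "v \<in> X" "u \<noteq> v" "R u v"
  then have "\<not> R v u" using R_total assms(1) by blast
  moreover have "pos u < pos v \<or> pos v < pos u" using pos_neq uv assms(1) by blast
  ultimately show "E (\<phi> u) (\<phi> v)" using assms(2)[of u v] assms(2)[of v u] uv by auto
qed

text \<open>Candidates that miss a given leaf span no backward arc to its candidates, so by
  \<open>slot_backward\<close> they make up at most a fraction \<open>1 / (4 * card W)\<close> of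
  the slot. All leaves together rule out at most a quarter, which leaves a quarter of the half-slot
  \<open>F' c\<close>.\<close>

lemma many_with_backward_leaves:
  assumes "c \<in> W" "L \<subseteq> W - {c}" "odd (gg c)" "half_slots (insert c L) F'"
  shows "card (slot c) \<le> 4 * card {a \<in> F' c. \<forall>l\<in>L. \<exists>b\<in>F' l. backward c l a b}"
    (is "_ \<le> 4 * card ?A")
proof -
  define Z where "Z l = {a \<in> F' c. \<forall>b\<in>F' l. \<not> backward c l a b}" for l
  have L: "finite L" "card L \<le> card W" using assms(2) finite_W
    by (auto intro: finite_subset card_mono)
  have W0: "0 < card W" using assms(1) finite_W card_gt_0_iff by blast
  have Fc: "F' c \<subseteq> slot c" "card (slot c) \<le> 2 * card (F' c)"
    using assms(4) unfolding half_slots_def by auto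
  have fin: "finite (F' c)" using Fc slot_sub[OF assms(1)] finite_sub by blast
  have "4 * card W * card (Z l) \<le> card (slot c)" if l: "l \<in> L" for l
  proof (rule ccontr)
    assume "\<not> ?thesis"
    moreover have "4 * card W * card (Z l) \<le> K * card (Z l)" using K_large by (intro mult_le_mono1) simp
    ultimately have "card (slot c) \<le> K * card (Z l)" by linarith
    moreover have "Z l \<subseteq> slot c" using Fc unfolding Z_def by auto
    moreover have "F' l \<subseteq> slot l" "card (slot l) \<le> 2 * card (F' l)"
      using assms(4) l unfolding half_slots_def by auto
    moreover have "2 * card (F' l) \<le> K * card (F' l)" using K_large by (intro mult_le_mono1) simp
    moreover have "l \<in> W" "c \<noteq> l" using assms(2) l by auto
    ultimately have "\<exists>a\<in>Z l. \<exists>b\<in>F' l. backward c l a b"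
      using slot_backward[of c l "Z l" "F' l"] assms(1,3) order.trans by blast
    then show False unfolding Z_def by blast
  qed
  then have *: "4 * card (\<Union>l\<in>L. Z l) \<le> card (slot c)"
    using card_UN_small[OF L W0] by blast
  have "F' c \<subseteq> ?A \<union> (\<Union>l\<in>L. Z l)" unfolding Z_def by auto
  then have "card (F' c) \<le> card (?A \<union> (\<Union>l\<in>L. Z l))"
    using fin L by (intro card_mono) (auto simp: Z_def)
  also have "\<dots> \<le> card ?A + card (\<Union>l\<in>L. Z l)" by (rule card_Un_le)
  finally show ?thesis using * Fc(2) by linarith
qed

section \<open>Embedding a single part: a vertex, a star, two linked stars\<close>

lemma embeddable_singleton: "v \<in> W \<Longrightarrow> embeddable {v}"
  unfolding embeddable_def
proof (intro allI impI)
  fix F' assume "v \<in> W" "half_slots {v} F'"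
  then have "0 < card (F' v)" using slot_card[of v] unfolding half_slots_def by auto
  then obtain a where "a \<in> F' v" by fastforce
  then show "\<exists>\<phi>. (\<forall>v\<in>{v}. \<phi> v \<in> F' v) \<and> hom_into {v} R E \<phi>"
    by (intro exI[of _ "\<lambda>_. a"]) (simp add: hom_into_def)
qed

text \<open>Once the center has backward arcs to all leaves, the leaves must be forward among
  themselves. Within a group this is automatic; across groups a backward pair of leaves would form a
  backward triple with the center. Galaxies use the former alternative, super nebulas the
  latter.\<close>

lemma embeddable_star:
  assumes Q: "Q \<subseteq> W" "c \<in> Q" "odd (gg c)"
    and R: "\<And>u v. u \<in> Q \<Longrightarrow> v \<in> Q \<Longrightarrow> pos u < pos v \<Longrightarrow> R v u \<longleftrightarrow> u = c \<or> v = c"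
    and leaves: "\<And>u v. u \<in> Q - {c} \<Longrightarrow> v \<in> Q - {c} \<Longrightarrow> gg u = gg v \<or> triangle_free"
  shows "embeddable Q"
  unfolding embeddable_def
proof (intro allI impI)
  fix F' assume F': "half_slots Q F'"
  have cW: "c \<in> W" using Q by blast
  have "insert c (Q - {c}) = Q" using Q by blast
  then have "card (slot c) \<le> 4 * card {a \<in> F' c. \<forall>l\<in>Q - {c}. \<exists>b\<in>F' l. backward c l a b}"
    using many_with_backward_leaves[of c "Q - {c}" F'] Q F' cW by auto
  then have "card {a \<in> F' c. \<forall>l\<in>Q - {c}. \<exists>b\<in>F' l. backward c l a b} \<noteq> 0"
    using slot_card[OF cW] by linarith
  then have "{a \<in> F' c. \<forall>l\<in>Q - {c}. \<exists>b\<in>F' l. backward c l a b} \<noteq> {}" by (metis card.empty)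
  then obtain a where a: "a \<in> F' c" "\<forall>l\<in>Q - {c}. \<exists>b\<in>F' l. backward c l a b" by blast
  then obtain f where f: "\<And>l. l \<in> Q - {c} \<Longrightarrow> f l \<in> F' l \<and> backward c l a (f l)" by metis
  have in_slot: "F' v \<subseteq> slot v" if "v \<in> Q" for v using F' that unfolding half_slots_def by blast
  have "hom_into Q R E (f(c := a))"
  proof (rule hom_intoI[OF Q(1)])
    fix u v assume uv: "u \<in> Q" "v \<in> Q" "pos u < pos v"
    consider "u = c" "v \<noteq> c" | "v = c" "u \<noteq> c" | "u \<noteq> c" "v \<noteq> c" using uv by auto
    then show "if R v u then E ((f(c := a)) v) ((f(c := a)) u) else E ((f(c := a)) u) ((f(c := a)) v)"
    proof cases
      case 1
      then show ?thesis using f[of v] uv R[OF uv] unfolding backward_def by auto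
    next
      case 2
      then show ?thesis using f[of u] uv R[OF uv] unfolding backward_def by auto
    next
      case 3
      have W: "u \<in> W" "v \<in> W" using uv Q by auto
      have s: "f u \<in> slot u" "f v \<in> slot v" "a \<in> slot c" using f in_slot a(1) 3 uv Q by blast+
      have "E (f u) (f v)"
      proof (cases "gg u = gg v")
        case True
        then show ?thesis using slot_chain[OF W uv(3)] s by blast
      next
        case False
        then have tf: triangle_free using leaves[of u v] uv 3 by auto
        show ?thesis
        proof (rule ccontr)
          assume "\<not> ?thesis"
          then have "E (f v) (f u)" using slot_dir[OF W _ s(1,2)] uv(3) by auto
          then have "backward u v (f u) (f v)" using uv(3) unfolding backward_def by simp
          moreover have "gg c \<noteq> gg u" "gg c \<noteq> gg v" using odd_gg_neq[OF cW] W 3 Q(3) by metis+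
          ultimately show False
            using no_backward_triple[OF tf cW W _ _ False s(3,1,2)] f[of u] f[of v] uv 3 by blast
        qed
      qed
      then show ?thesis using R[OF uv] 3 by auto
    qed
  qed
  moreover have "\<forall>v\<in>Q. (f(c := a)) v \<in> F' v" using f a by auto
  ultimately show "\<exists>\<phi>. (\<forall>v\<in>Q. \<phi> v \<in> F' v) \<and> hom_into Q R E \<phi>" by blast
qed

text \<open>
  A leaf of one star that is backward to the center of the other star would form a backward triple
  with the two centers.
\<close>

lemma embeddable_two_stars:
  assumes tf: triangle_free
    and Q: "Q1 \<subseteq> W" "Q2 \<subseteq> W" "Q1 \<inter> Q2 = {}" "c \<in> Q1" "d \<in> Q2" "odd (gg c)" "odd (gg d)"
    and R: "\<And>u v. u \<in> Q1 \<union> Q2 \<Longrightarrow> v \<in> Q1 \<union> Q2 \<Longrightarrow> pos u < pos v \<Longrightarrow> R v u \<longleftrightarrow>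
      {u, v} = {c, d} \<or> u \<in> Q1 \<and> v \<in> Q1 \<and> (u = c \<or> v = c) \<or> u \<in> Q2 \<and> v \<in> Q2 \<and> (u = d \<or> v = d)"
    and leaves: "\<And>u v. u \<in> Q1 \<union> Q2 - {c, d} \<Longrightarrow> v \<in> Q1 \<union> Q2 - {c, d} \<Longrightarrow> gg u = gg v"
  shows "embeddable (Q1 \<union> Q2)"
  unfolding embeddable_def
proof (intro allI impI)
  fix F' assume F': "half_slots (Q1 \<union> Q2) F'"
  have W: "c \<in> W" "d \<in> W" "c \<noteq> d" using Q by auto
  have in_slot: "F' v \<subseteq> slot v" if "v \<in> Q1 \<union> Q2" for v
    using F' that unfolding half_slots_def by blast
  have ins: "insert c (Q1 - {c}) = Q1" "insert d (Q2 - {d}) = Q2" using Q by auto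
  have F'12: "half_slots Q1 F'" "half_slots Q2 F'" using F' unfolding half_slots_def by auto
  define A where "A = {a \<in> F' c. \<forall>l\<in>Q1 - {c}. \<exists>b\<in>F' l. backward c l a b}"
  define B where "B = {a \<in> F' d. \<forall>l\<in>Q2 - {d}. \<exists>b\<in>F' l. backward d l a b}"
  have "card (slot c) \<le> 4 * card A"
    using many_with_backward_leaves[of c "Q1 - {c}" F'] Q F'12 ins unfolding A_def by auto
  also have "\<dots> \<le> K * card A" using K_large by (intro mult_le_mono1) simp
  finally have cA: "card (slot c) \<le> K * card A" .
  have "card (slot d) \<le> 4 * card B"
    using many_with_backward_leaves[of d "Q2 - {d}" F'] Q F'12 ins unfolding B_def by auto
  also have "\<dots> \<le> K * card B" using K_large by (intro mult_le_mono1) simp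
  finally have cB: "card (slot d) \<le> K * card B" .
  have AB: "A \<subseteq> slot c" "B \<subseteq> slot d"
    using in_slot[of c] in_slot[of d] Q(4,5) unfolding A_def B_def by auto
  obtain a b where ab: "a \<in> A" "b \<in> B" "backward c d a b"
    using slot_backward[OF W Q(6) AB cA cB] by metis
  have "\<forall>l\<in>Q1 - {c}. \<exists>x. x \<in> F' l \<and> backward c l a x" using ab(1) unfolding A_def by auto
  then obtain f1 where f1: "\<And>l. l \<in> Q1 - {c} \<Longrightarrow> f1 l \<in> F' l \<and> backward c l a (f1 l)"
    by metis
  have "\<forall>l\<in>Q2 - {d}. \<exists>x. x \<in> F' l \<and> backward d l b x" using ab(2) unfolding B_def by auto
  then obtain f2 where f2: "\<And>l. l \<in> Q2 - {d} \<Longrightarrow> f2 l \<in> F' l \<and> backward d l b (f2 l)"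
    by metis
  define \<phi> where "\<phi> v = (if v = c then a else if v = d then b else if v \<in> Q1 then f1 v else f2 v)" for v
  have \<phi>F: "\<phi> v \<in> F' v" if "v \<in> Q1 \<union> Q2" for v
    using that f1[of v] f2[of v] ab unfolding \<phi>_def A_def B_def by auto
  have \<phi>s: "\<phi> v \<in> slot v" if "v \<in> Q1 \<union> Q2" for v using \<phi>F in_slot that by blast
  have \<phi>cd: "\<phi> c = a" "\<phi> d = b" unfolding \<phi>_def using W(3) by auto
  have back1: "backward c l a (\<phi> l)" if "l \<in> Q1 - {c}" for l
    using f1[OF that] that Q unfolding \<phi>_def by auto
  have back2: "backward d l b (\<phi> l)" if "l \<in> Q2 - {d}" for l
    using f2[OF that] that Q unfolding \<phi>_def by auto
  have cd_ne: "gg c \<noteq> gg d" using odd_gg_neq W Q by blast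
  have not1: "\<not> backward c l a (\<phi> l)" if l: "l \<in> Q2 - {d}" for l
  proof
    assume bk: "backward c l a (\<phi> l)"
    have lW: "l \<in> W" "c \<noteq> l" "d \<noteq> l" using l Q by auto
    show False
      using no_backward_triple[OF tf W(1,2) lW(1) cd_ne, of a b "\<phi> l"] odd_gg_neq W lW Q
        \<phi>s[of c] \<phi>s[of d] \<phi>s[of l] \<phi>cd l ab(3) bk back2[OF l] by auto
  qed
  have not2: "\<not> backward d l b (\<phi> l)" if l: "l \<in> Q1 - {c}" for l
  proof
    assume bk: "backward d l b (\<phi> l)"
    have lW: "l \<in> W" "c \<noteq> l" "d \<noteq> l" using l Q by auto
    show False
      using no_backward_triple[OF tf W(1,2) lW(1) cd_ne, of a b "\<phi> l"] odd_gg_neq W lW Q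
        \<phi>s[of c] \<phi>s[of d] \<phi>s[of l] \<phi>cd l ab(3) bk back1[OF l] by auto
  qed
  have cd: "backward u v (\<phi> u) (\<phi> v) \<longleftrightarrow>
      {u, v} = {c, d} \<or> u \<in> Q1 \<and> v \<in> Q1 \<and> (u = c \<or> v = c) \<or> u \<in> Q2 \<and> v \<in> Q2 \<and> (u = d \<or> v = d)"
    if uv: "u \<in> Q1 \<union> Q2" "v \<in> Q1 \<union> Q2" "u \<noteq> v" and c: "u \<in> {c, d}" for u v
  proof -
    have "u = c \<or> u = d" using c by auto
    then show ?thesis
    proof
      assume u: "u = c"
      consider "v \<in> Q1 - {c}" | "v = d" | "v \<in> Q2 - {d}" using uv u by auto
      then show ?thesis
      proof cases
        case 1
        then show ?thesis using back1[of v] u \<phi>cd(1) Q(4) by simp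
      next
        case 2
        then show ?thesis using ab(3) u \<phi>cd by simp
      next
        case 3
        then have "v \<notin> Q1" "c \<notin> Q2" "v \<noteq> d" using Q by auto
        then show ?thesis using not1[OF 3] u \<phi>cd(1) W(3) by auto
      qed
    next
      assume u: "u = d"
      consider "v \<in> Q2 - {d}" | "v = c" | "v \<in> Q1 - {c}" using uv u by auto
      then show ?thesis
      proof cases
        case 1
        then show ?thesis using back2[of v] u \<phi>cd(2) Q(5) by simp
      next
        case 2
        then show ?thesis using ab(3) u \<phi>cd backward_sym[OF W] by auto
      next
        case 3
        then have "v \<notin> Q2" "d \<notin> Q1" "v \<noteq> c" using Q by auto
        then show ?thesis using not2[OF 3] u \<phi>cd(2) W(3) by auto
      qed
    qed
  qed
  have "hom_into (Q1 \<union> Q2) R E \<phi>"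
  proof (rule hom_intoI)
    show "Q1 \<union> Q2 \<subseteq> W" using Q by auto
    fix u v assume uv: "u \<in> Q1 \<union> Q2" "v \<in> Q1 \<union> Q2" "pos u < pos v"
    have uvW: "u \<in> W" "v \<in> W" "u \<noteq> v" using uv Q by auto
    have dir: "E (\<phi> u) (\<phi> v) \<longleftrightarrow> \<not> E (\<phi> v) (\<phi> u)" using slot_dir uvW \<phi>s uv by blast
    have bE: "backward u v (\<phi> u) (\<phi> v) \<longleftrightarrow> E (\<phi> v) (\<phi> u)" using uv unfolding backward_def by simp
    have "backward u v (\<phi> u) (\<phi> v) \<longleftrightarrow> R v u"
    proof (cases "u \<in> {c, d} \<or> v \<in> {c, d}")
      case True
      then show ?thesis
      proof
        assume "u \<in> {c, d}"
        then show ?thesis using cd[OF uv(1,2) uvW(3)] R[OF uv] by blast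
      next
        assume "v \<in> {c, d}"
        then have "backward v u (\<phi> v) (\<phi> u) \<longleftrightarrow> R v u"
          using cd[OF uv(2,1)] uvW(3) R[OF uv] by blast
        then show ?thesis using backward_sym[OF uvW] by blast
      qed
    next
      case False
      then have "gg u = gg v" using leaves uv by auto
      then have "E (\<phi> u) (\<phi> v)" using slot_chain[OF uvW(1,2) uv(3)] \<phi>s uv by blast
      moreover have "\<not> R v u" using R[OF uv] False by auto
      ultimately show ?thesis using dir bE by blast
    qed
    then show "if R v u then E (\<phi> v) (\<phi> u) else E (\<phi> u) (\<phi> v)" using dir bE by auto
  qed
  then show "\<exists>\<phi>. (\<forall>v\<in>Q1 \<union> Q2. \<phi> v \<in> F' v) \<and> hom_into (Q1 \<union> Q2) R E \<phi>" using \<phi>F by blast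
qed

text \<open>
  Parts are embedded one after the other, each into the vertices of its slots that are forward with
  respect to everything embedded before; by smoothness these are at least half of the slots.
\<close>

lemma embed_parts:
  assumes "finite Ps" "Ps \<subseteq> Ps0" "disjoint Ps0" "\<And>X. X \<in> Ps0 \<Longrightarrow> X \<subseteq> W"
    and part: "\<And>u v. u \<in> W \<Longrightarrow> v \<in> W \<Longrightarrow> pos u < pos v \<Longrightarrow> R v u \<Longrightarrow> \<exists>X\<in>Ps0. u \<in> X \<and> v \<in> X"
    and emb: "\<And>X. X \<in> Ps \<Longrightarrow> embeddable X"
    and W0: "W0 \<subseteq> W" "\<And>X. X \<in> Ps \<Longrightarrow> X \<inter> W0 = {}" "\<forall>v\<in>W0. \<phi>0 v \<in> slot v" "hom_into W0 R E \<phi>0"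
  shows "\<exists>\<phi>. (\<forall>v\<in>W0 \<union> \<Union>Ps. \<phi> v \<in> slot v) \<and> hom_into (W0 \<union> \<Union>Ps) R E \<phi>"
  using assms(1,2) emb W0(2)
proof (induction Ps rule: finite_induct)
  case empty
  then show ?case using W0 by auto
next
  case (insert X Ps)
  define Y where "Y = W0 \<union> \<Union>Ps"
  obtain \<phi> where \<phi>: "\<forall>v\<in>Y. \<phi> v \<in> slot v" "hom_into Y R E \<phi>"
    unfolding Y_def using insert.IH insert.prems by (metis insert_subset insertI2)
  have XW: "X \<subseteq> W" using insert.prems(1) assms(4) by auto
  have YW: "Y \<subseteq> W" using W0(1) insert.prems(1) assms(4) unfolding Y_def by blast
  have XY: "X \<inter> Y = {}"
  proof -
    have "X \<inter> X' = {}" if "X' \<in> Ps" for X'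
      using assms(3) insert.prems(1) insert.hyps that unfolding disjoint_def by (metis insert_subset subsetD)
    then show ?thesis using insert.prems(3)[of X] unfolding Y_def by auto
  qed
  have closed: "\<not> R v u" if uv: "u \<in> W" "v \<in> W" "pos u < pos v" "u \<in> X \<and> v \<in> Y \<or> u \<in> Y \<and> v \<in> X" for u v
  proof
    assume "R v u"
    then obtain X' where X': "X' \<in> Ps0" "u \<in> X'" "v \<in> X'" using part uv by blast
    moreover have "X \<in> Ps0" using insert.prems(1) by simp
    ultimately have "X' = X" using uv(4) assms(3) unfolding disjoint_def by blast
    then show False using X' uv(4) XY by blast
  qed
  define bad where "bad v u = {b \<in> slot v. \<not> (if pos u < pos v then E (\<phi> u) b else E b (\<phi> u))}" for u v
  define F' where "F' v = slot v - (\<Union>u\<in>Y. bad v u)" for v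
  have "half_slots X F'"
    unfolding half_slots_def
  proof (intro ballI conjI)
    fix v assume v: "v \<in> X"
    then have vW: "v \<in> W" using XW by blast
    show "F' v \<subseteq> slot v" unfolding F'_def by auto
    have fin: "finite (slot v)" using slot_sub[OF vW] finite_sub by blast
    have Y: "finite Y" "card Y \<le> card W" using YW finite_W by (auto intro: finite_subset card_mono)
    have W1: "0 < card W" using vW finite_W card_gt_0_iff by blast
    have "2 * card W * card (bad v u) \<le> card (slot v)" if u: "u \<in> Y" for u
    proof -
      have uW: "u \<in> W" and uv: "u \<noteq> v" using u YW XY v by auto
      have \<phi>u: "\<phi> u \<in> slot u" using \<phi> u by blast
      have "D * card (bad v u) \<le> card (slot v)"
      proof (cases "pos u < pos v")
        case True
        then show ?thesis
          using slot_forward[OF uW vW] \<phi>u unfolding mostly_forward_def bad_def by auto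
      next
        case False
        then have "pos v < pos u" using pos_neq uW vW uv by blast
        then show ?thesis
          using slot_forward[OF vW uW] \<phi>u False unfolding mostly_forward_def bad_def by auto
      qed
      moreover have "2 * card W * card (bad v u) \<le> D * card (bad v u)"
        using D_large by (intro mult_le_mono1)
      ultimately show ?thesis by linarith
    qed
    then have "2 * card (\<Union>u\<in>Y. bad v u) \<le> card (slot v)"
      by (rule card_UN_small[OF Y W1])
    moreover have "card (slot v) \<le> card (F' v) + card (\<Union>u\<in>Y. bad v u)"
    proof -
      have "card (slot v) \<le> card (F' v \<union> (\<Union>u\<in>Y. bad v u))"
        unfolding F'_def bad_def using fin Y by (intro card_mono) auto
      then show ?thesis using card_Un_le le_trans by blast
    qed
    ultimately show "card (slot v) \<le> 2 * card (F' v)" by linarith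
  qed
  then obtain \<psi> where \<psi>: "\<forall>v\<in>X. \<psi> v \<in> F' v" "hom_into X R E \<psi>"
    using insert.prems(2)[of X] unfolding embeddable_def by auto
  define \<chi> where "\<chi> v = (if v \<in> X then \<psi> v else \<phi> v)" for v
  have \<chi>: "\<chi> v = \<phi> v" if "v \<in> Y" for v using that XY unfolding \<chi>_def by auto
  have cross: "if pos u < pos v then E (\<phi> u) (\<psi> v) else E (\<psi> v) (\<phi> u)" if "u \<in> Y" "v \<in> X" for u v
    using \<psi>(1) that unfolding F'_def bad_def by blast
  have "hom_into (X \<union> Y) R E \<chi>"
    unfolding hom_into_def
  proof (intro ballI impI)
    fix u v assume uv: "u \<in> X \<union> Y" "v \<in> X \<union> Y" "u \<noteq> v" "R u v"
    have uvW: "u \<in> W" "v \<in> W" using uv XW YW by auto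
    have "u \<in> X \<and> v \<in> X \<or> u \<in> Y \<and> v \<in> Y \<or> u \<in> X \<and> v \<in> Y \<or> u \<in> Y \<and> v \<in> X" using uv by blast
    then consider "u \<in> X" "v \<in> X" | "u \<in> Y" "v \<in> Y" | "u \<in> X" "v \<in> Y" | "u \<in> Y" "v \<in> X" by blast
    then show "E (\<chi> u) (\<chi> v)"
    proof cases
      case 1
      then show ?thesis using \<psi>(2) uv unfolding hom_into_def \<chi>_def by auto
    next
      case 2
      then show ?thesis using \<phi>(2) uv \<chi> unfolding hom_into_def by auto
    next
      case 3
      then have "pos u < pos v" using closed[OF uvW(2,1)] uv pos_neq uvW by blast
      then show ?thesis using cross[OF 3(2,1)] \<chi>[OF 3(2)] 3 unfolding \<chi>_def by auto
    next
      case 4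
      then have "pos u < pos v" using closed[OF uvW(2,1)] uv pos_neq uvW by blast
      then show ?thesis using cross[OF 4] \<chi>[OF 4(1)] 4 unfolding \<chi>_def by auto
    qed
  qed
  moreover have "\<forall>v\<in>X \<union> Y. \<chi> v \<in> slot v"
    using \<psi>(1) \<phi>(1) \<chi> unfolding F'_def \<chi>_def by auto
  moreover have "W0 \<union> \<Union>(insert X Ps) = X \<union> Y" unfolding Y_def by auto
  ultimately show ?case by metis
qed

end

section \<open>Orderings\<close>

lemma before_Cons: "before (x # xs) u v \<longleftrightarrow> x = u \<and> v \<in> set xs \<or> before xs u v"
proof
  assume "before (x # xs) u v"
  then obtain i j where ij: "i < j" "j < Suc (length xs)" "(x # xs) ! i = u" "(x # xs) ! j = v"
    unfolding before_def by auto
  obtain j' where j': "j = Suc j'" using ij(1) by (cases j) auto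
  show "x = u \<and> v \<in> set xs \<or> before xs u v"
  proof (cases i)
    case 0
    then show ?thesis using ij j' by auto
  next
    case (Suc i')
    then have "before xs u v" unfolding before_def using ij j' by auto
    then show ?thesis ..
  qed
next
  assume "x = u \<and> v \<in> set xs \<or> before xs u v"
  then show "before (x # xs) u v"
  proof
    assume "x = u \<and> v \<in> set xs"
    then obtain j where "j < length xs" "xs ! j = v" "x = u" by (auto simp: in_set_conv_nth)
    then show ?thesis unfolding before_def by (intro exI[of _ 0] exI[of _ "Suc j"]) auto
  next
    assume "before xs u v"
    then obtain i j where "i < j" "j < length xs" "xs ! i = u" "xs ! j = v"
      unfolding before_def by auto
    then show ?thesis unfolding before_def by (intro exI[of _ "Suc i"] exI[of _ "Suc j"]) auto
  qed
qed

lemma before_in_set: "before \<theta> u v \<Longrightarrow> u \<in> set \<theta> \<and> v \<in> set \<theta>"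
  unfolding before_def by (auto intro: nth_mem)

lemma before_restrict_ordering:
  "before (restrict_ordering \<theta> Y) u v \<longleftrightarrow> u \<in> Y \<and> v \<in> Y \<and> before \<theta> u v"
proof (induction \<theta>)
  case Nil
  then show ?case by (simp add: restrict_ordering_def before_def)
next
  case (Cons x \<theta>)
  then show ?case
    using before_in_set[of \<theta> u v] by (auto simp: restrict_ordering_def before_Cons)
qed

lemma set_restrict_ordering: "set (restrict_ordering \<theta> Y) = set \<theta> \<inter> Y"
  by (auto simp: restrict_ordering_def)

lemma ordering_positions:
  fixes \<theta> :: "'a list"
  assumes "distinct \<theta>"
  shows "\<exists>pos :: 'a \<Rightarrow> nat. inj_on pos (set \<theta>) \<and>
    (\<forall>u\<in>set \<theta>. \<forall>v\<in>set \<theta>. before \<theta> u v \<longleftrightarrow> pos u < pos v) \<and> (\<forall>u\<in>set \<theta>. pos u < length \<theta>)"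
proof -
  define pos where "pos v = (SOME i. i < length \<theta> \<and> \<theta> ! i = v)" for v
  have pos: "pos v < length \<theta> \<and> \<theta> ! pos v = v" if "v \<in> set \<theta>" for v
    unfolding pos_def by (rule someI_ex) (use that in \<open>simp add: in_set_conv_nth\<close>)
  have "before \<theta> u v \<longleftrightarrow> pos u < pos v" if uv: "u \<in> set \<theta>" "v \<in> set \<theta>" for u v
  proof
    assume "before \<theta> u v"
    then obtain i j where ij: "i < j" "j < length \<theta>" "\<theta> ! i = u" "\<theta> ! j = v"
      unfolding before_def by auto
    then have "i = pos u" "j = pos v"
      using pos[OF uv(1)] pos[OF uv(2)] assms nth_eq_iff_index_eq by (metis less_trans)+
    then show "pos u < pos v" using ij by simp
  next
    assume "pos u < pos v"
    then show "before \<theta> u v" unfolding before_def using pos uv by blast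
  qed
  moreover have "inj_on pos (set \<theta>)" using pos by (metis inj_onI)
  ultimately show ?thesis using pos by (intro exI[of _ pos]) blast
qed

text \<open>
  Consecutive non-separators share an even index; separators have an odd index of their own.
\<close>

definition group_index :: "'p set \<Rightarrow> ('p \<Rightarrow> bool) \<Rightarrow> ('p \<Rightarrow> nat) \<Rightarrow> 'p \<Rightarrow> nat" where
  "group_index W sep pos v = 2 * card {u \<in> W. sep u \<and> pos u < pos v} + (if sep v then 1 else 0)"

lemma odd_group_index: "odd (group_index W sep pos v) \<longleftrightarrow> sep v"
  unfolding group_index_def by simp

lemma group_index_mono:
  assumes "finite W" "u \<in> W" "pos u < pos v"
  shows "group_index W sep pos u < group_index W sep pos v \<or>
    group_index W sep pos u = group_index W sep pos v \<and> \<not> sep u \<and> \<not> sep v"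
proof (cases "sep u")
  case True
  have "{w \<in> W. sep w \<and> pos w < pos u} \<subset> {w \<in> W. sep w \<and> pos w < pos v}"
    using assms True by auto
  then have "card {w \<in> W. sep w \<and> pos w < pos u} < card {w \<in> W. sep w \<and> pos w < pos v}"
    using assms by (intro psubset_card_mono) auto
  then show ?thesis unfolding group_index_def using True by simp
next
  case False
  have "card {w \<in> W. sep w \<and> pos w < pos u} \<le> card {w \<in> W. sep w \<and> pos w < pos v}"
    using assms by (intro card_mono) auto
  then show ?thesis unfolding group_index_def using False by auto
qed

lemma group_index_less:
  assumes "finite W" "v \<in> W"
  shows "group_index W sep pos v < 2 * card W"
proof -
  have "{u \<in> W. sep u \<and> pos u < pos v} \<subset> W" using assms by blast
  then have "card {u \<in> W. sep u \<and> pos u < pos v} < card W" using assms psubset_card_mono by blast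
  then show ?thesis unfolding group_index_def by simp
qed

lemma group_index_eq:
  assumes "\<not> sep u" "\<not> sep v" "pos u < pos v"
    and "\<And>w. w \<in> W \<Longrightarrow> sep w \<Longrightarrow> \<not> (pos u < pos w \<and> pos w < pos v) \<and> pos w \<noteq> pos u"
  shows "group_index W sep pos u = group_index W sep pos v"
proof -
  have "pos w < pos u \<longleftrightarrow> pos w < pos v" if "w \<in> W" "sep w" for w
    using assms(3) assms(4)[OF that] by linarith
  then have "{w \<in> W. sep w \<and> pos w < pos u} = {w \<in> W. sep w \<and> pos w < pos v}" by blast
  then show ?thesis unfolding group_index_def using assms by simp
qed

section \<open>Tournaments, stars and nebulas\<close>

abbreviation dominates :: "'a pair_pre_digraph \<Rightarrow> 'a \<Rightarrow> 'a \<Rightarrow> bool" where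
  "dominates T u v \<equiv> (u, v) \<in> parcs T"

lemma tournament_arcs_dominates:
  assumes "tournament T"
  shows "tournament_arcs (pverts T) (dominates T)"
proof -
  interpret tournament T by fact
  show ?thesis
  proof
    show "finite (pverts T)" by (rule pair_finite_verts)
    show "\<not> dominates T u u" for u using pair_no_loops[of "(u, u)"] by auto
    show "dominates T u v \<longleftrightarrow> \<not> dominates T v u" if "u \<in> pverts T" "v \<in> pverts T" "u \<noteq> v" for u v
      using exactly_one_arc that by blast
  qed
qed

lemma asymp_on_dominates:
  assumes "tournament T"
  shows "asymp_on (pverts T) (dominates T)"
proof -
  interpret tournament_arcs "pverts T" "dominates T" using assms by (rule tournament_arcs_dominates)
  show ?thesis
  proof (rule asymp_onI)
    fix x y assume "x \<in> pverts T" "y \<in> pverts T" "dominates T x y"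
    then show "\<not> dominates T y x" using irrefl[of x] total[of x y] by (cases "x = y") auto
  qed
qed

lemma star_backward_arcs:
  assumes "star S us c"
  obtains r where "r < length us" "c = us ! r"
    "backward_arcs S us = {(us ! j, us ! i) |i j. i < j \<and> j < length us \<and> (i = r \<or> j = r)}"
proof -
  consider "left_star S us c" | "right_star S us c" | "middle_star S us c"
    using assms unfolding star_def by blast
  then show ?thesis
  proof cases
    case 1
    then have "0 < length us" "c = us ! 0" unfolding left_star_def by (auto simp: hd_conv_nth)
    moreover from this have "backward_arcs S us =
        {(us ! j, us ! i) |i j. i < j \<and> j < length us \<and> (i = 0 \<or> j = 0)}"
      using 1 unfolding left_star_def by auto
    ultimately show ?thesis using that by blast
  next
    case 2
    define r where "r = length us - 1"
    have r: "r < length us" "c = us ! r" "backward_arcs S us = {(c, us ! i) |i. i < r}"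
      using 2 unfolding right_star_def r_def by (auto simp: last_conv_nth)
    have "(i < j \<and> j < length us \<and> (i = r \<or> j = r)) \<longleftrightarrow> (j = r \<and> i < r)" for i j
      using r(1) unfolding r_def by linarith
    then have "backward_arcs S us = {(us ! j, us ! i) |i j. i < j \<and> j < length us \<and> (i = r \<or> j = r)}"
      unfolding r(2,3) by simp
    then show ?thesis using that r(1,2) by blast
  next
    case 3
    then obtain r where r: "0 < r" "r < length us - 1" "c = us ! r"
      "backward_arcs S us =
        {(us ! i, us ! r) | i. r < i \<and> i < length us} \<union> {(us ! r, us ! i) | i. i < r}"
      unfolding middle_star_def by blast
    have "r < length us" using r(2) by simp
    moreover have "backward_arcs S us =
        {(us ! j, us ! i) |i j. i < j \<and> j < length us \<and> (i = r \<or> j = r)}"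
      unfolding r(4) using \<open>r < length us\<close> by auto
    ultimately show ?thesis using that r(3) by blast
  qed
qed

lemma star_arcs:
  assumes "star S us c"
  shows "c \<in> set us" and "before us u v \<Longrightarrow> dominates S v u \<longleftrightarrow> u = c \<or> v = c"
proof -
  obtain r where r: "r < length us" "c = us ! r"
    "backward_arcs S us = {(us ! j, us ! i) |i j. i < j \<and> j < length us \<and> (i = r \<or> j = r)}"
    using star_backward_arcs[OF assms] .
  show "c \<in> set us" using r by simp
  assume b: "before us u v"
  then obtain i j where ij: "i < j" "j < length us" "us ! i = u" "us ! j = v"
    unfolding before_def by blast
  have d: "distinct us"
    using assms unfolding star_def left_star_def right_star_def middle_star_def tournament_ordering_def
    by blast
  have "dominates S v u \<longleftrightarrow> (v, u) \<in> backward_arcs S us" using b unfolding backward_arcs_def by simp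
  also have "\<dots> \<longleftrightarrow> i = r \<or> j = r"
  proof
    assume "(v, u) \<in> backward_arcs S us"
    then obtain i' j' where "i' < j'" "j' < length us" "i' = r \<or> j' = r" "us ! i' = u" "us ! j' = v"
      unfolding r(3) by blast
    moreover from this have "i' = i" "j' = j"
      using ij d nth_eq_iff_index_eq by (metis less_trans)+
    ultimately show "i = r \<or> j = r" by blast
  next
    assume "i = r \<or> j = r"
    then show "(v, u) \<in> backward_arcs S us" unfolding r(3) using ij by blast
  qed
  also have "\<dots> \<longleftrightarrow> u = c \<or> v = c"
    using r(1,2) ij d nth_eq_iff_index_eq by (metis less_trans)
  finally show "dominates S v u \<longleftrightarrow> u = c \<or> v = c" .
qed

lemma restricted_star_arcs:
  assumes "star (subtournament T Q) (restrict_ordering \<theta> Q) c"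
  shows "c \<in> Q"
    and "u \<in> Q \<Longrightarrow> v \<in> Q \<Longrightarrow> before \<theta> u v \<Longrightarrow> dominates T v u \<longleftrightarrow> u = c \<or> v = c"
  using star_arcs[OF assms]
  by (auto simp: set_restrict_ordering before_restrict_ordering subtournament_def)

lemma frontier_star_star: "frontier_star S us c \<Longrightarrow> star S us c"
  unfolding frontier_star_def star_def by blast

lemma frontier_star_center_extreme:
  assumes "frontier_star S us c"
  shows "\<not> (before us u c \<and> before us c v)"
proof
  assume b: "before us u c \<and> before us c v"
  have d: "distinct us" "us \<noteq> []"
    using assms unfolding frontier_star_def left_star_def right_star_def tournament_ordering_def by auto
  obtain i j i' j' where ij: "i < j" "j < length us" "us ! j = c" "i' < j'" "j' < length us" "us ! i' = c"
    using b unfolding before_def by blast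
  have "c = us ! 0 \<or> c = us ! (length us - 1)"
    using assms d unfolding frontier_star_def left_star_def right_star_def
    by (auto simp: hd_conv_nth last_conv_nth)
  then have "j = 0 \<or> i' = length us - 1"
    using ij d nth_eq_iff_index_eq[OF d(1), of j 0]
      nth_eq_iff_index_eq[OF d(1), of i' "length us - 1"] by force
  then show False using ij by auto
qed

lemma super_2_nebula_structure:
  fixes us :: "'a list"
  assumes "super_2_nebula H us c d"
  shows "\<exists>Q1 Q2. set us = Q1 \<union> Q2 \<and> Q1 \<inter> Q2 = {} \<and> c \<in> Q1 \<and> d \<in> Q2 \<and>
    (\<forall>u v. before us u v \<longrightarrow> (dominates H v u \<longleftrightarrow>
      {u, v} = {c, d} \<or> u \<in> Q1 \<and> v \<in> Q1 \<and> (u = c \<or> v = c) \<or> u \<in> Q2 \<and> v \<in> Q2 \<and> (u = d \<or> v = d))) \<and>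
    \<not> between_leaves us c (set us - {c, d}) \<and> \<not> between_leaves us d (set us - {c, d})"
proof -
  obtain T Q1 Q2 where ord: "tournament_ordering T us" and Q: "pverts T = Q1 \<union> Q2" "Q1 \<inter> Q2 = {}"
    and f: "frontier_star (subtournament T Q1) (restrict_ordering us Q1) c"
      "frontier_star (subtournament T Q2) (restrict_ordering us Q2) d"
    and parts: "\<forall>(u, v) \<in> backward_arcs T us. {u, v} \<subseteq> Q1 \<or> {u, v} \<subseteq> Q2"
    and config: "(\<forall>v \<in> pverts T - {c, d}. before us v c \<and> before us v d) \<or>
       (\<forall>v \<in> pverts T - {c, d}. between us v c d) \<or>
       (\<forall>v \<in> pverts T - {c, d}. before us c v \<and> before us d v)"
    and H: "H = reverse_arc T c d"
    using assms unfolding super_2_nebula_def by blast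
  note s1 = restricted_star_arcs[OF frontier_star_star[OF f(1)]]
  note s2 = restricted_star_arcs[OF frontier_star_star[OF f(2)]]
  have us: "set us = Q1 \<union> Q2" "distinct us" using ord Q unfolding tournament_ordering_def by auto
  interpret tournament_arcs "pverts T" "dominates T"
    using ord unfolding tournament_ordering_def by (intro tournament_arcs_dominates) blast
  obtain pos :: "'a \<Rightarrow> nat" where pos0: "\<forall>u\<in>set us. \<forall>v\<in>set us. before us u v \<longleftrightarrow> pos u < pos v"
    using ordering_positions[OF us(2)] by blast
  have pos: "before us u v \<longleftrightarrow> pos u < pos v" if "u \<in> set us" "v \<in> set us" for u v
    using pos0 that by simp
  have cd: "c \<in> set us" "d \<in> set us" "c \<in> Q1" "d \<in> Q2" "c \<noteq> d" using s1(1) s2(1) us Q by auto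
  have arcT: "dominates T v u \<longleftrightarrow>
      u \<in> Q1 \<and> v \<in> Q1 \<and> (u = c \<or> v = c) \<or> u \<in> Q2 \<and> v \<in> Q2 \<and> (u = d \<or> v = d)"
    if b: "before us u v" for u v
  proof
    assume "dominates T v u"
    then have "(v, u) \<in> backward_arcs T us" using b unfolding backward_arcs_def by simp
    then have "{v, u} \<subseteq> Q1 \<or> {v, u} \<subseteq> Q2" using parts by blast
    then show "u \<in> Q1 \<and> v \<in> Q1 \<and> (u = c \<or> v = c) \<or> u \<in> Q2 \<and> v \<in> Q2 \<and> (u = d \<or> v = d)"
      using s1(2)[of u v] s2(2)[of u v] b \<open>dominates T v u\<close> by auto
  next
    assume "u \<in> Q1 \<and> v \<in> Q1 \<and> (u = c \<or> v = c) \<or> u \<in> Q2 \<and> v \<in> Q2 \<and> (u = d \<or> v = d)"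
    then show "dominates T v u" using s1(2)[of u v] s2(2)[of u v] b by auto
  qed
  have arcH: "dominates H v u \<longleftrightarrow>
      {u, v} = {c, d} \<or> u \<in> Q1 \<and> v \<in> Q1 \<and> (u = c \<or> v = c) \<or> u \<in> Q2 \<and> v \<in> Q2 \<and> (u = d \<or> v = d)"
    if b: "before us u v" for u v
  proof (cases "{u, v} = {c, d}")
    case True
    then have uv: "u = c \<and> v = d \<or> u = d \<and> v = c" by (auto simp: doubleton_eq_iff)
    then have "\<not> dominates T v u" using arcT[OF b] Q(2) cd(3-5) by blast
    moreover have "u \<in> pverts T" "v \<in> pverts T" "u \<noteq> v" using uv cd us Q by auto
    ultimately have "dominates T u v" using total by blast
    moreover have "{v, u} = {c, d}" using True by (simp add: insert_commute)
    ultimately show ?thesis using True unfolding H reverse_arc_def by simp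
  next
    case False
    then have "{v, u} \<noteq> {c, d}" by (simp add: insert_commute)
    then have "dominates H v u \<longleftrightarrow> dominates T v u" unfolding H reverse_arc_def by simp
    then show ?thesis using arcT[OF b] False by blast
  qed
  have sides: "(pos x < pos c \<longleftrightarrow> pos y < pos c) \<and> (pos x < pos d \<longleftrightarrow> pos y < pos d)"
    if xy: "x \<in> set us - {c, d}" "y \<in> set us - {c, d}" for x y
  proof -
    have v: "x \<in> set us" "y \<in> set us" "x \<in> pverts T - {c, d}" "y \<in> pverts T - {c, d}"
      using xy us Q by auto
    have pc: "before us v c \<longleftrightarrow> pos v < pos c" "before us c v \<longleftrightarrow> pos c < pos v"
        "before us v d \<longleftrightarrow> pos v < pos d" "before us d v \<longleftrightarrow> pos d < pos v" if "v \<in> set us" for v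
      using pos that cd by blast+
    from config show ?thesis
    proof (elim disjE)
      assume "\<forall>v \<in> pverts T - {c, d}. before us v c \<and> before us v d"
      then show ?thesis using v pc by blast
    next
      assume "\<forall>v \<in> pverts T - {c, d}. between us v c d"
      then have "between us x c d" "between us y c d" using v by auto
      then show ?thesis unfolding between_def using pc[OF v(1)] pc[OF v(2)] by auto
    next
      assume "\<forall>v \<in> pverts T - {c, d}. before us c v \<and> before us d v"
      then have "pos c < pos x" "pos c < pos y" "pos d < pos x" "pos d < pos y" using v pc by blast+
      then show ?thesis by auto
    qed
  qed
  have nb: "\<not> between_leaves us e (set us - {c, d})" if e: "e = c \<or> e = d" for e
  proof
    assume "between_leaves us e (set us - {c, d})"
    then obtain x y where xy: "x \<in> set us - {c, d}" "y \<in> set us - {c, d}" "between us e x y"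
      unfolding between_leaves_def by blast
    then have "pos x < pos e \<and> pos e < pos y \<or> pos y < pos e \<and> pos e < pos x"
      unfolding between_def using pos e cd by auto
    then show False using sides[OF xy(1,2)] e by auto
  qed
  show ?thesis
    by (intro exI[of _ Q1] exI[of _ Q2] conjI allI impI us(1) Q(2) cd(3,4) nb arcH) simp_all
qed

section \<open>Embedding super nebulas and $\Delta$galaxies\<close>

lemma between_leaves_restrict_ordering:
  assumes "v \<in> Y" "L \<subseteq> Y"
  shows "between_leaves (restrict_ordering \<theta> Y) v L \<longleftrightarrow> between_leaves \<theta> v L"
  using assms unfolding between_leaves_def between_def before_restrict_ordering by blast

lemma disjoint_two_families_and_singletons:
  assumes "disjoint_family_on A I" "disjoint_family_on B J"
    and "(\<Union>i\<in>I. A i) \<inter> (\<Union>j\<in>J. B j) = {}" "((\<Union>i\<in>I. A i) \<union> (\<Union>j\<in>J. B j)) \<inter> X = {}"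
  shows "disjoint (A ` I \<union> B ` J \<union> (\<lambda>x. {x}) ` X)"
proof (intro disjoint_union)
  show "disjoint (A ` I)" "disjoint (B ` J)"
    using assms(1,2) by (simp_all add: disjoint_family_on_disjoint_image)
  show "disjoint ((\<lambda>x. {x}) ` X)" unfolding disjoint_def by auto
qed (use assms(3,4) in auto)

context grid
begin

lemma super_nebula_or_triangle:
  fixes N :: "'p pair_pre_digraph" and loc :: "nat \<Rightarrow> nat"
  assumes N: "super_nebula N"
    and loc: "strict_mono loc" "\<And>g. even (loc g) \<longleftrightarrow> even g" "loc (2 * card (pverts N)) \<le> k"
    and large: "card (pverts N) \<le> P" "2 * card (pverts N) \<le> D" "4 * card (pverts N) + 4 \<le> K"
  shows "(\<exists>\<phi>. \<phi> ` pverts N \<subseteq> V \<and> hom_into (pverts N) (dominates N) E \<phi>) \<or>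
    (\<exists>g1 g2 g3 r1 r2 r3 a b c. g1 < g2 \<and> g2 < g3 \<and> g3 < 2 * card (pverts N) \<and>
      r1 < P \<and> r2 < P \<and> r3 < P \<and> a \<in> F (loc g1) r1 \<and> b \<in> F (loc g2) r2 \<and> c \<in> F (loc g3) r3 \<and>
      E b a \<and> E c a \<and> E c b)"
proof -
  obtain \<theta> and m l :: nat and Q a S c d X where ord: "tournament_ordering N \<theta>"
    and W: "pverts N = (\<Union>i<m. Q i) \<union> (\<Union>j<l. S j) \<union> X"
    and dQ: "disjoint_family_on Q {..<m}" and dS: "disjoint_family_on S {..<l}"
    and dQS: "(\<Union>i<m. Q i) \<inter> (\<Union>j<l. S j) = {}"
    and dX: "((\<Union>i<m. Q i) \<union> (\<Union>j<l. S j)) \<inter> X = {}"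
    and stars: "\<forall>i<m. star (subtournament N (Q i)) (restrict_ordering \<theta> (Q i)) (a i)"
    and nebulas: "\<forall>j<l. super_2_nebula (subtournament N (S j)) (restrict_ordering \<theta> (S j)) (c j) (d j)"
    and parts: "\<forall>(u, v) \<in> backward_arcs N \<theta>. (\<exists>i<m. {u, v} \<subseteq> Q i) \<or> (\<exists>j<l. {u, v} \<subseteq> S j)"
    and sepQ: "\<forall>i<m. \<forall>j<l. \<not> between_leaves \<theta> (a i) (S j - {c j, d j})"
    and sepS: "\<forall>j<l. \<forall>j'<l. j \<noteq> j' \<longrightarrow>
        \<not> between_leaves \<theta> (c j) (S j' - {c j', d j'}) \<and>
        \<not> between_leaves \<theta> (d j) (S j' - {c j', d j'})"
    using N unfolding super_nebula_def by (elim exE conjE) (rule that)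
  define W' where "W' = pverts N"
  have \<theta>: "set \<theta> = W'" "distinct \<theta>" "tournament N"
    using ord unfolding tournament_ordering_def W'_def by auto
  interpret t: tournament_arcs W' "dominates N"
    unfolding W'_def using \<theta>(3) by (rule tournament_arcs_dominates)
  obtain pos :: "'p \<Rightarrow> nat" where inj: "inj_on pos W'"
    and pos0: "\<forall>u\<in>W'. \<forall>v\<in>W'. before \<theta> u v \<longleftrightarrow> pos u < pos v" and pos_less: "\<forall>u\<in>W'. pos u < length \<theta>"
    using ordering_positions[OF \<theta>(2)] unfolding \<theta>(1) by blast
  have pos: "before \<theta> u v \<longleftrightarrow> pos u < pos v" if "u \<in> W'" "v \<in> W'" for u v
    using pos0 that by simp
  have lenP: "length \<theta> \<le> P" using \<theta> distinct_card[of \<theta>] large(1) W'_def by simp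
  define sep where "sep v \<longleftrightarrow> v \<in> a ` {..<m} \<or> v \<in> c ` {..<l} \<or> v \<in> d ` {..<l}" for v
  define grp where "grp = group_index W' sep pos"
  interpret p: grid_pattern V E F k P D K W' "dominates N" pos "\<lambda>v. loc (grp v)" pos
  proof
    show "finite W'" by (rule t.finite_V)
    show "inj_on pos W'" by (rule inj)
    show "dominates N u v \<longleftrightarrow> \<not> dominates N v u" if "u \<in> W'" "v \<in> W'" "u \<noteq> v" for u v
      using t.total that by blast
    show "loc (grp u) < k" if "u \<in> W'" for u
    proof -
      have "grp u < 2 * card W'" unfolding grp_def using t.finite_V that by (rule group_index_less)
      then have "loc (grp u) < loc (2 * card W')" using loc(1) by (simp add: strict_mono_less)
      then show ?thesis using loc(3) unfolding W'_def by simp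
    qed
    show "pos u < P" if "u \<in> W'" for u using pos_less that lenP by force
    show "loc (grp u) < loc (grp v) \<or> loc (grp u) = loc (grp v) \<and> even (loc (grp u)) \<and> pos u < pos v"
      if "u \<in> W'" "v \<in> W'" "pos u < pos v" for u v
    proof -
      have "grp u < grp v \<or> grp u = grp v \<and> \<not> sep u \<and> \<not> sep v"
        unfolding grp_def using t.finite_V that(1,3) by (rule group_index_mono)
      moreover have "even (grp u)" if "\<not> sep u"
        using odd_group_index[of W' sep pos u] that unfolding grp_def by simp
      ultimately show ?thesis using that loc(1,2) by (auto simp: strict_mono_less)
    qed
    show "2 * card W' \<le> D" "4 * card W' + 4 \<le> K" using large W'_def by auto
  qed
  have odd_sep: "odd (loc (grp v))" if "sep v" for v
    using that odd_group_index[of W' sep pos v] loc(2) unfolding grp_def by simp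
  show ?thesis
  proof (cases p.triangle_free)
    case False
    then obtain u v w x y z where uvw: "u \<in> W'" "v \<in> W'" "w \<in> W'"
        "loc (grp u) < loc (grp v)" "loc (grp v) < loc (grp w)"
        "x \<in> p.slot u" "y \<in> p.slot v" "z \<in> p.slot w" "E y x" "E z x" "E z y"
      unfolding p.triangle_free_def by blast
    have "grp u < grp v" "grp v < grp w" using uvw loc(1) by (auto simp: strict_mono_less)
    moreover have "grp w < 2 * card (pverts N)"
      using group_index_less[OF t.finite_V uvw(3)] unfolding grp_def W'_def by simp
    moreover have "pos u < P" "pos v < P" "pos w < P" using uvw(1-3) p.rr_less by auto
    ultimately show ?thesis using uvw(6-) unfolding p.slot_def by blast
  next
    case True
    have QW: "Q i \<subseteq> W'" if "i < m" for i using W that unfolding W'_def by auto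
    have SW: "S j \<subseteq> W'" if "j < l" for j using W that unfolding W'_def by auto
    have embQ: "p.embeddable (Q i)" if i: "i < m" for i
    proof -
      note s = restricted_star_arcs[OF stars[rule_format, OF i]]
      show ?thesis
      proof (rule p.embeddable_star)
        show "Q i \<subseteq> W'" "a i \<in> Q i" using QW i s(1) by auto
        show "odd (loc (grp (a i)))" using i by (intro odd_sep) (auto simp: sep_def)
        show "dominates N v u \<longleftrightarrow> u = a i \<or> v = a i"
          if uv: "u \<in> Q i" "v \<in> Q i" "pos u < pos v" for u v
        proof -
          have "before \<theta> u v" using pos uv QW[OF i] by blast
          then show ?thesis using s(2) uv by blast
        qed
      qed (use True in blast)
    qed
    have embS: "p.embeddable (S j)" if j: "j < l" for j
    proof -
      have us: "set (restrict_ordering \<theta> (S j)) = S j"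
        using SW[OF j] \<theta>(1) by (auto simp: set_restrict_ordering)
      obtain Q1 Q2 where Q12: "S j = Q1 \<union> Q2" "Q1 \<inter> Q2 = {}" "c j \<in> Q1" "d j \<in> Q2"
        and arcs: "\<forall>u v. before (restrict_ordering \<theta> (S j)) u v \<longrightarrow>
          (dominates (subtournament N (S j)) v u \<longleftrightarrow>
          {u, v} = {c j, d j} \<or> u \<in> Q1 \<and> v \<in> Q1 \<and> (u = c j \<or> v = c j) \<or>
          u \<in> Q2 \<and> v \<in> Q2 \<and> (u = d j \<or> v = d j))"
        and own: "\<not> between_leaves (restrict_ordering \<theta> (S j)) (c j) (S j - {c j, d j})"
          "\<not> between_leaves (restrict_ordering \<theta> (S j)) (d j) (S j - {c j, d j})"
        using super_2_nebula_structure[OF nebulas[rule_format, OF j]] unfolding us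
        by (elim exE conjE) (rule that)
      have cdS: "c j \<in> S j" "d j \<in> S j" using Q12 by auto
      have own': "\<not> between_leaves \<theta> (c j) (S j - {c j, d j})" "\<not> between_leaves \<theta> (d j) (S j - {c j, d j})"
        using own between_leaves_restrict_ordering[of _ "S j"] cdS by auto
      have cdS': "c j' \<in> S j'" "d j' \<in> S j'" if "j' < l" for j'
      proof -
        have "set (restrict_ordering \<theta> (S j')) = S j'"
          using SW[OF that] \<theta>(1) by (auto simp: set_restrict_ordering)
        then show "c j' \<in> S j'" "d j' \<in> S j'"
          using super_2_nebula_structure[OF nebulas[rule_format, OF that]] by auto
      qed
      have no_between: "\<not> between_leaves \<theta> w (S j - {c j, d j})" if "sep w" for w
      proof -
        consider i where "i < m" "w = a i" | j' where "j' < l" "w = c j' \<or> w = d j'"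
          using \<open>sep w\<close> unfolding sep_def by auto
        then show ?thesis
        proof cases
          case 1
          then show ?thesis using sepQ j by blast
        next
          case 2
          then show ?thesis using sepS j own' by (cases "j' = j") auto
        qed
      qed
      have not_sep: "\<not> sep u" if u: "u \<in> S j - {c j, d j}" for u
      proof
        assume "sep u"
        then consider i where "i < m" "u = a i" | j' where "j' < l" "u = c j' \<or> u = d j'"
          unfolding sep_def by auto
        then show False
        proof cases
          case 1
          then have "u \<in> Q i" using restricted_star_arcs(1)[OF stars[rule_format, OF 1(1)]] by simp
          then show False using dQS u 1 j by auto
        next
          case 2
          then have "u \<in> S j'" using cdS' by auto
          then have "j' = j" using dS u 2 j unfolding disjoint_family_on_def by blast
          then show False using 2 u by auto
        qed
      qed
      have eq: "grp u = grp v"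
        if uv: "u \<in> S j - {c j, d j}" "v \<in> S j - {c j, d j}" "pos u < pos v" for u v
        unfolding grp_def
      proof (rule group_index_eq)
        fix w assume w: "w \<in> W'" "sep w"
        have uvW: "u \<in> W'" "v \<in> W'" using uv SW[OF j] by auto
        have "\<not> between \<theta> w u v" using no_between[OF w(2)] uv unfolding between_leaves_def by blast
        then have "\<not> (pos u < pos w \<and> pos w < pos v)"
          unfolding between_def using pos w(1) uvW by blast
        moreover have "pos w \<noteq> pos u"
          using inj w uvW not_sep[OF uv(1)] by (metis inj_onD)
        ultimately show "\<not> (pos u < pos w \<and> pos w < pos v) \<and> pos w \<noteq> pos u" by blast
      qed (use not_sep uv in auto)
      have "p.embeddable (Q1 \<union> Q2)"
      proof (rule p.embeddable_two_stars[OF True])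
        show "Q1 \<subseteq> W'" "Q2 \<subseteq> W'" using SW[OF j] Q12 by auto
        show "Q1 \<inter> Q2 = {}" "c j \<in> Q1" "d j \<in> Q2" by fact+
        show "odd (loc (grp (c j)))" "odd (loc (grp (d j)))"
          using j by (auto intro!: odd_sep simp: sep_def)
        show "dominates N v u \<longleftrightarrow>
          {u, v} = {c j, d j} \<or> u \<in> Q1 \<and> v \<in> Q1 \<and> (u = c j \<or> v = c j) \<or>
          u \<in> Q2 \<and> v \<in> Q2 \<and> (u = d j \<or> v = d j)"
          if uv: "u \<in> Q1 \<union> Q2" "v \<in> Q1 \<union> Q2" "pos u < pos v" for u v
        proof -
          have S: "u \<in> S j" "v \<in> S j" using uv Q12 by auto
          then have "before (restrict_ordering \<theta> (S j)) u v"
            using pos uv SW[OF j] by (auto simp: before_restrict_ordering)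
          moreover have "dominates (subtournament N (S j)) v u \<longleftrightarrow> dominates N v u"
            using S by (auto simp: subtournament_def)
          ultimately show ?thesis using arcs by simp
        qed
        show "loc (grp u) = loc (grp v)"
          if uv: "u \<in> Q1 \<union> Q2 - {c j, d j}" "v \<in> Q1 \<union> Q2 - {c j, d j}" for u v
        proof (cases "u = v")
          case False
          have "u \<in> W'" "v \<in> W'" using uv SW[OF j] Q12 by auto
          then show ?thesis using p.pos_neq[OF _ _ False] eq[of u v] eq[of v u] uv Q12(1) by auto
        qed simp
      qed
      then show ?thesis using Q12(1) by simp
    qed
    define Ps where "Ps = Q ` {..<m} \<union> S ` {..<l} \<union> (\<lambda>x. {x}) ` X"
    have XW: "X \<subseteq> W'" using W W'_def by auto
    have finPs: "finite Ps" unfolding Ps_def using XW t.finite_V finite_subset by auto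
    have "\<exists>\<phi>. (\<forall>v\<in>{} \<union> \<Union>Ps. \<phi> v \<in> p.slot v) \<and> hom_into ({} \<union> \<Union>Ps) (dominates N) E \<phi>"
    proof (rule p.embed_parts[OF finPs order_refl])
      show "disjoint Ps" unfolding Ps_def using dQ dS dQS dX
        by (rule disjoint_two_families_and_singletons)
      show "Y \<subseteq> W'" if "Y \<in> Ps" for Y using that QW SW XW unfolding Ps_def by auto
      show "p.embeddable Y" if "Y \<in> Ps" for Y
        using that embQ embS p.embeddable_singleton XW unfolding Ps_def by auto
      show "\<exists>Y\<in>Ps. u \<in> Y \<and> v \<in> Y" if uv: "u \<in> W'" "v \<in> W'" "pos u < pos v" "dominates N v u" for u v
      proof -
        have "(v, u) \<in> backward_arcs N \<theta>" using uv pos unfolding backward_arcs_def by auto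
        then have "(\<exists>i<m. {v, u} \<subseteq> Q i) \<or> (\<exists>j<l. {v, u} \<subseteq> S j)" using parts by blast
        then show ?thesis unfolding Ps_def by blast
      qed
    qed (auto simp: hom_into_def)
    moreover have "\<Union>Ps = pverts N" unfolding Ps_def W by auto
    ultimately obtain \<phi> where "\<forall>v\<in>pverts N. \<phi> v \<in> p.slot v" "hom_into (pverts N) (dominates N) E \<phi>"
      by auto
    moreover from this have "\<phi> ` pverts N \<subseteq> V" using p.slot_sub unfolding W'_def by blast
    ultimately show ?thesis by blast
  qed
qed

end

text \<open>
  The group of a vertex at position \<open>p\<close> with group index \<open>g\<close> when the triangle vertices, at positions
  \<open>p1\<close>, \<open>p2\<close>, \<open>p3\<close>, have been placed into the groups \<open>q1\<close>, \<open>q2\<close>, \<open>q3\<close>.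
\<close>

definition place :: "nat \<Rightarrow> nat \<Rightarrow> nat \<Rightarrow> nat \<Rightarrow> nat \<Rightarrow> nat \<Rightarrow> nat \<Rightarrow> nat \<Rightarrow> nat \<Rightarrow> nat \<Rightarrow> nat \<Rightarrow> nat" where
  "place p1 p2 p3 q1 q2 q3 b1 b2 b3 p g =
    (if p < p1 then g else if p = p1 then q1 else if p < p2 then b1 + g else if p = p2 then q2
     else if p < p3 then b2 + g else if p = p3 then q3 else b3 + g)"

context grid
begin

lemma Delta_galaxy_completion:
  fixes G :: "'p pair_pre_digraph"
  assumes G: "Delta_galaxy G"
    and q: "r1 < P" "r2 < P" "r3 < P" "a1 \<in> F q1 r1" "a2 \<in> F q2 r2" "a3 \<in> F q3 r3"
      "E a2 a1" "E a3 a1" "E a3 a2"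
    and b: "even b1" "even b2" "even b3"
    and gaps: "2 * card (pverts G) \<le> q1" "q1 < b1" "b1 + 2 * card (pverts G) \<le> q2" "q2 < b2"
      "b2 + 2 * card (pverts G) \<le> q3" "q3 < b3" "b3 + 2 * card (pverts G) \<le> k"
    and large: "card (pverts G) \<le> P" "2 * card (pverts G) \<le> D" "4 * card (pverts G) + 4 \<le> K"
  shows "\<exists>\<phi>. \<phi> ` pverts G \<subseteq> V \<and> hom_into (pverts G) (dominates G) E \<phi>"
proof -
  obtain \<theta> and D' X and m :: nat and Q a where ord: "tournament_ordering G \<theta>"
    and W0: "pverts G = (\<Union>i<(1::nat). D' i) \<union> X" "(\<Union>i<(1::nat). D' i) \<inter> X = {}"
      "disjoint_family_on D' {..<1}"
    and tri0: "\<forall>i<1. triangle G \<theta> (D' i)"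
    and parts0: "\<forall>(u, v) \<in> backward_arcs G \<theta>. (\<exists>i<1. {u, v} \<subseteq> D' i) \<or> {u, v} \<subseteq> X"
    and gal: "galaxy_decomposition (subtournament G X) (restrict_ordering \<theta> X) m Q a"
    and sepD0: "\<forall>i<1. \<forall>v \<in> D' i. \<forall>k<m. \<not> between_leaves \<theta> v (Q k - {a k})"
    using G unfolding Delta_galaxy_def triangular_galaxy_def by (elim exE conjE) (rule that)
  obtain x y z where xyz: "D' 0 = {x, y, z}" "before \<theta> x y" "before \<theta> y z"
    "dominates G y x" "dominates G z x" "dominates G z y"
    using tri0 unfolding triangle_def by auto
  have W: "pverts G = {x, y, z} \<union> X" "{x, y, z} \<inter> X = {}" using W0(1,2) xyz(1) by (simp_all add: lessThan_Suc)
  have parts: "{u, v} \<subseteq> {x, y, z} \<or> {u, v} \<subseteq> X" if "(u, v) \<in> backward_arcs G \<theta>" for u v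
    using parts0 that xyz(1) by auto
  have sepD: "\<not> between_leaves \<theta> v (Q i - {a i})" if "v \<in> {x, y, z}" "i < m" for v i
    using sepD0 that xyz(1) by auto
  obtain X' where X': "X = (\<Union>i<m. Q i) \<union> X'" "(\<Union>i<m. Q i) \<inter> X' = {}"
    using gal unfolding galaxy_decomposition_def subtournament_def by auto
  have dQ: "disjoint_family_on Q {..<m}"
    and stars: "\<forall>i<m. frontier_star (subtournament (subtournament G X) (Q i))
      (restrict_ordering (restrict_ordering \<theta> X) (Q i)) (a i)"
    and partsX: "\<forall>(u, v) \<in> backward_arcs (subtournament G X) (restrict_ordering \<theta> X). \<exists>i<m. {u, v} \<subseteq> Q i"
    and sepX: "\<forall>i<m. \<forall>i'<m. i \<noteq> i' \<longrightarrow> \<not> between_leaves (restrict_ordering \<theta> X) (a i) (Q i' - {a i'})"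
    using gal unfolding galaxy_decomposition_def by auto
  define W' where "W' = pverts G"
  have \<theta>: "set \<theta> = W'" "distinct \<theta>" "tournament G"
    using ord unfolding tournament_ordering_def W'_def by auto
  interpret t: tournament_arcs W' "dominates G"
    unfolding W'_def using \<theta>(3) by (rule tournament_arcs_dominates)
  obtain pos :: "'p \<Rightarrow> nat" where inj: "inj_on pos W'"
    and pos0: "\<forall>u\<in>W'. \<forall>v\<in>W'. before \<theta> u v \<longleftrightarrow> pos u < pos v" and pos_less: "\<forall>u\<in>W'. pos u < length \<theta>"
    using ordering_positions[OF \<theta>(2)] unfolding \<theta>(1) by blast
  have pos: "before \<theta> u v \<longleftrightarrow> pos u < pos v" if "u \<in> W'" "v \<in> W'" for u v
    using pos0 that by simp
  have lenP: "length \<theta> \<le> P" using \<theta> distinct_card[of \<theta>] large(1) W'_def by simp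
  have xyzW: "x \<in> W'" "y \<in> W'" "z \<in> W'" using W W'_def by auto
  have pxyz: "pos x < pos y" "pos y < pos z" using pos xyz xyzW by auto
  have QX: "Q i \<subseteq> X" if "i < m" for i using X' that by auto
  have XW: "X \<subseteq> W'" using W W'_def by auto
  have QW: "Q i \<subseteq> W'" if "i < m" for i using QX[OF that] XW by auto
  define sep where "sep v \<longleftrightarrow> v \<in> {x, y, z} \<or> v \<in> a ` {..<m}" for v
  define grp where "grp = group_index W' sep pos"
  define pl where "pl = place (pos x) (pos y) (pos z) q1 q2 q3 b1 b2 b3"
  define gg where "gg v = pl (pos v) (grp v)" for v
  define rr where "rr v = (if v = x then r1 else if v = y then r2 else if v = z then r3 else pos v)" for v
  have grp_less: "grp u < 2 * card (pverts G)" if "u \<in> W'" for u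
    using group_index_less[OF t.finite_V that] unfolding grp_def W'_def by simp
  have pos_eq: "pos u = pos w \<longleftrightarrow> u = w" if "u \<in> W'" "w \<in> W'" for u w
    using inj that by (metis inj_onD)
  have gg_xyz: "gg x = q1" "gg y = q2" "gg z = q3"
    using pxyz unfolding gg_def pl_def place_def by auto
  interpret p: grid_pattern V E F k P D K W' "dominates G" pos gg rr
  proof
    show "finite W'" by (rule t.finite_V)
    show "inj_on pos W'" by (rule inj)
    show "dominates G u v \<longleftrightarrow> \<not> dominates G v u" if "u \<in> W'" "v \<in> W'" "u \<noteq> v" for u v
      using t.total that by blast
    show "gg u < k" if "u \<in> W'" for u
      using grp_less[OF that] gaps unfolding gg_def pl_def place_def by auto
    show "rr u < P" if "u \<in> W'" for u using pos_less that lenP q(1-3) unfolding rr_def by force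
    show "gg u < gg v \<or> gg u = gg v \<and> even (gg u) \<and> rr u < rr v"
      if uv: "u \<in> W'" "v \<in> W'" "pos u < pos v" for u v
    proof -
      have m: "grp u < grp v \<or> grp u = grp v \<and> \<not> sep u \<and> \<not> sep v"
        unfolding grp_def using t.finite_V uv(1,3) by (rule group_index_mono)
      have ev: "even (grp u)" if "\<not> sep u"
        using odd_group_index[of W' sep pos u] that unfolding grp_def by simp
      note less = grp_less[OF uv(1)] grp_less[OF uv(2)]
      note pe = pos_eq[OF uv(1) xyzW(1)] pos_eq[OF uv(1) xyzW(2)] pos_eq[OF uv(1) xyzW(3)]
        pos_eq[OF uv(2) xyzW(1)] pos_eq[OF uv(2) xyzW(2)] pos_eq[OF uv(2) xyzW(3)]
      show ?thesis
      proof (cases "gg u < gg v")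
        case False
        have ns: "pos u \<notin> {pos x, pos y, pos z} \<and> pos v \<notin> {pos x, pos y, pos z} \<and> gg u = gg v \<and>
            grp u = grp v \<and> gg u \<in> {grp u, b1 + grp u, b2 + grp u, b3 + grp u}"
          using False m less gaps uv(3) pxyz unfolding gg_def pl_def place_def
          by (auto split: if_splits)
        then have "\<not> sep u" "u \<notin> {x, y, z}" "v \<notin> {x, y, z}" using m by auto
        moreover have "even (gg u)"
        proof -
          have "gg u = grp u \<or> gg u = b1 + grp u \<or> gg u = b2 + grp u \<or> gg u = b3 + grp u"
            using ns by blast
          then show ?thesis using ev[OF \<open>\<not> sep u\<close>] b by (elim disjE) simp_all
        qed
        ultimately show ?thesis using ns uv(3) unfolding rr_def by auto
      qed blast
    qed
    show "2 * card W' \<le> D" "4 * card W' + 4 \<le> K" using large W'_def by auto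
  qed
  have centerQ: "a i \<in> Q i" if "i < m" for i
    using restricted_star_arcs(1)[OF frontier_star_star[OF stars[rule_format, OF that]]] .
  have not_xyz: "pos u \<notin> {pos x, pos y, pos z}" if "u \<in> X" for u
    using pos_eq xyzW that XW W(2) by blast
  have emb: "p.embeddable (Q i)" if i: "i < m" for i
  proof (rule p.embeddable_star)
    note f = stars[rule_format, OF i]
    note s = restricted_star_arcs(2)[OF frontier_star_star[OF f]]
    show "Q i \<subseteq> W'" "a i \<in> Q i" using QW centerQ i by auto
    have "sep (a i)" using i unfolding sep_def by auto
    then have "odd (grp (a i))"
      using odd_group_index[of W' sep pos "a i"] unfolding grp_def by simp
    then show "odd (gg (a i))"
      using not_xyz[of "a i"] centerQ[OF i] QX[OF i] b unfolding gg_def pl_def place_def by auto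
    show "dominates G v u \<longleftrightarrow> u = a i \<or> v = a i" if uv: "u \<in> Q i" "v \<in> Q i" "pos u < pos v" for u v
    proof -
      have "before (restrict_ordering \<theta> X) u v"
        using pos uv QW[OF i] QX[OF i] by (auto simp: before_restrict_ordering)
      moreover have "dominates (subtournament G X) v u \<longleftrightarrow> dominates G v u"
        using uv QX[OF i] by (auto simp: subtournament_def)
      ultimately show ?thesis using s[OF uv(1,2)] by blast
    qed
    have not_sep: "\<not> sep u" if u: "u \<in> Q i - {a i}" for u
    proof
      assume "sep u"
      then consider "u \<in> {x, y, z}" | i' where "i' < m" "u = a i'" unfolding sep_def by auto
      then show False
      proof cases
        case 1
        then show False using u QX[OF i] W(2) by blast
      next
        case 2
        then have "u \<in> Q i'" using centerQ by simp
        then have "i' = i" using dQ u 2 i unfolding disjoint_family_on_def by blast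
        then show False using 2 u by auto
      qed
    qed
    have eq: "gg u = gg v" if uv: "u \<in> Q i - {a i}" "v \<in> Q i - {a i}" "pos u < pos v" for u v
    proof -
      have uvW: "u \<in> W'" "v \<in> W'" "u \<in> X" "v \<in> X" using uv QW[OF i] QX[OF i] by auto
      have nb: "\<not> (pos u < pos w \<and> pos w < pos v)" if w: "w \<in> W'" "sep w" for w
      proof
        assume b: "pos u < pos w \<and> pos w < pos v"
        then have bt: "before \<theta> u w" "before \<theta> w v" using pos uvW w by auto
        then have bl: "between_leaves \<theta> w (Q i - {a i})"
          using uv unfolding between_leaves_def between_def by blast
        consider "w \<in> {x, y, z}" | "w = a i" | i' where "i' < m" "w = a i'" "i' \<noteq> i"
          using w(2) unfolding sep_def by auto
        then show False
        proof cases
          case 1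
          then show False using sepD bl i by blast
        next
          case 2
          then have "before (restrict_ordering (restrict_ordering \<theta> X) (Q i)) u (a i)"
              "before (restrict_ordering (restrict_ordering \<theta> X) (Q i)) (a i) v"
            using bt uv uvW centerQ[OF i] QX[OF i] by (auto simp: before_restrict_ordering)
          then show False using frontier_star_center_extreme[OF f] by blast
        next
          case 3
          have "a i' \<in> X" using 3 centerQ QX by blast
          then have "\<not> between_leaves \<theta> w (Q i - {a i})"
            using sepX 3 i between_leaves_restrict_ordering[of "a i'" X "Q i - {a i}" \<theta>] QX[OF i] by blast
          then show False using bl by blast
        qed
      qed
      have "grp u = grp v"
        unfolding grp_def
      proof (rule group_index_eq)
        fix w assume w: "w \<in> W'" "sep w"
        have "pos w \<noteq> pos u" using pos_eq[OF w(1) uvW(1)] w not_sep[OF uv(1)] by blast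
        then show "\<not> (pos u < pos w \<and> pos w < pos v) \<and> pos w \<noteq> pos u" using nb[OF w] by blast
      qed (use not_sep uv in auto)
      moreover have "(pos u < pos w \<longleftrightarrow> pos v < pos w) \<and> pos u \<noteq> pos w \<and> pos v \<noteq> pos w"
        if w: "w \<in> {x, y, z}" for w
      proof -
        have "pos w \<in> {pos x, pos y, pos z}" using w by auto
        then have "pos u \<noteq> pos w" "pos v \<noteq> pos w" using not_xyz[OF uvW(3)] not_xyz[OF uvW(4)] by auto
        moreover have "\<not> (pos u < pos w \<and> pos w < pos v)"
          using nb[of w] w xyzW unfolding sep_def by blast
        ultimately show ?thesis using uv(3) by linarith
      qed
      ultimately show ?thesis unfolding gg_def pl_def place_def by simp
    qed
    show "gg u = gg v \<or> p.triangle_free" if uv: "u \<in> Q i - {a i}" "v \<in> Q i - {a i}" for u v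
    proof (cases "u = v")
      case False
      have "u \<in> W'" "v \<in> W'" using uv QW[OF i] by auto
      then show ?thesis using p.pos_neq[OF _ _ False] eq[of u v] eq[of v u] uv by auto
    qed simp
  qed
  define Ps where "Ps = Q ` {..<m} \<union> (\<lambda>x. {x}) ` X'"
  define Ps0 where "Ps0 = Q ` {..<m} \<union> D' ` {..<1} \<union> (\<lambda>x. {x}) ` X'"
  have X'W: "X' \<subseteq> W'" using X' XW by auto
  have finPs: "finite Ps" unfolding Ps_def using X'W t.finite_V finite_subset by auto
  have D'1: "D' ` {..<1} = {{x, y, z}}" using xyz(1) by (auto simp: lessThan_Suc)
  have sub: "Ps \<subseteq> Ps0" unfolding Ps_def Ps0_def by auto
  define \<phi>0 where "\<phi>0 v = (if v = x then a1 else if v = y then a2 else a3)" for v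
  have ne: "x \<noteq> y" "x \<noteq> z" "y \<noteq> z" using pxyz by auto
  have "\<exists>\<phi>. (\<forall>v\<in>{x, y, z} \<union> \<Union>Ps. \<phi> v \<in> p.slot v) \<and> hom_into ({x, y, z} \<union> \<Union>Ps) (dominates G) E \<phi>"
  proof (rule p.embed_parts[OF finPs sub])
    show "disjoint Ps0" unfolding Ps0_def
    proof (rule disjoint_two_families_and_singletons[OF dQ W0(3)])
      show "(\<Union>i<m. Q i) \<inter> (\<Union>i<1. D' i) = {}" using W0(2) X'(1) by blast
      show "((\<Union>i<m. Q i) \<union> (\<Union>i<1. D' i)) \<inter> X' = {}" using W0(2) X' by blast
    qed
    show "Y \<subseteq> W'" if "Y \<in> Ps0" for Y using that QW xyzW X'W unfolding Ps0_def D'1 by auto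
    show "p.embeddable Y" if "Y \<in> Ps" for Y
      using that emb p.embeddable_singleton X'W unfolding Ps_def by auto
    show "\<exists>Y\<in>Ps0. u \<in> Y \<and> v \<in> Y" if uv: "u \<in> W'" "v \<in> W'" "pos u < pos v" "dominates G v u" for u v
    proof -
      have bk: "(v, u) \<in> backward_arcs G \<theta>" using uv pos unfolding backward_arcs_def by auto
      show ?thesis
      proof (cases "{v, u} \<subseteq> {x, y, z}")
        case True
        then show ?thesis unfolding Ps0_def D'1 by blast
      next
        case False
        then have vu: "v \<in> X" "u \<in> X" using parts[OF bk] by auto
        then have "(v, u) \<in> backward_arcs (subtournament G X) (restrict_ordering \<theta> X)"
          using bk unfolding backward_arcs_def by (auto simp: before_restrict_ordering subtournament_def)
        then obtain i where "i < m" "{v, u} \<subseteq> Q i" using partsX by blast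
        then show ?thesis unfolding Ps0_def by blast
      qed
    qed
    show "{x, y, z} \<subseteq> W'" using xyzW by blast
    show "Y \<inter> {x, y, z} = {}" if "Y \<in> Ps" for Y
      using that W(2) X'(1) unfolding Ps_def by auto
    show "\<forall>v\<in>{x, y, z}. \<phi>0 v \<in> p.slot v"
      using q(4-6) gg_xyz ne unfolding \<phi>0_def p.slot_def rr_def by auto
    show "hom_into {x, y, z} (dominates G) E \<phi>0"
    proof -
      have "\<not> dominates G x y" "\<not> dominates G x z" "\<not> dominates G y z"
        using xyz(4-6) t.total xyzW ne by blast+
      then show ?thesis using q(7-9) ne unfolding hom_into_def \<phi>0_def by simp
    qed
  qed
  moreover have "{x, y, z} \<union> \<Union>Ps = pverts G" unfolding Ps_def W(1) X'(1) by auto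
  ultimately obtain \<phi> where "\<forall>v\<in>pverts G. \<phi> v \<in> p.slot v" "hom_into (pverts G) (dominates G) E \<phi>"
    by metis
  moreover from this have "\<phi> ` pverts G \<subseteq> V" using p.slot_sub unfolding W'_def by blast
  ultimately show ?thesis by blast
qed

end

section \<open>The Erd\H{o}s--Hajnal property\<close>

lemma contains_if_hom_into:
  assumes T: "tournament T" and H: "tournament H"
    and \<phi>: "\<phi> ` pverts H \<subseteq> pverts T" "hom_into (pverts H) (dominates H) (dominates T) \<phi>"
  shows "contains T H"
proof -
  interpret t: tournament_arcs "pverts T" "dominates T" using T by (rule tournament_arcs_dominates)
  interpret h: tournament_arcs "pverts H" "dominates H" using H by (rule tournament_arcs_dominates)
  interpret H: tournament H by fact
  have in_T: "\<phi> u \<in> pverts T" if "u \<in> pverts H" for u using \<phi>(1) that by blast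
  have hom: "dominates T (\<phi> u) (\<phi> v)" if "u \<in> pverts H" "v \<in> pverts H" "dominates H u v" for u v
  proof -
    have "u \<noteq> v" using that h.irrefl by auto
    then show ?thesis using \<phi>(2) that unfolding hom_into_def by simp
  qed
  have inj: "inj_on \<phi> (pverts H)"
  proof (rule inj_onI, rule ccontr)
    fix u v assume uv: "u \<in> pverts H" "v \<in> pverts H" "\<phi> u = \<phi> v" "u \<noteq> v"
    then have "dominates H u v \<or> dominates H v u" using h.total by blast
    then show False using hom[of u v] hom[of v u] uv t.irrefl[OF in_T[OF uv(1)]] by auto
  qed
  have hom_iff: "dominates T (\<phi> u) (\<phi> v) \<longleftrightarrow> dominates H u v" if uv: "u \<in> pverts H" "v \<in> pverts H" for u v
  proof (cases "u = v")
    case True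
    then show ?thesis using t.irrefl[OF in_T[OF uv(1)]] h.irrefl uv by auto
  next
    case False
    then have "\<phi> u \<noteq> \<phi> v" using inj uv by (metis inj_onD)
    then show ?thesis
      using hom[OF uv] hom[OF uv(2,1)] h.total[OF uv False] t.total[OF in_T[OF uv(1)] in_T[OF uv(2)]] by blast
  qed
  define f where "f = \<lparr>iso_verts = \<phi>, iso_arcs = map_prod \<phi> \<phi>, iso_head = snd, iso_tail = fst\<rparr>"
  have "pre_digraph.digraph_isomorphism (with_proj H) f"
    unfolding pre_digraph.digraph_isomorphism_def
  proof (intro conjI)
    show "wf_digraph (with_proj H)" by (rule H.wf_digraph_axioms)
    show "inj_on (iso_arcs f) (arcs (with_proj H))"
    proof (rule inj_onI)
      fix e e' assume e: "e \<in> arcs (with_proj H)" "e' \<in> arcs (with_proj H)" "iso_arcs f e = iso_arcs f e'"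
      obtain u v u' v' where uv: "e = (u, v)" "e' = (u', v')" by (cases e; cases e')
      then have "u \<in> pverts H" "v \<in> pverts H" "u' \<in> pverts H" "v' \<in> pverts H"
        using e H.in_arcsD1 H.in_arcsD2 by auto
      moreover have "\<phi> u = \<phi> u'" "\<phi> v = \<phi> v'" using e(3) uv unfolding f_def by auto
      ultimately show "e = e'" using inj_onD[OF inj] uv by blast
    qed
  qed (use inj in \<open>auto simp: f_def\<close>)
  moreover have "with_proj (subtournament T (\<phi> ` pverts H)) = app_iso f (with_proj H)"
  proof -
    have "parcs T \<inter> \<phi> ` pverts H \<times> \<phi> ` pverts H = map_prod \<phi> \<phi> ` parcs H"
    proof (intro equalityI subsetI)
      fix e assume "e \<in> parcs T \<inter> \<phi> ` pverts H \<times> \<phi> ` pverts H"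
      then obtain u v where "u \<in> pverts H" "v \<in> pverts H" "e = (\<phi> u, \<phi> v)" "dominates T (\<phi> u) (\<phi> v)"
        by auto
      then have "(u, v) \<in> parcs H" "e = map_prod \<phi> \<phi> (u, v)" using hom_iff by auto
      then show "e \<in> map_prod \<phi> \<phi> ` parcs H" by blast
    next
      fix e assume "e \<in> map_prod \<phi> \<phi> ` parcs H"
      then obtain u v where "(u, v) \<in> parcs H" "e = (\<phi> u, \<phi> v)" by auto
      then show "e \<in> parcs T \<inter> \<phi> ` pverts H \<times> \<phi> ` pverts H"
        using hom H.in_arcsD1 H.in_arcsD2 by auto
    qed
    then show ?thesis by (simp add: app_iso_def with_proj_def subtournament_def f_def)
  qed
  ultimately show ?thesis unfolding contains_def digraph_iso_def using \<phi>(1) by blast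
qed

lemma transitive_tournament_subtournament:
  assumes T: "tournament T" and X: "X \<subseteq> pverts T" "transp_on X (dominates T)"
  shows "transitive_tournament (subtournament T X)"
proof -
  interpret T: tournament T by fact
  let ?S = "subtournament T X"
  have S: "tournament ?S"
  proof
    show "finite (pverts ?S)" "finite (parcs ?S)"
      using finite_subset[OF X(1) T.pair_finite_verts] T.pair_finite_arcs
      by (auto simp: subtournament_def)
    show "fst e \<in> pverts ?S" "snd e \<in> pverts ?S" if "e \<in> parcs ?S" for e
      using that by (auto simp: subtournament_def)
    show "fst e \<noteq> snd e" if "e \<in> parcs ?S" for e
      using that T.pair_no_loops by (auto simp: subtournament_def)
    show "(u, v) \<in> parcs ?S \<longleftrightarrow> (v, u) \<notin> parcs ?S" if "u \<in> pverts ?S" "v \<in> pverts ?S" "u \<noteq> v" for u v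
      using that X(1) T.exactly_one_arc[of u v] by (auto simp: subtournament_def)
  qed
  have walk: "dominates T u v \<and> u \<in> X \<and> v \<in> X" if "set p \<subseteq> parcs ?S" "pcas u p v" "p \<noteq> []" for u p v
    using that
  proof (induction p arbitrary: u)
    case (Cons e p)
    then have e: "dominates T u (snd e)" "u \<in> X" "snd e \<in> X"
      by (cases e; auto simp: subtournament_def)+
    show ?case
    proof (cases "p = []")
      case True
      then show ?thesis using Cons.prems e by auto
    next
      case False
      then have "dominates T (snd e) v \<and> snd e \<in> X \<and> v \<in> X" using Cons by auto
      then show ?thesis using e transp_onD[OF X(2)] by blast
    qed
  qed simp
  have "\<not> pre_digraph.cycle (with_proj ?S) p" for p
  proof
    assume "pre_digraph.cycle (with_proj ?S) p"
    then obtain u where "set p \<subseteq> parcs ?S" "pcas u p u" "p \<noteq> []"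
      unfolding pre_digraph.cycle_def pre_digraph.awalk_def by (auto simp: cas_with_proj_eq)
    then have "dominates T u u" using walk by blast
    then show False using T.pair_no_loops by fastforce
  qed
  then show ?thesis using S unfolding transitive_tournament_def by blast
qed

theorem theorem2:
  fixes N :: "'a pair_pre_digraph" and G :: "'b pair_pre_digraph"
  assumes "super_nebula N" and "Delta_galaxy G"
  shows "\<exists>\<epsilon>::real. \<epsilon> > 0 \<and>
    (\<forall>T :: 'c pair_pre_digraph. tournament T \<and> \<not> contains T N \<and> \<not> contains T G \<longrightarrow>
      (\<exists>X \<subseteq> pverts T. transitive_tournament (subtournament T X) \<and>
        real (card X) \<ge> real (card (pverts T)) powr \<epsilon>))"
proof -
  have tN: "tournament N"
    using assms(1) unfolding super_nebula_def tournament_ordering_def by blast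
  have tG: "tournament G"
    using assms(2) unfolding Delta_galaxy_def triangular_galaxy_def tournament_ordering_def by blast
  interpret G: tournament_arcs "pverts G" "dominates G" using tG by (rule tournament_arcs_dominates)
  define nN nG where "nN = card (pverts N)" and "nG = card (pverts G)"
  define L where "L = 2 * nG + 4"
  define loc where "loc g = L * g + (2 * nG + 2) + g mod 2" for g
  define k where "k = L * (2 * nN + 2)"
  define P where "P = nN + nG + 1"
  define D where "D = 2 * (nN + nG) + 1"
  define K where "K = 4 * (nN + nG) + 4"
  have "0 < D" "0 < P" "0 < K" "2 \<le> k" unfolding D_def P_def K_def k_def L_def by auto
  from grid_exists[OF G.finite_V asymp_on_dominates[OF tG] this, where ?'c = 'c]
  obtain \<epsilon> :: real where "0 < \<epsilon>" and grids: "\<forall>(V :: 'c set) E. tournament_arcs V E \<longrightarrow>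
    (\<nexists>\<phi>. \<phi> ` pverts G \<subseteq> V \<and> hom_into (pverts G) (dominates G) E \<phi>) \<longrightarrow>
    (\<forall>W. W \<subset> V \<longrightarrow> (\<exists>X\<subseteq>W. transp_on X E \<and> real (card W) powr \<epsilon> \<le> real (card X))) \<longrightarrow>
    (\<forall>X\<subseteq>V. transp_on X E \<longrightarrow> real (card X) < real (card V) powr \<epsilon>) \<longrightarrow>
    (\<exists>F. grid V E F k P D K)"
    by (elim exE conjE) (rule that)
  have loc_less: "loc g < L * Suc g" for g
    unfolding loc_def L_def by (simp add: algebra_simps)
  have Lg: "L * Suc g \<le> L * g'" if "g < g'" for g g' using that by (intro mult_le_mono2) simp
  have loc_ge: "L * g + 2 * nG \<le> loc g" for g unfolding loc_def by simp
  have mono: "strict_mono loc"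
  proof (rule strict_monoI)
    fix g g' :: nat assume "g < g'"
    then show "loc g < loc g'" using loc_less[of g] Lg[of g g'] loc_ge[of g'] by linarith
  qed
  have parity: "even (loc g) \<longleftrightarrow> even g" for g
    unfolding loc_def L_def by (cases "even g") (auto simp: odd_iff_mod_2_eq_one)
  have "\<exists>X\<subseteq>W. transp_on X (dominates T) \<and> real (card W) powr \<epsilon> \<le> real (card X)"
    if T: "tournament T" and noN: "\<not> contains T N" and noG: "\<not> contains T G" and W: "W \<subseteq> pverts T"
    for T :: "'c pair_pre_digraph" and W
  proof -
    interpret T: tournament_arcs "pverts T" "dominates T" using T by (rule tournament_arcs_dominates)
    have "finite W" using W T.finite_sub by blast
    then show ?thesis using W
    proof (induction W rule: finite_psubset_induct)
      case (psubset W)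
      show ?case
      proof (rule ccontr)
        assume "\<not> ?thesis"
        then have small: "\<forall>X\<subseteq>W. transp_on X (dominates T) \<longrightarrow> real (card X) < real (card W) powr \<epsilon>"
          by (meson not_less)
        have noG': "\<nexists>\<phi>. \<phi> ` pverts G \<subseteq> W \<and> hom_into (pverts G) (dominates G) (dominates T) \<phi>"
          using contains_if_hom_into[OF T tG] noG psubset.prems by blast
        have noN': "\<nexists>\<phi>. \<phi> ` pverts N \<subseteq> W \<and> hom_into (pverts N) (dominates N) (dominates T) \<phi>"
          using contains_if_hom_into[OF T tN] noN psubset.prems by blast
        have ih: "\<forall>W'. W' \<subset> W \<longrightarrow>
            (\<exists>X\<subseteq>W'. transp_on X (dominates T) \<and> real (card W') powr \<epsilon> \<le> real (card X))"
          using psubset.IH psubset.prems by blast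
        obtain F where "grid W (dominates T) F k P D K"
          using grids[rule_format, OF T.restricted[OF psubset.prems] noG'] ih small by blast
        then interpret g: grid W "dominates T" F k P D K .
        have "loc (2 * card (pverts N)) \<le> k"
          using loc_less[of "2 * nN"] unfolding k_def nN_def by (simp add: algebra_simps)
        moreover have "card (pverts N) \<le> P" "2 * card (pverts N) \<le> D" "4 * card (pverts N) + 4 \<le> K"
          unfolding P_def D_def K_def nN_def by auto
        ultimately obtain g1 g2 g3 r1 r2 r3 a b c where
          g: "g1 < g2" "g2 < g3" "g3 < 2 * nN" "r1 < P" "r2 < P" "r3 < P"
            "a \<in> F (loc g1) r1" "b \<in> F (loc g2) r2" "c \<in> F (loc g3) r3"
            "dominates T b a" "dominates T c a" "dominates T c b"
          using g.super_nebula_or_triangle[OF assms(1) mono parity] noN' unfolding nN_def by blast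
        have "\<exists>\<phi>. \<phi> ` pverts G \<subseteq> W \<and> hom_into (pverts G) (dominates G) (dominates T) \<phi>"
        proof (rule g.Delta_galaxy_completion[OF assms(2) g(4-12)])
          show "even (L * Suc g1)" "even (L * Suc g2)" "even (L * Suc g3)" unfolding L_def by auto
          show "2 * card (pverts G) \<le> loc g1" using loc_ge[of g1] unfolding nG_def by linarith
          show "loc g1 < L * Suc g1" "loc g2 < L * Suc g2" "loc g3 < L * Suc g3" by (rule loc_less)+
          show "L * Suc g1 + 2 * card (pverts G) \<le> loc g2"
            using Lg[OF g(1)] loc_ge[of g2] unfolding nG_def by linarith
          show "L * Suc g2 + 2 * card (pverts G) \<le> loc g3"
            using Lg[OF g(2)] loc_ge[of g3] unfolding nG_def by linarith
          show "L * Suc g3 + 2 * card (pverts G) \<le> k"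
            using Lg[OF g(3)] unfolding k_def L_def nG_def by (simp add: algebra_simps)
          show "card (pverts G) \<le> P" "2 * card (pverts G) \<le> D" "4 * card (pverts G) + 4 \<le> K"
            unfolding P_def D_def K_def nG_def by auto
        qed
        then show False using noG' by blast
      qed
    qed
  qed
  then have "\<exists>X\<subseteq>pverts T. transitive_tournament (subtournament T X) \<and>
      real (card (pverts T)) powr \<epsilon> \<le> real (card X)"
    if "tournament T" "\<not> contains T N" "\<not> contains T G" for T :: "'c pair_pre_digraph"
    using transitive_tournament_subtournament[OF that(1)] that by blast
  then show ?thesis using \<open>0 < \<epsilon>\<close> by blast
qed

end
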